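(* There exist absolute constants $C>0$ and $\kappa>0$ such that the following holds for every $d\in\mathbb{Z}_+$, every $c\in(0,1)$, every $\sigma\ge0$, every $\eta\in[\frac{2+c}{d},\frac{4}{\sqrt d}]$ and every $b\ge0$. For every (possibly randomized) algorithm $\mathcal{A}$ that takes as input $\eta,\sigma,b$ and $n$ labeled examples in $(\mathbb{R}\cup\{\perp\})^d\times(\mathbb{R}\cup\{\perp\})$ and outputs $\hat\beta\in\mathbb{R}^d$, there exist $\beta\in\mathbb{R}^d$ with $\|\beta\|=b$ and an adversary as in the coordinate-wise missing data model such that, when $\mathcal{A}$ is run on $\eta,\sigma,b$ and the $\eta$-coordinate-wise incomplete version of $n$ i.i.d. samples from the linear regression model with regressor $\beta$ and noise level $\sigma$, its output satisfies $$\|\hat\beta-\beta\|\ \ge\ \eta\,\frac{c\sqrt d}{C}\,\|\beta\|$$ with probability at least $\tfrac12\big(1-(d+1)e^{-\kappa c^2\eta n}\big)$.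
   Context: Linear regression model with regressor $\beta\in\mathbb{R}^d$ and noise level $\sigma\ge 0$: a labeled example $(X,y)$ with $X\sim\mathcal{N}(0,I_d)$ and $y=\beta^\top X+\xi$, where $\xi\sim\mathcal{N}(0,\sigma^2)$ is independent of $X$ ($\xi=0$ if $\sigma=0$). Coordinate-wise missing data model with rate $\eta\in[0,1]$: given a set $S=\{(X^{(i)},y^{(i)})\}_{i\in[n]}$ of $n$ i.i.d. labeled examples, an adversary (possibly randomized) inspects all of $S$ and, for each coordinate $j\in[d]$, may replace the $j$-th coordinate of at most $\eta n$ of the vectors $X^{(i)}$ by the symbol $\perp$, and may replace at most $\eta n$ of the labels $y^{(i)}$ by $\perp$; the resulting dataset is given to the algorithm. Probabilities are over the samples and the randomness of the adversary and the algorithm. *)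

theory Defs
  imports "HOL-Probability.Probability"
begin

text \<open>Vectors in R^d are functions nat => real, only coordinates j < d matter.
  Missing entries (the symbol bottom) are encoded as None in real option.\<close>

definition vnorm :: "nat \<Rightarrow> (nat \<Rightarrow> real) \<Rightarrow> real" where
  "vnorm d v = sqrt (\<Sum>j<d. (v j)\<^sup>2)"

definition vec_space :: "nat \<Rightarrow> (nat \<Rightarrow> real) measure" where
  "vec_space d = PiM {..<d} (\<lambda>_. (borel :: real measure))"

definition std_gauss :: "real measure" where
  "std_gauss = density lborel std_normal_density"

definition noise_dist :: "real \<Rightarrow> real measure" where
  "noise_dist \<sigma> = (if \<sigma> = 0 then return borel 0 else density lborel (normal_density 0 \<sigma>))"

definition lr_example :: "nat \<Rightarrow> (nat \<Rightarrow> real) \<Rightarrow> real \<Rightarrow> ((nat \<Rightarrow> real) \<times> real) measure" where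
  "lr_example d \<beta> \<sigma> =
     distr (PiM {..<d} (\<lambda>_. std_gauss) \<Otimes>\<^sub>M noise_dist \<sigma>)
           (vec_space d \<Otimes>\<^sub>M (borel :: real measure))
           (\<lambda>(x, \<xi>). (x, (\<Sum>j<d. \<beta> j * x j) + \<xi>))"

definition sample_space :: "nat \<Rightarrow> nat \<Rightarrow> (nat \<Rightarrow> real) \<Rightarrow> real \<Rightarrow> (nat \<Rightarrow> (nat \<Rightarrow> real) \<times> real) measure" where
  "sample_space d n \<beta> \<sigma> = PiM {..<n} (\<lambda>_. lr_example d \<beta> \<sigma>)"

definition opt_borel :: "real option measure" where
  "opt_borel = sigma UNIV ({Some ` B | B. B \<in> sets (borel :: real measure)} \<union> {{None}})"

definition data_space :: "nat \<Rightarrow> nat \<Rightarrow> (nat \<Rightarrow> (nat \<Rightarrow> real option) \<times> real option) measure" where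
  "data_space d n = PiM {..<n} (\<lambda>_. PiM {..<d} (\<lambda>_. opt_borel) \<Otimes>\<^sub>M opt_borel)"

definition is_corruption ::
  "nat \<Rightarrow> nat \<Rightarrow> real \<Rightarrow> (nat \<Rightarrow> (nat \<Rightarrow> real) \<times> real) \<Rightarrow> (nat \<Rightarrow> (nat \<Rightarrow> real option) \<times> real option) \<Rightarrow> bool" where
  "is_corruption d n \<eta> s D \<longleftrightarrow>
     D \<in> space (data_space d n) \<and>
     (\<forall>i<n. \<forall>j<d. fst (D i) j \<in> {Some (fst (s i) j), None}) \<and>
     (\<forall>i<n. snd (D i) \<in> {Some (snd (s i)), None}) \<and>
     (\<forall>j<d. real (card {i. i < n \<and> fst (D i) j = None}) \<le> \<eta> * real n) \<and>
     real (card {i. i < n \<and> snd (D i) = None}) \<le> \<eta> * real n"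

definition cw_adversary ::
  "nat \<Rightarrow> nat \<Rightarrow> real \<Rightarrow> (nat \<Rightarrow> real) \<Rightarrow> real \<Rightarrow>
   ((nat \<Rightarrow> (nat \<Rightarrow> real) \<times> real) \<Rightarrow> (nat \<Rightarrow> (nat \<Rightarrow> real option) \<times> real option) measure) \<Rightarrow> bool" where
  "cw_adversary d n \<eta> \<beta> \<sigma> Adv \<longleftrightarrow>
     Adv \<in> measurable (sample_space d n \<beta> \<sigma>) (subprob_algebra (data_space d n)) \<and>
     (\<forall>s \<in> space (sample_space d n \<beta> \<sigma>).
        prob_space (Adv s) \<and> (AE D in Adv s. is_corruption d n \<eta> s D))"

definition randomized_alg ::
  "nat \<Rightarrow> nat \<Rightarrow> ((nat \<Rightarrow> (nat \<Rightarrow> real option) \<times> real option) \<Rightarrow> (nat \<Rightarrow> real) measure) \<Rightarrow> bool" where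
  "randomized_alg d n A \<longleftrightarrow>
     A \<in> measurable (data_space d n) (subprob_algebra (vec_space d)) \<and>
     (\<forall>D \<in> space (data_space d n). prob_space (A D))"

definition output_law ::
  "nat \<Rightarrow> nat \<Rightarrow> (nat \<Rightarrow> real) \<Rightarrow> real \<Rightarrow>
   ((nat \<Rightarrow> (nat \<Rightarrow> real) \<times> real) \<Rightarrow> (nat \<Rightarrow> (nat \<Rightarrow> real option) \<times> real option) measure) \<Rightarrow>
   ((nat \<Rightarrow> (nat \<Rightarrow> real option) \<times> real option) \<Rightarrow> (nat \<Rightarrow> real) measure) \<Rightarrow> (nat \<Rightarrow> real) measure" where
  "output_law d n \<beta> \<sigma> Adv A = bind (sample_space d n \<beta> \<sigma>) (\<lambda>s. bind (Adv s) A)"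

end

theory Submission
  imports Defs
begin

text \<open>Let \<open>e\<close>, \<open>e'\<close> be orthonormal vectors all of whose entries are of order \<open>1 / sqrt d\<close>, and let
  \<open>\<beta> = b e\<close> and \<open>\<beta>'\<close> be its rotation in the plane of \<open>e\<close>, \<open>e'\<close> by an angle of order
  \<open>\<eta> c sqrt d\<close>. If \<open>X\<close> is standard Gaussian and \<open>R\<close> is this rotation, then \<open>R X\<close> is standard
  Gaussian, \<open>\<beta>' \<bullet> R X = \<beta> \<bullet> X\<close>, and each coordinate of \<open>R X - X\<close> is of order \<open>\<eta> c\<close>. Delete two
  random sink coordinates, chosen so that every coordinate is a sink with probability at most
  \<open>2 / d\<close>. Each other coordinate \<open>s\<close> is now moved from \<open>(R X)\<^sub>s\<close> back to \<open>X\<^sub>s\<close> along the direction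
  supported on \<open>s\<close> and the sinks that is orthogonal to \<open>e\<close> and \<open>e'\<close>. A reflection coupling makes
  this move preserve the Gaussian law, and it fails with probability of order \<open>\<eta> c\<close>. The resulting
  vector \<open>Z\<close> is standard Gaussian, satisfies \<open>\<beta>' \<bullet> Z = \<beta> \<bullet> X\<close>, and differs from \<open>X\<close> in any given
  coordinate with probability at most \<open>\<eta> (1 - c / 6)\<close>. An adversary that deletes the differing
  coordinates makes \<open>\<beta>\<close> and \<open>\<beta>'\<close> indistinguishable; by a Chernoff bound it respects its budget with
  the claimed probability. Labels need not be deleted. If \<open>d \<le> 2\<close>, then \<open>\<eta> > 1\<close> and all entries may
  be deleted.\<close>

section \<open>Gaussian vectors and integration along lines\<close>


text \<open>Three coordinates against two linear constraints leave one direction; this is why two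
  sinks are deleted, and why the theorem asks for \<eta> d \<ge> 2 + c. The sinks use up 2 / d \<le>
  \<eta> (1 - c / 3) of the budget. Of the remaining \<eta> c / 3, at most one half pays for
  rejected moves, and the other half is the slack of the Chernoff bound. The obstacle is that
  coordinate \<open>s\<close> must return to exactly its old value while the vector stays Gaussian,
  although the required displacement depends on \<open>X\<close>. The displacement is a linear
  function of the values of \<open>e\<close> and \<open>e'\<close> at \<open>R X\<close>, which no
  move changes. So it can be read off the current vector, and it is constant along the line of the
  move. On each line one has to couple a standard Gaussian with its translate by a known amount, and
  this fails with probability of the order of the displacement.\<close>

definition lin :: "nat \<Rightarrow> (nat \<Rightarrow> real) \<Rightarrow> (nat \<Rightarrow> real) \<Rightarrow> real" where
  "lin d w z = (\<Sum>j<d. w j * z j)"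

text \<open>The restriction to \<open>{..<d}\<close> keeps the result in the extensional space
  underlying \<open>vec_space d\<close>, whatever \<open>z\<close> is.\<close>

definition move :: "nat \<Rightarrow> (nat \<Rightarrow> real) \<Rightarrow> real \<Rightarrow> (nat \<Rightarrow> real) \<Rightarrow> nat \<Rightarrow> real" where
  "move d w l z = (\<lambda>j\<in>{..<d}. z j + l * w j)"

abbreviation gauss_vec :: "nat \<Rightarrow> (nat \<Rightarrow> real) measure" where
  "gauss_vec d \<equiv> PiM {..<d} (\<lambda>_. std_gauss)"

lemma move_apply [simp]: "j < d \<Longrightarrow> move d w l z j = z j + l * w j"
  by (simp add: move_def)

lemma lin_move [simp]: "lin d v (move d w l z) = lin d v z + l * lin d v w"
  by (simp add: lin_def distrib_left sum.distrib sum_distrib_left mult_ac)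

lemma move_move: "move d w k (move d w l z) = move d w (k + l) z"
  by (auto simp: move_def fun_eq_iff algebra_simps)

lemma space_vec_space: "space (vec_space d) = {..<d} \<rightarrow>\<^sub>E UNIV"
  by (simp add: vec_space_def space_PiM)

lemma move_in_space [simp]: "move d w l z \<in> space (vec_space d)"
  by (simp add: space_vec_space move_def)

lemma measurable_component_vec:
  "j < d \<Longrightarrow> (\<lambda>z. z j) \<in> borel_measurable (vec_space d)"
  unfolding vec_space_def by measurable

lemma measurable_lin [measurable]: "lin d w \<in> borel_measurable (vec_space d)"
  unfolding lin_def by (intro borel_measurable_sum borel_measurable_times measurable_component_vec) auto

lemma measurable_move [measurable (raw)]:
  assumes [measurable]: "f \<in> borel_measurable M" "g \<in> measurable M (vec_space d)"
  shows "(\<lambda>x. move d w (f x) (g x)) \<in> measurable M (vec_space d)"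
proof -
  have [measurable]: "(\<lambda>x. g x j) \<in> borel_measurable M" if "j < d" for j
    using measurable_compose[OF assms(2) measurable_component_vec[OF that]] .
  show ?thesis
    unfolding move_def vec_space_def by measurable
qed

lemma sets_std_gauss [simp, measurable_cong]: "sets std_gauss = sets borel"
  by (simp add: std_gauss_def)

lemma space_std_gauss [simp]: "space std_gauss = UNIV"
  by (simp add: std_gauss_def)

lemma prob_space_std_gauss: "prob_space std_gauss"
  unfolding std_gauss_def by (rule prob_space_normal_density) simp

lemma sets_gauss_vec [simp, measurable_cong]: "sets (gauss_vec d) = sets (vec_space d)"
  unfolding vec_space_def by (intro sets_PiM_cong) auto

lemma prob_space_gauss_vec: "prob_space (gauss_vec d)"
  by (intro prob_space_PiM prob_space_std_gauss)

section \<open>Lebesgue measure on the vector space and its invariance under moves\<close>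

abbreviation leb_vec :: "nat \<Rightarrow> (nat \<Rightarrow> real) measure" where
  "leb_vec d \<equiv> PiM {..<d} (\<lambda>_. lborel)"

lemma sets_leb_vec [simp, measurable_cong]: "sets (leb_vec d) = sets (vec_space d)"
  unfolding vec_space_def by (intro sets_PiM_cong) auto

lemma space_leb_vec: "space (leb_vec d) = space (vec_space d)"
  using sets_eq_imp_space_eq[OF sets_leb_vec] .

lemma sigma_finite_leb_vec: "sigma_finite_measure (leb_vec d)"
proof -
  interpret product_sigma_finite "\<lambda>_::nat. lborel :: real measure" by standard
  show ?thesis by (rule sigma_finite) simp
qed

lemma emeasure_lborel_translate:
  fixes t :: real
  assumes [measurable]: "A \<in> sets borel"
  shows "emeasure lborel ((\<lambda>x. x + t) -` A) = emeasure lborel A"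
proof -
  have "emeasure lborel A = emeasure (distr lborel borel ((+) t)) A"
    by (simp add: lborel_distr_plus)
  also have "\<dots> = emeasure lborel ((+) t -` A)"
    by (subst emeasure_distr) auto
  also have "(+) t -` A = (\<lambda>x. x + t) -` A" by (auto simp: add.commute)
  finally show ?thesis by simp
qed

lemma distr_leb_vec_move: "distr (leb_vec d) (vec_space d) (move d w l) = leb_vec d"
proof -
  interpret product_sigma_finite "\<lambda>_::nat. lborel :: real measure" by standard
  have m [measurable]: "move d w l \<in> measurable (leb_vec d) (vec_space d)"
    by measurable
  show ?thesis
  proof (rule PiM_eqI)
    fix A :: "nat \<Rightarrow> real set"
    assume A: "\<And>i. i \<in> {..<d} \<Longrightarrow> A i \<in> sets lborel"
    have *: "move d w l -` Pi\<^sub>E {..<d} A \<inter> space (leb_vec d)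
        = Pi\<^sub>E {..<d} (\<lambda>j. (\<lambda>x. x + l * w j) -` A j)"
      by (auto simp: space_PiM move_def PiE_iff)
    have "Pi\<^sub>E {..<d} A \<in> sets (vec_space d)"
      unfolding vec_space_def using A by (intro sets_PiM_I_finite) auto
    then have "emeasure (distr (leb_vec d) (vec_space d) (move d w l)) (Pi\<^sub>E {..<d} A)
       = emeasure (leb_vec d) (Pi\<^sub>E {..<d} (\<lambda>j. (\<lambda>x. x + l * w j) -` A j))"
      by (subst emeasure_distr) (auto simp: *)
    also have "\<dots> = (\<Prod>j<d. emeasure lborel ((\<lambda>x. x + l * w j) -` A j))"
      using A by (intro emeasure_PiM) (auto intro!: measurable_sets_borel[of _ borel])
    also have "\<dots> = (\<Prod>j<d. emeasure lborel (A j))"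
      using A by (intro prod.cong) (auto intro!: emeasure_lborel_translate)
    finally show "emeasure (distr (leb_vec d) (vec_space d) (move d w l)) (Pi\<^sub>E {..<d} A)
       = (\<Prod>j<d. emeasure lborel (A j))" .
  qed (auto)
qed

lemma nn_integral_leb_vec_move:
  assumes [measurable]: "G \<in> borel_measurable (vec_space d)"
  shows "(\<integral>\<^sup>+z. G (move d w l z) \<partial>leb_vec d) = (\<integral>\<^sup>+z. G z \<partial>leb_vec d)"
proof -
  have "(\<integral>\<^sup>+z. G z \<partial>leb_vec d) = (\<integral>\<^sup>+z. G z \<partial>distr (leb_vec d) (vec_space d) (move d w l))"
    by (simp add: distr_leb_vec_move)
  also have "\<dots> = (\<integral>\<^sup>+z. G (move d w l z) \<partial>leb_vec d)"
    by (subst nn_integral_distr) auto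
  finally show ?thesis by simp
qed

section \<open>The Gaussian density and its restriction to lines\<close>

definition gauss_dens :: "nat \<Rightarrow> (nat \<Rightarrow> real) \<Rightarrow> real" where
  "gauss_dens d z = (\<Prod>j<d. std_normal_density (z j))"

lemma measurable_gauss_dens [measurable]: "gauss_dens d \<in> borel_measurable (vec_space d)"
  unfolding gauss_dens_def
  by (intro borel_measurable_prod measurable_compose[OF measurable_component_vec]) auto

text \<open>A product measure is determined by boxes, and on a box the density and the indicator
  both factor into one-variable terms.\<close>

lemma gauss_vec_density: "gauss_vec d = density (leb_vec d) (\<lambda>z. ennreal (gauss_dens d z))"
proof -
  interpret product_sigma_finite "\<lambda>_::nat. lborel :: real measure" by standard
  interpret g: prob_space std_gauss by (rule prob_space_std_gauss)
  interpret G: product_sigma_finite "\<lambda>_::nat. std_gauss" by standard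
  have "density (leb_vec d) (\<lambda>z. ennreal (gauss_dens d z)) = gauss_vec d"
  proof (rule G.PiM_eqI)
    fix A :: "nat \<Rightarrow> real set"
    assume "\<And>i. i \<in> {..<d} \<Longrightarrow> A i \<in> sets std_gauss"
    then have A [measurable]: "\<And>i. i < d \<Longrightarrow> A i \<in> sets borel" by simp
    have AA [measurable]: "Pi\<^sub>E {..<d} A \<in> sets (vec_space d)"
      unfolding vec_space_def using A by (intro sets_PiM_I_finite) auto
    have ind: "indicator (Pi\<^sub>E {..<d} A) z = (\<Prod>j<d. indicator (A j) (z j) :: ennreal)"
      if "z \<in> space (leb_vec d)" for z
      using that by (auto simp: space_PiM PiE_iff indicator_def)
    have "emeasure (density (leb_vec d) (\<lambda>z. ennreal (gauss_dens d z))) (Pi\<^sub>E {..<d} A)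
      = (\<integral>\<^sup>+z. ennreal (gauss_dens d z) * indicator (Pi\<^sub>E {..<d} A) z \<partial>leb_vec d)"
      by (subst emeasure_density) auto
    also have "\<dots> = (\<integral>\<^sup>+z. (\<Prod>j<d. ennreal (std_normal_density (z j)) * indicator (A j) (z j)) \<partial>leb_vec d)"
      by (intro nn_integral_cong) (simp add: ind gauss_dens_def prod_ennreal[symmetric] prod.distrib)
    also have "\<dots> = (\<Prod>j<d. \<integral>\<^sup>+x. ennreal (std_normal_density x) * indicator (A j) x \<partial>lborel)"
      by (intro product_nn_integral_prod) auto
    also have "\<dots> = (\<Prod>j<d. emeasure std_gauss (A j))"
      unfolding std_gauss_def by (intro prod.cong) (auto simp: emeasure_density)
    finally show "emeasure (density (leb_vec d) (\<lambda>z. ennreal (gauss_dens d z))) (Pi\<^sub>E {..<d} A)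
      = (\<Prod>j<d. emeasure std_gauss (A j))" .
  qed auto
  then show ?thesis by simp
qed

text \<open>The squared length minus the squared component along the unit vector \<open>w\<close>
  does not change along a line in direction \<open>w\<close>. So the Gaussian density is a
  one-dimensional density in that component times a factor that is constant on the line; the
  identity is this factorization with the denominators cleared.\<close>

lemma gauss_dens_move:
  assumes "lin d w w = 1"
  shows "gauss_dens d (move d w l z) * std_normal_density (lin d w z)
       = gauss_dens d z * std_normal_density (lin d w z + l)"
proof -
  have q: "(\<Sum>j<d. (z j + l * w j)\<^sup>2) + (lin d w z)\<^sup>2 = (\<Sum>j<d. (z j)\<^sup>2) + (lin d w z + l)\<^sup>2"
  proof -
    have "(\<Sum>j<d. (z j + l * w j)\<^sup>2) = (\<Sum>j<d. (z j)\<^sup>2) + 2 * l * lin d w z + l\<^sup>2 * lin d w w"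
      by (simp add: power2_sum lin_def sum.distrib sum_distrib_left power2_eq_square algebra_simps)
    then show ?thesis using assms by (simp add: power2_eq_square algebra_simps)
  qed
  have g: "gauss_dens d x = (1 / sqrt (2 * pi)) ^ d * exp (\<Sum>j<d. - (x j)\<^sup>2 / 2)" for x
    by (simp add: gauss_dens_def std_normal_density_def exp_sum power_divide prod_dividef)
  have s: "(\<Sum>j<d. - (x j)\<^sup>2 / 2) = - (\<Sum>j<d. (x j)\<^sup>2) / 2" for x :: "nat \<Rightarrow> real"
    by (simp add: sum_divide_distrib sum_negf)
  have e: "exp (\<Sum>j<d. - (move d w l z j)\<^sup>2 / 2) * exp (- (lin d w z)\<^sup>2 / 2)
     = exp (\<Sum>j<d. - (z j)\<^sup>2 / 2) * exp (- (lin d w z + l)\<^sup>2 / 2)"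
    unfolding exp_add[symmetric] s
    by (rule arg_cong[where f = exp]) (use q in \<open>simp add: field_simps\<close>)
  show "gauss_dens d (move d w l z) * std_normal_density (lin d w z)
       = gauss_dens d z * std_normal_density (lin d w z + l)"
    unfolding g std_normal_density_def using e by (simp add: algebra_simps)
qed

text \<open>Weighting each point of a line by a density along that line turns an integral over the space
  into an average of its line integrals.\<close>

lemma nn_integral_leb_vec_eq_of_lines:
  assumes w: "lin d w w = 1"
  assumes [measurable]: "G \<in> borel_measurable (vec_space d)" "H \<in> borel_measurable (vec_space d)"
  assumes eq: "\<And>z. z \<in> space (vec_space d) \<Longrightarrow>
    (\<integral>\<^sup>+l. G (move d w l z) \<partial>lborel) = (\<integral>\<^sup>+l. H (move d w l z) \<partial>lborel)"
  shows "(\<integral>\<^sup>+z. G z \<partial>leb_vec d) = (\<integral>\<^sup>+z. H z \<partial>leb_vec d)"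
proof -
  \<comment> \<open>Any probability density would serve as the weight along a line; the standard
    normal density is one.\<close>
  define k where "k a = ennreal (std_normal_density a)" for a
  have [measurable]: "k \<in> borel_measurable borel" unfolding k_def by measurable
  have one: "(\<integral>\<^sup>+a. k a \<partial>lborel) = 1"
    using prob_space.emeasure_space_1[OF prob_space_std_gauss]
    by (simp add: std_gauss_def k_def emeasure_density)
  interpret leb: sigma_finite_measure "leb_vec d" by (rule sigma_finite_leb_vec)
  interpret P: pair_sigma_finite "leb_vec d" "lborel :: real measure" by standard
  have main: "(\<integral>\<^sup>+z. F z \<partial>leb_vec d) = (\<integral>\<^sup>+z. k (lin d w z) * (\<integral>\<^sup>+l. F (move d w l z) \<partial>lborel) \<partial>leb_vec d)"
    if [measurable]: "F \<in> borel_measurable (vec_space d)" for F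
  proof -
    have one': "(\<integral>\<^sup>+l. k (lin d w z - l) \<partial>lborel) = 1" for z
      using nn_integral_real_affine[of k "-1" "lin d w z"] one by simp
    have "(\<integral>\<^sup>+z. F z \<partial>leb_vec d) = (\<integral>\<^sup>+z. (\<integral>\<^sup>+l. F z * k (lin d w z - l) \<partial>lborel) \<partial>leb_vec d)"
      by (subst nn_integral_cmult) (auto simp: one')
    also have "\<dots> = (\<integral>\<^sup>+l. (\<integral>\<^sup>+z. F z * k (lin d w z - l) \<partial>leb_vec d) \<partial>lborel)"
      by (rule P.Fubini'[symmetric]) measurable
    \<comment> \<open>For fixed \<open>l\<close>, translation by \<open>l\<close> times
      \<open>w\<close> preserves Lebesgue measure and, as \<open>lin d w w = 1\<close>, turns the
      weight into one that does not depend on \<open>l\<close>.\<close>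
    also have "\<dots> = (\<integral>\<^sup>+l. (\<integral>\<^sup>+z. F (move d w l z) * k (lin d w z) \<partial>leb_vec d) \<partial>lborel)"
    proof (rule nn_integral_cong)
      fix l :: real
      show "(\<integral>\<^sup>+z. F z * k (lin d w z - l) \<partial>leb_vec d)
          = (\<integral>\<^sup>+z. F (move d w l z) * k (lin d w z) \<partial>leb_vec d)"
        by (subst nn_integral_leb_vec_move[of _ d w l, symmetric]) (auto simp: w)
    qed
    also have "\<dots> = (\<integral>\<^sup>+z. (\<integral>\<^sup>+l. F (move d w l z) * k (lin d w z) \<partial>lborel) \<partial>leb_vec d)"
      by (rule P.Fubini') measurable
    also have "\<dots> = (\<integral>\<^sup>+z. k (lin d w z) * (\<integral>\<^sup>+l. F (move d w l z) \<partial>lborel) \<partial>leb_vec d)"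
      by (intro nn_integral_cong, subst nn_integral_multc) (auto simp: mult.commute space_leb_vec)
    finally show ?thesis .
  qed
  show ?thesis
    unfolding main[OF assms(2)] main[OF assms(3)]
    by (intro nn_integral_cong) (simp add: eq space_leb_vec)
qed

text \<open>A Gaussian vector splits into its component along \<open>w\<close> and an independent
  part in the orthogonal hyperplane. In terms of lines this takes no change of basis: it suffices to
  compare one-dimensional Gaussian averages on the lines through points of the hyperplane
  \<open>lin d w z = 0\<close>.\<close>

lemma nn_integral_gauss_vec_eq_of_lines:
  assumes w: "lin d w w = 1"
  assumes [measurable]: "G \<in> borel_measurable (vec_space d)" "H \<in> borel_measurable (vec_space d)"
  assumes eq: "\<And>z. z \<in> space (vec_space d) \<Longrightarrow> lin d w z = 0 \<Longrightarrow>
    (\<integral>\<^sup>+a. G (move d w a z) * ennreal (std_normal_density a) \<partial>lborel)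
    = (\<integral>\<^sup>+a. H (move d w a z) * ennreal (std_normal_density a) \<partial>lborel)"
  shows "(\<integral>\<^sup>+z. G z \<partial>gauss_vec d) = (\<integral>\<^sup>+z. H z \<partial>gauss_vec d)"
proof -
  have *: "(\<integral>\<^sup>+l. ennreal (gauss_dens d (move d w l z)) * F (move d w l z) \<partial>lborel)
     = ennreal (gauss_dens d z / std_normal_density (lin d w z)) *
       (\<integral>\<^sup>+a. F (move d w a (move d w (- lin d w z) z)) * ennreal (std_normal_density a) \<partial>lborel)"
    if [measurable]: "F \<in> borel_measurable (vec_space d)" "z \<in> space (vec_space d)" for F z
  proof -
    have p: "std_normal_density x > 0" for x :: real by (simp add: normal_density_pos)
    have n: "gauss_dens d z \<ge> 0" by (auto simp: gauss_dens_def intro!: prod_nonneg)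
    have d: "gauss_dens d (move d w l z)
        = gauss_dens d z / std_normal_density (lin d w z) * std_normal_density (lin d w z + l)" for l
      using gauss_dens_move[OF w, of l z] p[of "lin d w z"] by (simp add: field_simps)
    have "(\<integral>\<^sup>+l. ennreal (gauss_dens d (move d w l z)) * F (move d w l z) \<partial>lborel)
       = (\<integral>\<^sup>+l. ennreal (gauss_dens d z / std_normal_density (lin d w z)) *
          (F (move d w l z) * ennreal (std_normal_density (lin d w z + l))) \<partial>lborel)"
      unfolding d using n p
      by (intro nn_integral_cong, subst ennreal_mult) (auto simp: mult_ac intro!: divide_nonneg_nonneg less_imp_le)
    also have "\<dots> = ennreal (gauss_dens d z / std_normal_density (lin d w z)) *
         (\<integral>\<^sup>+l. F (move d w l z) * ennreal (std_normal_density (lin d w z + l)) \<partial>lborel)"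
      by (subst nn_integral_cmult) (auto intro!: borel_measurable_times_ennreal)
    \<comment> \<open>Shifting the parameter by \<open>lin d w z\<close> starts the line at its foot
      in the hyperplane, where the parameter equals the component along \<open>w\<close>.\<close>
    also have "(\<integral>\<^sup>+l. F (move d w l z) * ennreal (std_normal_density (lin d w z + l)) \<partial>lborel)
       = (\<integral>\<^sup>+a. F (move d w a (move d w (- lin d w z) z)) * ennreal (std_normal_density a) \<partial>lborel)"
      by (subst nn_integral_real_affine[of _ 1 "- lin d w z"]) (auto simp: move_move add.commute)
    finally show ?thesis .
  qed
  show ?thesis
    unfolding gauss_vec_density
    by (simp add: nn_integral_density, rule nn_integral_leb_vec_eq_of_lines[OF w])
      (auto simp: * eq w)
qed

section \<open>Moves along a line that preserve the Gaussian law\<close>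


lemma nn_integral_unif_if:
  fixes p q :: ennreal
  assumes "0 \<le> \<alpha>" "\<alpha> \<le> 1"
  shows "(\<integral>\<^sup>+u. (if u \<le> \<alpha> then p else q) \<partial>uniform_measure lborel {0..1::real})
    = ennreal \<alpha> * p + ennreal (1 - \<alpha>) * q"
proof -
  have "(\<integral>\<^sup>+u. (if u \<le> \<alpha> then p else q) \<partial>uniform_measure lborel {0..1::real})
      = (\<integral>\<^sup>+u. (if u \<le> \<alpha> then p else q) * indicator {0..1} u \<partial>lborel)"
    by (subst nn_integral_uniform_measure) (auto simp: divide_ennreal_def)
  also have "\<dots> = (\<integral>\<^sup>+u. p * indicator {0..\<alpha>} u + q * indicator {\<alpha><..1} u \<partial>lborel)"
    using assms by (intro nn_integral_cong) (auto simp: indicator_def)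
  also have "\<dots> = p * emeasure lborel {0..\<alpha>} + q * emeasure lborel {\<alpha><..1}"
    by (subst nn_integral_add) (auto simp: nn_integral_cmult_indicator)
  also have "\<dots> = ennreal \<alpha> * p + ennreal (1 - \<alpha>) * q"
    using assms by (simp add: mult.commute)
  finally show ?thesis .
qed

lemma prob_space_unif: "prob_space (uniform_measure lborel {0..1::real})"
  by (rule prob_space_uniform_measure) auto

definition refl_along :: "nat \<Rightarrow> (nat \<Rightarrow> real) \<Rightarrow> (nat \<Rightarrow> real) \<Rightarrow> nat \<Rightarrow> real" where
  "refl_along d w z = move d w (- 2 * lin d w z) z"

lemma measurable_refl_along [measurable]: "refl_along d w \<in> measurable (vec_space d) (vec_space d)"
  unfolding refl_along_def by measurable

text \<open>On each line the reflection is the change of sign of the parameter, and the standard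
  normal density is even.\<close>

lemma nn_integral_gauss_refl:
  assumes w: "lin d w w = 1" and [measurable]: "F \<in> borel_measurable (vec_space d)"
  shows "(\<integral>\<^sup>+z. F (refl_along d w z) \<partial>gauss_vec d) = (\<integral>\<^sup>+z. F z \<partial>gauss_vec d)"
proof (rule nn_integral_gauss_vec_eq_of_lines[OF w])
  fix z assume z: "z \<in> space (vec_space d)" "lin d w z = 0"
  have "(\<integral>\<^sup>+a. F (move d w a z) * ennreal (std_normal_density a) \<partial>lborel)
     = (\<integral>\<^sup>+a. F (move d w (- a) z) * ennreal (std_normal_density a) \<partial>lborel)"
    using z by (subst nn_integral_real_affine[of _ "-1" 0]) (auto simp: std_normal_density_def)
  also have "\<dots> = (\<integral>\<^sup>+a. F (refl_along d w (move d w a z)) * ennreal (std_normal_density a) \<partial>lborel)"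
    using z w by (simp add: refl_along_def move_move)
  finally show "(\<integral>\<^sup>+a. F (refl_along d w (move d w a z)) * ennreal (std_normal_density a) \<partial>lborel)
     = (\<integral>\<^sup>+a. F (move d w a z) * ennreal (std_normal_density a) \<partial>lborel)" by simp
qed measurable

text \<open>The reflection coupling of a Gaussian with its translate, run along the direction \<open>w\<close>.\<close>

definition accept :: "nat \<Rightarrow> (nat \<Rightarrow> real) \<Rightarrow> (nat \<Rightarrow> real) \<Rightarrow> (nat \<Rightarrow> real) \<Rightarrow> real" where
  "accept d w g z = exp (- lin d w z * lin d g z - (lin d g z)\<^sup>2 / 2)"

text \<open>Let \<open>w\<close> be a unit vector, \<open>a = lin d w z\<close> and
  \<open>h = lin d g z\<close>. Then \<open>accept d w g z\<close> is the ratio of the standard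
  normal densities at \<open>a + h\<close> and at \<open>a\<close>; it may exceed 1, and then every
  \<open>u\<close> in the unit interval accepts. Acceptance sends \<open>a\<close> to
  \<open>a + h\<close>, rejection sends it to \<open>- a\<close>.\<close>

definition refl_step :: "nat \<Rightarrow> (nat \<Rightarrow> real) \<Rightarrow> (nat \<Rightarrow> real) \<Rightarrow> (nat \<Rightarrow> real) \<Rightarrow> real \<Rightarrow> nat \<Rightarrow> real" where
  "refl_step d w g z u =
     move d w (if u \<le> accept d w g z then lin d g z else - 2 * lin d w z) z"

lemma measurable_accept [measurable]: "accept d w g \<in> borel_measurable (vec_space d)"
  unfolding accept_def by measurable

lemma measurable_refl_step [measurable (raw)]:
  assumes [measurable]: "f \<in> measurable M (vec_space d)" "u \<in> borel_measurable M"
  shows "(\<lambda>x. refl_step d w g (f x) (u x)) \<in> measurable M (vec_space d)"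
  unfolding refl_step_def by measurable

text \<open>The density \<open>min (\<phi> a) (\<phi> (a + h))\<close> is carried from
  \<open>a\<close> to \<open>a + h\<close>, and the rest of the mass at \<open>a\<close> is carried
  to \<open>- a\<close>. The density found at \<open>b\<close> is then
  \<open>m (b - h) + \<phi> b - m (- b)\<close>, and \<open>m (- b) = m (b - h)\<close> because
  \<open>\<phi>\<close> is even.\<close>

lemma reflection_coupling:
  fixes f :: "real \<Rightarrow> ennreal" and h :: real
  assumes [measurable]: "f \<in> borel_measurable borel"
  defines "\<alpha> \<equiv> \<lambda>a. min 1 (exp (- a * h - h\<^sup>2 / 2))"
  shows "(\<integral>\<^sup>+a. (ennreal (\<alpha> a) * f (a + h) + ennreal (1 - \<alpha> a) * f (- a)) * ennreal (std_normal_density a) \<partial>lborel)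
    = (\<integral>\<^sup>+a. f a * ennreal (std_normal_density a) \<partial>lborel)"
proof -
  define \<phi> :: "real \<Rightarrow> real" where "\<phi> = std_normal_density"
  define m where "m a = min (\<phi> a) (\<phi> (a + h))" for a
  have [measurable]: "\<phi> \<in> borel_measurable borel" unfolding \<phi>_def by measurable
  have [measurable]: "m \<in> borel_measurable borel" unfolding m_def by measurable
  have pos: "\<phi> a \<ge> 0" for a by (simp add: \<phi>_def)
  have mp: "m a \<ge> 0" "m a \<le> \<phi> a" for a using pos by (auto simp: m_def)
  have \<alpha>: "\<alpha> a \<ge> 0" "\<alpha> a \<le> 1" for a by (auto simp: \<alpha>_def)
  have e: "exp (- a * h - h\<^sup>2 / 2) * \<phi> a = \<phi> (a + h)" for a
    unfolding \<phi>_def std_normal_density_def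
    by (simp add: exp_add[symmetric] power2_eq_square field_simps)
  have am: "\<alpha> a * \<phi> a = m a" for a
  proof -
    have "\<alpha> a * \<phi> a = min (1 * \<phi> a) (exp (- a * h - h\<^sup>2 / 2) * \<phi> a)"
      unfolding \<alpha>_def using pos[of a] by (simp only: min_mult_distrib_right) simp
    then show ?thesis unfolding e m_def by simp
  qed
  have sym: "\<phi> (- a) = \<phi> a" for a by (simp add: \<phi>_def std_normal_density_def)
  have p1: "(ennreal (\<alpha> a) * f (a + h) + ennreal (1 - \<alpha> a) * f (- a)) * ennreal (\<phi> a)
     = ennreal (m a) * f (a + h) + ennreal (\<phi> a - m a) * f (- a)" for a
  proof -
    have "ennreal (m a) = ennreal (\<alpha> a) * ennreal (\<phi> a)"
      using \<alpha> pos by (simp add: am[symmetric] ennreal_mult)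
    moreover have "ennreal (\<phi> a - m a) = ennreal (1 - \<alpha> a) * ennreal (\<phi> a)"
      using \<alpha> pos by (simp add: am[symmetric] ennreal_mult[symmetric] algebra_simps)
    ultimately show ?thesis by (simp add: algebra_simps)
  qed
  have "(\<integral>\<^sup>+a. (ennreal (\<alpha> a) * f (a + h) + ennreal (1 - \<alpha> a) * f (- a)) * ennreal (\<phi> a) \<partial>lborel)
     = (\<integral>\<^sup>+a. ennreal (m a) * f (a + h) \<partial>lborel) + (\<integral>\<^sup>+a. ennreal (\<phi> a - m a) * f (- a) \<partial>lborel)"
    unfolding p1 by (subst nn_integral_add) auto
  also have "(\<integral>\<^sup>+a. ennreal (m a) * f (a + h) \<partial>lborel) = (\<integral>\<^sup>+b. ennreal (m (b - h)) * f b \<partial>lborel)"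
    by (subst nn_integral_real_affine[of _ 1 "-h"]) (auto simp: algebra_simps)
  also have "(\<integral>\<^sup>+a. ennreal (\<phi> a - m a) * f (- a) \<partial>lborel) = (\<integral>\<^sup>+b. ennreal (\<phi> b - m (- b)) * f b \<partial>lborel)"
    by (subst nn_integral_real_affine[of _ "-1" 0]) (auto simp: sym)
  also have "(\<integral>\<^sup>+b. ennreal (m (b - h)) * f b \<partial>lborel) + (\<integral>\<^sup>+b. ennreal (\<phi> b - m (- b)) * f b \<partial>lborel)
     = (\<integral>\<^sup>+b. ennreal (m (b - h)) * f b + ennreal (\<phi> b - m (- b)) * f b \<partial>lborel)"
    by (subst nn_integral_add) auto
  also have "\<dots> = (\<integral>\<^sup>+b. f b * ennreal (\<phi> b) \<partial>lborel)"
  proof (rule nn_integral_cong)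
    fix b :: real
    have "m (- b) = m (b - h)"
      using sym[of b] sym[of "b - h"] by (simp add: m_def min.commute)
    moreover have "ennreal (m (b - h)) + ennreal (\<phi> b - m (- b)) = ennreal (m (b - h) + (\<phi> b - m (- b)))"
      using mp[of "b - h"] mp[of "- b"] sym[of b] by (subst ennreal_plus) auto
    ultimately show "ennreal (m (b - h)) * f b + ennreal (\<phi> b - m (- b)) * f b = f b * ennreal (\<phi> b)"
      by (simp only: distrib_right[symmetric]) (simp add: mult.commute)
  qed
  finally show ?thesis by (simp add: \<phi>_def)
qed

text \<open>Because \<open>g\<close> is orthogonal to \<open>w\<close>, the displacement
  \<open>lin d g z\<close> is constant on each line in direction \<open>w\<close>, so on that line
  the step is the one-dimensional coupling with a fixed \<open>h\<close>.\<close>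

lemma nn_integral_gauss_refl_step:
  assumes w: "lin d w w = 1" and g: "lin d g w = 0"
    and [measurable]: "F \<in> borel_measurable (vec_space d)"
  shows "(\<integral>\<^sup>+z. (\<integral>\<^sup>+u. F (refl_step d w g z u) \<partial>uniform_measure lborel {0..1::real}) \<partial>gauss_vec d)
    = (\<integral>\<^sup>+z. F z \<partial>gauss_vec d)"
proof -
  interpret u: prob_space "uniform_measure lborel {0..1::real}" by (rule prob_space_unif)
  show ?thesis
  proof (rule nn_integral_gauss_vec_eq_of_lines[OF w])
    show "(\<lambda>z. \<integral>\<^sup>+u. F (refl_step d w g z u) \<partial>uniform_measure lborel {0..1::real})
       \<in> borel_measurable (vec_space d)" by measurable
    fix z assume z: "z \<in> space (vec_space d)" "lin d w z = 0"
    define h where "h = lin d g z"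
    have *: "(\<integral>\<^sup>+u. F (refl_step d w g (move d w a z) u) \<partial>uniform_measure lborel {0..1::real})
       = ennreal (min 1 (exp (- a * h - h\<^sup>2 / 2))) * F (move d w (a + h) z)
         + ennreal (1 - min 1 (exp (- a * h - h\<^sup>2 / 2))) * F (move d w (- a) z)" for a
    proof -
      have "(\<integral>\<^sup>+u. F (refl_step d w g (move d w a z) u) \<partial>uniform_measure lborel {0..1::real})
        = (\<integral>\<^sup>+u. (if u \<le> min 1 (exp (- a * h - h\<^sup>2 / 2)) then F (move d w (a + h) z) else F (move d w (- a) z)) \<partial>uniform_measure lborel {0..1::real})"
      proof (rule nn_integral_cong_AE)
        \<comment> \<open>Almost surely \<open>u \<le> 1\<close>, so the threshold may be capped at
          1 and becomes a probability.\<close>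
        have "AE u in uniform_measure lborel {0..1::real}. u \<le> 1"
          by (rule AE_uniform_measureI) auto
        then show "AE u in uniform_measure lborel {0..1}. F (refl_step d w g (move d w a z) u)
          = (if u \<le> min 1 (exp (- a * h - h\<^sup>2 / 2)) then F (move d w (a + h) z) else F (move d w (- a) z))"
          by eventually_elim
            (use z w g in \<open>auto simp: refl_step_def accept_def move_move h_def add.commute\<close>)
      qed
      also note nn_integral_unif_if
      finally show ?thesis by auto
    qed
    show "(\<integral>\<^sup>+a. (\<integral>\<^sup>+u. F (refl_step d w g (move d w a z) u) \<partial>uniform_measure lborel {0..1::real})
          * ennreal (std_normal_density a) \<partial>lborel)
       = (\<integral>\<^sup>+a. F (move d w a z) * ennreal (std_normal_density a) \<partial>lborel)"
      unfolding * using z by (intro reflection_coupling[of "\<lambda>b. F (move d w b z)" h]) measurable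
  qed measurable
qed

text \<open>For the unit vector \<open>w\<close> in the direction of \<open>v\<close>, the
  functional is the line parameter itself, so the line integral is the second moment of a standard
  normal variable; the rest is scaling. The zero vector has no direction and is treated
  apart.\<close>

lemma nn_integral_gauss_lin_square:
  "(\<integral>\<^sup>+z. ennreal ((lin d v z)\<^sup>2) \<partial>gauss_vec d) = ennreal (lin d v v)"
proof (cases "lin d v v = 0")
  case True
  then have "v j = 0" if "j < d" for j
    using that by (auto simp: lin_def sum_nonneg_eq_0_iff)
  then have "lin d v z = 0" for z by (simp add: lin_def)
  then show ?thesis using True by simp
next
  case False
  moreover have "lin d v v \<ge> 0" by (auto simp: lin_def intro!: sum_nonneg)
  ultimately have pos: "lin d v v > 0" by simp
  define s where "s = sqrt (lin d v v)"
  have s: "s > 0" "s\<^sup>2 = lin d v v" using pos by (auto simp: s_def)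
  define w where "w j = v j / s" for j
  have lw: "lin d w z = lin d v z / s" for z
    by (simp add: lin_def w_def sum_divide_distrib)
  have w: "lin d w w = 1"
  proof -
    have "lin d w w = lin d v v / s\<^sup>2"
      by (simp add: lin_def w_def sum_divide_distrib power2_eq_square)
    then show ?thesis using s pos by simp
  qed
  have sq: "(\<integral>\<^sup>+a. ennreal (a\<^sup>2) * ennreal (std_normal_density a) \<partial>lborel) = 1"
  proof -
    have "has_bochner_integral lborel (\<lambda>x. std_normal_density x * x ^ (2 * 1)) (fact (2 * 1) / (2 ^ 1 * fact 1))"
      by (rule std_normal_moment_even)
    then have "has_bochner_integral lborel (\<lambda>x. std_normal_density x * x\<^sup>2) 1"
      by (simp add: fact_numeral)
    then have "(\<integral>\<^sup>+a. ennreal (std_normal_density a * a\<^sup>2) \<partial>lborel) = ennreal 1"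
      by (subst nn_integral_eq_integral)
        (auto simp: has_bochner_integral_iff)
    then show ?thesis by (simp add: ennreal_mult mult.commute)
  qed
  have "(\<integral>\<^sup>+z. ennreal ((lin d w z)\<^sup>2) \<partial>gauss_vec d) = (\<integral>\<^sup>+z. 1 \<partial>gauss_vec d)"
  proof (rule nn_integral_gauss_vec_eq_of_lines[OF w])
    fix z assume "lin d w z = 0"
    moreover have "(\<integral>\<^sup>+a. ennreal (std_normal_density a) \<partial>lborel) = 1"
      using prob_space.emeasure_space_1[OF prob_space_std_gauss]
      by (simp add: std_gauss_def emeasure_density)
    ultimately show "(\<integral>\<^sup>+a. ennreal ((lin d w (move d w a z))\<^sup>2) * ennreal (std_normal_density a) \<partial>lborel)
      = (\<integral>\<^sup>+a. 1 * ennreal (std_normal_density a) \<partial>lborel)"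
      by (simp add: w sq)
  qed measurable
  also have "\<dots> = 1"
    using prob_space.emeasure_space_1[OF prob_space_gauss_vec] by simp
  finally have 1: "(\<integral>\<^sup>+z. ennreal ((lin d w z)\<^sup>2) \<partial>gauss_vec d) = 1" .
  have "(\<integral>\<^sup>+z. ennreal ((lin d v z)\<^sup>2) \<partial>gauss_vec d)
     = (\<integral>\<^sup>+z. ennreal (s\<^sup>2) * ennreal ((lin d w z)\<^sup>2) \<partial>gauss_vec d)"
    using s pos by (intro nn_integral_cong) (simp add: lw ennreal_mult[symmetric] power_divide)
  also have "\<dots> = ennreal (s\<^sup>2) * (\<integral>\<^sup>+z. ennreal ((lin d w z)\<^sup>2) \<partial>gauss_vec d)"
    by (rule nn_integral_cmult) measurable
  finally show ?thesis by (simp add: 1 s)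
qed

text \<open>Let \<open>a = lin d w z\<close> and \<open>h = lin d g z\<close>. By 1 + x \<le> exp x,
  the rejection probability is at most the positive part of \<open>a * h + h\<^sup>2 / 2\<close>.
  Splitting the product by the weighted inequality of means leaves only \<open>a\<^sup>2\<close> and
  \<open>h\<^sup>2\<close>, so second moments suffice and the joint law of \<open>a\<close> and
  \<open>h\<close> is never computed. The weight \<open>r\<close> balances the two parts of the
  product, whose means are both \<open>r / 2\<close>.\<close>

lemma refl_step_reject:
  assumes w: "lin d w w = 1" and g: "lin d g g = r\<^sup>2" and r: "r > 0"
  shows "(\<integral>\<^sup>+z. (\<integral>\<^sup>+u. (if u \<le> accept d w g z then 0 else 1) \<partial>uniform_measure lborel {0..1::real}) \<partial>gauss_vec d)
    \<le> ennreal (r + r\<^sup>2 / 2)"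
proof -
  have "(\<integral>\<^sup>+u. (if u \<le> accept d w g z then 0 else 1) \<partial>uniform_measure lborel {0..1::real})
     \<le> ennreal (r / 2) * ennreal ((lin d w z)\<^sup>2) + ennreal (1 / (2 * r) + 1 / 2) * ennreal ((lin d g z)\<^sup>2)" for z
  proof -
    define a h where "a = lin d w z" and "h = lin d g z"
    define \<alpha> where "\<alpha> = min 1 (accept d w g z)"
    have \<alpha>: "0 \<le> \<alpha>" "\<alpha> \<le> 1" by (auto simp: \<alpha>_def accept_def)
    have "AE u in uniform_measure lborel {0..1::real}. u \<le> 1"
      by (rule AE_uniform_measureI) auto
    then have "(\<integral>\<^sup>+u. (if u \<le> accept d w g z then 0 else 1) \<partial>uniform_measure lborel {0..1::real})
       = (\<integral>\<^sup>+u. (if u \<le> \<alpha> then 0 else 1) \<partial>uniform_measure lborel {0..1::real})"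
    proof (intro nn_integral_cong_AE, eventually_elim)
      case (elim u)
      then show ?case by (auto simp: \<alpha>_def)
    qed
    also have "\<dots> = ennreal (1 - \<alpha>)" using nn_integral_unif_if[OF \<alpha>, of 0 1] by simp
    also have "\<dots> \<le> ennreal (r / 2 * a\<^sup>2 + (1 / (2 * r) + 1 / 2) * h\<^sup>2)"
    proof (rule ennreal_leI)
      have "1 + (- a * h - h\<^sup>2 / 2) \<le> exp (- a * h - h\<^sup>2 / 2)" by (rule exp_ge_add_one_self)
      then have 1: "1 - \<alpha> \<le> max 0 (a * h + h\<^sup>2 / 2)"
        unfolding \<alpha>_def accept_def a_def[symmetric] h_def[symmetric] by linarith
      have "0 \<le> (r * a - h)\<^sup>2 / (2 * r)" using r by simp
      also have "\<dots> = r / 2 * a\<^sup>2 + 1 / (2 * r) * h\<^sup>2 - a * h"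
        using r by (simp add: power2_eq_square field_simps)
      finally have 2: "a * h \<le> r / 2 * a\<^sup>2 + 1 / (2 * r) * h\<^sup>2" by simp
      have 3: "0 \<le> r / 2 * a\<^sup>2 + (1 / (2 * r) + 1 / 2) * h\<^sup>2" using r by simp
      show "1 - \<alpha> \<le> r / 2 * a\<^sup>2 + (1 / (2 * r) + 1 / 2) * h\<^sup>2"
        using 1 2 3 by (auto simp: algebra_simps max_def split: if_splits)
    qed
    also have "\<dots> = ennreal (r / 2) * ennreal (a\<^sup>2) + ennreal (1 / (2 * r) + 1 / 2) * ennreal (h\<^sup>2)"
      using r by (subst ennreal_plus) (auto simp: ennreal_mult[symmetric] simp del: ennreal_plus)
    finally show ?thesis by (simp add: a_def h_def)
  qed
  then have "(\<integral>\<^sup>+z. (\<integral>\<^sup>+u. (if u \<le> accept d w g z then 0 else 1) \<partial>uniform_measure lborel {0..1::real}) \<partial>gauss_vec d)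
    \<le> (\<integral>\<^sup>+z. ennreal (r / 2) * ennreal ((lin d w z)\<^sup>2) + ennreal (1 / (2 * r) + 1 / 2) * ennreal ((lin d g z)\<^sup>2) \<partial>gauss_vec d)"
    by (intro nn_integral_mono) auto
  also have "\<dots> = ennreal (r / 2) * (\<integral>\<^sup>+z. ennreal ((lin d w z)\<^sup>2) \<partial>gauss_vec d)
     + ennreal (1 / (2 * r) + 1 / 2) * (\<integral>\<^sup>+z. ennreal ((lin d g z)\<^sup>2) \<partial>gauss_vec d)"
    by (subst nn_integral_add, measurable) (simp add: nn_integral_cmult)
  also have "\<dots> = ennreal (r / 2 * 1 + (1 / (2 * r) + 1 / 2) * r\<^sup>2)"
    unfolding nn_integral_gauss_lin_square w g using r
    by (subst ennreal_plus) (auto simp: ennreal_mult simp del: ennreal_plus)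
  also have "r / 2 * 1 + (1 / (2 * r) + 1 / 2) * r\<^sup>2 = r + r\<^sup>2 / 2"
    using r by (simp add: power2_eq_square field_simps)
  finally show ?thesis .
qed

section \<open>Couplings of two Gaussian vectors\<close>


definition gauss_coupling :: "nat \<Rightarrow> ((nat \<Rightarrow> real) \<times> (nat \<Rightarrow> real)) measure \<Rightarrow> bool" where
  "gauss_coupling d M \<longleftrightarrow>
     sets M = sets (vec_space d \<Otimes>\<^sub>M vec_space d) \<and>
     distr M (vec_space d) fst = gauss_vec d \<and> distr M (vec_space d) snd = gauss_vec d"

lemma gauss_couplingD:
  assumes "gauss_coupling d M"
  shows gauss_coupling_sets: "sets M = sets (vec_space d \<Otimes>\<^sub>M vec_space d)"
    and gauss_coupling_prob: "prob_space M"
    and gauss_coupling_fst: "\<And>F. F \<in> borel_measurable (vec_space d) \<Longrightarrow>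
      (\<integral>\<^sup>+p. F (fst p) \<partial>M) = (\<integral>\<^sup>+x. F x \<partial>gauss_vec d)"
    and gauss_coupling_snd: "\<And>F. F \<in> borel_measurable (vec_space d) \<Longrightarrow>
      (\<integral>\<^sup>+p. F (snd p) \<partial>M) = (\<integral>\<^sup>+x. F x \<partial>gauss_vec d)"
proof -
  show s [measurable_cong]: "sets M = sets (vec_space d \<Otimes>\<^sub>M vec_space d)"
    using assms by (simp add: gauss_coupling_def)
  have 1: "distr M (vec_space d) fst = gauss_vec d" and 2: "distr M (vec_space d) snd = gauss_vec d"
    using assms by (auto simp: gauss_coupling_def)
  have m: "fst \<in> measurable M (vec_space d)" "snd \<in> measurable M (vec_space d)" by measurable
  show "prob_space M"
    using prob_space_distrD[OF m(1)] prob_space_gauss_vec[of d] by (simp add: 1)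
  fix F :: "(nat \<Rightarrow> real) \<Rightarrow> ennreal" assume [measurable]: "F \<in> borel_measurable (vec_space d)"
  show "(\<integral>\<^sup>+p. F (fst p) \<partial>M) = (\<integral>\<^sup>+x. F x \<partial>gauss_vec d)"
    unfolding 1[symmetric] using m by (subst nn_integral_distr) auto
  show "(\<integral>\<^sup>+p. F (snd p) \<partial>M) = (\<integral>\<^sup>+x. F x \<partial>gauss_vec d)"
    unfolding 2[symmetric] using m by (subst nn_integral_distr) auto
qed

lemma gauss_couplingI:
  assumes s [measurable_cong]: "sets M = sets (vec_space d \<Otimes>\<^sub>M vec_space d)"
    and 1: "\<And>F. F \<in> borel_measurable (vec_space d) \<Longrightarrow>
      (\<integral>\<^sup>+p. F (fst p) \<partial>M) = (\<integral>\<^sup>+x. F x \<partial>gauss_vec d)"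
    and 2: "\<And>F. F \<in> borel_measurable (vec_space d) \<Longrightarrow>
      (\<integral>\<^sup>+p. F (snd p) \<partial>M) = (\<integral>\<^sup>+x. F x \<partial>gauss_vec d)"
  shows "gauss_coupling d M"
proof -
  have "distr M (vec_space d) f = gauss_vec d"
    if [measurable]: "f \<in> measurable M (vec_space d)"
      and eq: "\<And>F. F \<in> borel_measurable (vec_space d) \<Longrightarrow> (\<integral>\<^sup>+p. F (f p) \<partial>M) = (\<integral>\<^sup>+x. F x \<partial>gauss_vec d)"
    for f
  proof (rule measure_eqI)
    fix A assume "A \<in> sets (distr M (vec_space d) f)"
    then have A [measurable]: "A \<in> sets (vec_space d)" by simp
    have "emeasure (distr M (vec_space d) f) A = (\<integral>\<^sup>+x. indicator A x \<partial>distr M (vec_space d) f)"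
      by simp
    also have "\<dots> = (\<integral>\<^sup>+p. indicator A (f p) \<partial>M)"
      by (subst nn_integral_distr) auto
    also have "\<dots> = (\<integral>\<^sup>+x. indicator A x \<partial>gauss_vec d)"
      by (rule eq) simp
    finally show "emeasure (distr M (vec_space d) f) A = emeasure (gauss_vec d) A" by simp
  qed simp
  from this[OF _ 1] this[OF _ 2] show ?thesis
    unfolding gauss_coupling_def using s by simp
qed

text \<open>A fresh uniform variable drives the step and is then forgotten, so the result is again a
  law on pairs and steps can be iterated. The first component, the original vector, is never
  touched.\<close>

definition step_coupling ::
  "nat \<Rightarrow> (nat \<Rightarrow> real) \<Rightarrow> (nat \<Rightarrow> real) \<Rightarrow> ((nat \<Rightarrow> real) \<times> (nat \<Rightarrow> real)) measure \<Rightarrow>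
   ((nat \<Rightarrow> real) \<times> (nat \<Rightarrow> real)) measure" where
  "step_coupling d w g M =
     distr (M \<Otimes>\<^sub>M uniform_measure lborel {0..1::real}) (vec_space d \<Otimes>\<^sub>M vec_space d)
       (\<lambda>q. (fst (fst q), refl_step d w g (snd (fst q)) (snd q)))"

lemma nn_integral_step_coupling:
  assumes "gauss_coupling d M" and [measurable]: "F \<in> borel_measurable (vec_space d \<Otimes>\<^sub>M vec_space d)"
  shows "(\<integral>\<^sup>+p. F p \<partial>step_coupling d w g M)
    = (\<integral>\<^sup>+p. (\<integral>\<^sup>+u. F (fst p, refl_step d w g (snd p) u) \<partial>uniform_measure lborel {0..1::real}) \<partial>M)"
proof -
  note [measurable_cong] = gauss_coupling_sets[OF assms(1)]
  interpret u: prob_space "uniform_measure lborel {0..1::real}" by (rule prob_space_unif)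
  show ?thesis
    unfolding step_coupling_def
    by (subst nn_integral_distr, measurable, subst u.nn_integral_fst[symmetric], measurable)
qed

lemma gauss_coupling_step:
  assumes M: "gauss_coupling d M" and w: "lin d w w = 1" and g: "lin d g w = 0"
  shows "gauss_coupling d (step_coupling d w g M)"
proof (rule gauss_couplingI)
  interpret u: prob_space "uniform_measure lborel {0..1::real}" by (rule prob_space_unif)
  note [measurable_cong] = gauss_coupling_sets[OF M]
  show "sets (step_coupling d w g M) = sets (vec_space d \<Otimes>\<^sub>M vec_space d)"
    by (simp add: step_coupling_def)
  fix F :: "(nat \<Rightarrow> real) \<Rightarrow> ennreal" assume F [measurable]: "F \<in> borel_measurable (vec_space d)"
  have "(\<integral>\<^sup>+p. F (fst p) \<partial>step_coupling d w g M)
      = (\<integral>\<^sup>+p. (\<integral>\<^sup>+u. F (fst p) \<partial>uniform_measure lborel {0..1::real}) \<partial>M)"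
    by (subst nn_integral_step_coupling[OF M]) auto
  then show "(\<integral>\<^sup>+p. F (fst p) \<partial>step_coupling d w g M) = (\<integral>\<^sup>+x. F x \<partial>gauss_vec d)"
    using u.emeasure_space_1 by (simp add: gauss_coupling_fst[OF M])
  have "(\<integral>\<^sup>+p. F (snd p) \<partial>step_coupling d w g M)
      = (\<integral>\<^sup>+p. (\<integral>\<^sup>+u. F (refl_step d w g (snd p) u) \<partial>uniform_measure lborel {0..1::real}) \<partial>M)"
    by (subst nn_integral_step_coupling[OF M]) auto
  also have "\<dots> = (\<integral>\<^sup>+z. (\<integral>\<^sup>+u. F (refl_step d w g z u) \<partial>uniform_measure lborel {0..1::real}) \<partial>gauss_vec d)"
    by (rule gauss_coupling_snd[OF M, of "\<lambda>z. \<integral>\<^sup>+u. F (refl_step d w g z u) \<partial>uniform_measure lborel {0..1::real}"])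
      measurable
  finally show "(\<integral>\<^sup>+p. F (snd p) \<partial>step_coupling d w g M) = (\<integral>\<^sup>+x. F x \<partial>gauss_vec d)"
    by (simp add: nn_integral_gauss_refl_step[OF w g])
qed

lemma emeasure_step_coupling:
  assumes M: "gauss_coupling d M" and [measurable]: "Measurable.pred (vec_space d \<Otimes>\<^sub>M vec_space d) Q"
  shows "emeasure (step_coupling d w g M) {p \<in> space (step_coupling d w g M). Q p}
    = (\<integral>\<^sup>+p. (\<integral>\<^sup>+u. (if Q (fst p, refl_step d w g (snd p) u) then 1 else 0) \<partial>uniform_measure lborel {0..1::real}) \<partial>M)"
proof -
  note [measurable_cong] = gauss_coupling_sets[OF M]
  have [measurable_cong]: "sets (step_coupling d w g M) = sets (vec_space d \<Otimes>\<^sub>M vec_space d)"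
    by (simp add: step_coupling_def)
  have "emeasure (step_coupling d w g M) {p \<in> space (step_coupling d w g M). Q p}
     = (\<integral>\<^sup>+p. indicator {p \<in> space (step_coupling d w g M). Q p} p \<partial>step_coupling d w g M)"
    by (subst nn_integral_indicator) auto
  also have "\<dots> = (\<integral>\<^sup>+p. (if Q p then 1 else 0) \<partial>step_coupling d w g M)"
    by (intro nn_integral_cong) (auto simp: indicator_def)
  finally show ?thesis
    by (simp add: nn_integral_step_coupling[OF M])
qed

text \<open>A property that no move along \<open>w\<close> can break survives acceptance and
  rejection alike, hence the quantifier over every \<open>u\<close>.\<close>

lemma AE_step_coupling:
  assumes M: "gauss_coupling d M" and Q [measurable]: "Measurable.pred (vec_space d \<Otimes>\<^sub>M vec_space d) Q"
    and ae: "AE p in M. \<forall>u. Q (fst p, refl_step d w g (snd p) u)"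
  shows "AE p in step_coupling d w g M. Q p"
proof -
  have s [measurable_cong]: "sets (step_coupling d w g M) = sets (vec_space d \<Otimes>\<^sub>M vec_space d)"
    by (simp add: step_coupling_def)
  have "emeasure (step_coupling d w g M) {p \<in> space (step_coupling d w g M). \<not> Q p} = (\<integral>\<^sup>+p. 0 \<partial>M)"
    unfolding emeasure_step_coupling[OF M pred_intros_logic(2)[OF Q]]
    using ae by (intro nn_integral_cong_AE) auto
  then show ?thesis
    by (intro AE_I'[of "{p \<in> space (step_coupling d w g M). \<not> Q p}"]) auto
qed

text \<open>All coordinates outside the sink set \<open>T\<close> are moved back to their original values one at a
  time; the sinks absorb each move so that the functionals \<open>e\<close> and \<open>e'\<close> do not change.\<close>

lemma coupling_with_sinks:
  fixes w g :: "nat \<Rightarrow> nat \<Rightarrow> real" and r :: "nat \<Rightarrow> real" and R :: "(nat \<Rightarrow> real) \<Rightarrow> nat \<Rightarrow> real"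
  assumes R [measurable]: "R \<in> measurable (vec_space d) (vec_space d)"
    and R_inv: "\<And>F. F \<in> borel_measurable (vec_space d) \<Longrightarrow>
      (\<integral>\<^sup>+z. F (R z) \<partial>gauss_vec d) = (\<integral>\<^sup>+z. F z \<partial>gauss_vec d)"
    and w: "\<And>s. s < d \<Longrightarrow> s \<notin> T \<Longrightarrow> lin d (w s) (w s) = 1"
    and gw: "\<And>s. s < d \<Longrightarrow> s \<notin> T \<Longrightarrow> lin d (g s) (w s) = 0"
    and g: "\<And>s. s < d \<Longrightarrow> s \<notin> T \<Longrightarrow> lin d (g s) (g s) = (r s)\<^sup>2"
    and r: "\<And>s. s < d \<Longrightarrow> s \<notin> T \<Longrightarrow> r s > 0 \<and> r s + (r s)\<^sup>2 / 2 \<le> q"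
    and supp: "\<And>s j. s < d \<Longrightarrow> s \<notin> T \<Longrightarrow> j < d \<Longrightarrow> j \<notin> T \<Longrightarrow> j \<noteq> s \<Longrightarrow> w s j = 0"
    and ew: "\<And>s. s < d \<Longrightarrow> s \<notin> T \<Longrightarrow> lin d e (w s) = 0"
    and e'w: "\<And>s. s < d \<Longrightarrow> s \<notin> T \<Longrightarrow> lin d e' (w s) = 0"
    and undo: "\<And>s x z. s < d \<Longrightarrow> s \<notin> T \<Longrightarrow> lin d e z = lin d e (R x) \<Longrightarrow>
      lin d e' z = lin d e' (R x) \<Longrightarrow> z s = R x s \<Longrightarrow> z s + lin d (g s) z * w s s = x s"
  shows "\<exists>M. gauss_coupling d M \<and>
    (AE p in M. lin d e (snd p) = lin d e (R (fst p)) \<and> lin d e' (snd p) = lin d e' (R (fst p))) \<and>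
    (\<forall>s<d. s \<notin> T \<longrightarrow> emeasure M {p \<in> space M. fst p s \<noteq> snd p s} \<le> ennreal q)"
proof -
  \<comment> \<open>The invariant once the coordinates below \<open>k\<close> have been treated: the
    functionals still have the values they take at \<open>R x\<close>, coordinates from
    \<open>k\<close> on that are not sinks still carry their rotated values, and earlier ones have
    returned to the original values up to probability \<open>q\<close>.\<close>
  define I where "I k M \<longleftrightarrow> gauss_coupling d M \<and>
    (AE p in M. lin d e (snd p) = lin d e (R (fst p)) \<and> lin d e' (snd p) = lin d e' (R (fst p)) \<and>
        (\<forall>s\<in>{k..<d} - T. snd p s = R (fst p) s)) \<and>
    (\<forall>s<d. s < k \<longrightarrow> s \<notin> T \<longrightarrow> emeasure M {p \<in> space M. fst p s \<noteq> snd p s} \<le> ennreal q)" for k M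
  have [measurable]: "(\<lambda>x. f x s) \<in> borel_measurable N"
    if "f \<in> measurable N (vec_space d)" "s < d" for f s and N :: "'x measure"
    using measurable_compose[OF that(1) measurable_component_vec[OF that(2)]] .
  have pred [measurable]: "Measurable.pred (vec_space d \<Otimes>\<^sub>M vec_space d)
      (\<lambda>p. lin d e (snd p) = lin d e (R (fst p)) \<and> lin d e' (snd p) = lin d e' (R (fst p)) \<and>
        (\<forall>s\<in>{k..<d} - T. snd p s = R (fst p) s))" for k
  proof -
    have "Measurable.pred (vec_space d \<Otimes>\<^sub>M vec_space d) (\<lambda>p. \<forall>s\<in>{k..<d} - T. snd p s = R (fst p) s)"
      by (rule pred_intros_finite) (auto intro!: borel_measurable_eq)
    then show ?thesis by measurable
  qed
  have "\<exists>M. I k M" for k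
  proof (induction k)
    case 0
    define M where "M = distr (gauss_vec d) (vec_space d \<Otimes>\<^sub>M vec_space d) (\<lambda>x. (x, R x))"
    have [measurable]: "(\<lambda>x. (x, R x)) \<in> measurable (gauss_vec d) (vec_space d \<Otimes>\<^sub>M vec_space d)"
      by measurable
    have "gauss_coupling d M"
      by (rule gauss_couplingI) (auto simp: M_def nn_integral_distr R_inv)
    moreover have "AE p in M. lin d e (snd p) = lin d e (R (fst p)) \<and>
        lin d e' (snd p) = lin d e' (R (fst p)) \<and> (\<forall>s\<in>{0..<d} - T. snd p s = R (fst p) s)"
      unfolding M_def
    proof (subst AE_distr_iff)
      show "{p \<in> space (vec_space d \<Otimes>\<^sub>M vec_space d). lin d e (snd p) = lin d e (R (fst p)) \<and>
        lin d e' (snd p) = lin d e' (R (fst p)) \<and> (\<forall>s\<in>{0..<d} - T. snd p s = R (fst p) s)}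
        \<in> sets (vec_space d \<Otimes>\<^sub>M vec_space d)"
        using pred[of 0] by (rule predE)
    qed auto
    ultimately show ?case
      by (intro exI[of _ M]) (auto simp: I_def)
  next
    case (Suc k)
    then obtain M where IM: "I k M" by blast
    then have M: "gauss_coupling d M" by (simp add: I_def)
    have ae: "AE p in M. lin d e (snd p) = lin d e (R (fst p)) \<and> lin d e' (snd p) = lin d e' (R (fst p)) \<and>
        (\<forall>s\<in>{k..<d} - T. snd p s = R (fst p) s)" using IM by (simp add: I_def)
    show ?case
    proof (cases "k < d \<and> k \<notin> T")
      \<comment> \<open>A sink, or an index beyond the dimension, calls for no move.\<close>
      case False
      then have "{k..<d} - T = {Suc k..<d} - T" by (auto simp: Suc_le_eq order.order_iff_strict)
      moreover have "s < k" if "s < d" "s < Suc k" "s \<notin> T" for s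
        using False that by (cases "s = k") auto
      ultimately have "I (Suc k) M"
        using IM unfolding I_def by auto
      then show ?thesis by blast
    next
      case True
      then have k: "k < d" "k \<notin> T" by auto
      define N where "N = step_coupling d (w k) (g k) M"
      have N: "gauss_coupling d N"
        unfolding N_def by (rule gauss_coupling_step[OF M w[OF k] gw[OF k]])
      \<comment> \<open>Outside the sinks the move for \<open>k\<close> changes coordinate
        \<open>k\<close> only. So the bounds for earlier coordinates persist, and later coordinates
        still wait with their rotated values.\<close>
      have st: "refl_step d (w k) (g k) z u s = z s" if "s < d" "s \<notin> T" "s \<noteq> k" for s z u
        using supp[OF k that] that by (simp add: refl_step_def)
      have le: "lin d e (refl_step d (w k) (g k) z u) = lin d e z"
               "lin d e' (refl_step d (w k) (g k) z u) = lin d e' z" for z u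
        using ew[OF k] e'w[OF k] by (auto simp: refl_step_def)
      have ae': "AE p in N. lin d e (snd p) = lin d e (R (fst p)) \<and> lin d e' (snd p) = lin d e' (R (fst p)) \<and>
        (\<forall>s\<in>{Suc k..<d} - T. snd p s = R (fst p) s)"
        unfolding N_def
      proof (rule AE_step_coupling[OF M])
        show "AE p in M. \<forall>u. lin d e (snd (fst p, refl_step d (w k) (g k) (snd p) u)) = lin d e (R (fst (fst p, refl_step d (w k) (g k) (snd p) u))) \<and>
           lin d e' (snd (fst p, refl_step d (w k) (g k) (snd p) u)) = lin d e' (R (fst (fst p, refl_step d (w k) (g k) (snd p) u))) \<and>
           (\<forall>s\<in>{Suc k..<d} - T. snd (fst p, refl_step d (w k) (g k) (snd p) u) s = R (fst (fst p, refl_step d (w k) (g k) (snd p) u)) s)"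
          using ae by eventually_elim (auto simp: st le)
      qed (rule pred)
      have em: "emeasure N {p \<in> space N. fst p s \<noteq> snd p s}
        = (\<integral>\<^sup>+p. (\<integral>\<^sup>+u. (if fst p s \<noteq> refl_step d (w k) (g k) (snd p) u s then 1 else 0)
             \<partial>uniform_measure lborel {0..1::real}) \<partial>M)" if "s < d" for s
        unfolding N_def
        by (subst emeasure_step_coupling[OF M]) (use that in \<open>auto intro!: pred_intros_logic borel_measurable_eq\<close>)
      interpret u: prob_space "uniform_measure lborel {0..1::real}" by (rule prob_space_unif)
      note [measurable_cong] = gauss_coupling_sets[OF M]
      have "emeasure N {p \<in> space N. fst p s \<noteq> snd p s} \<le> ennreal q" if s: "s < d" "s < Suc k" "s \<notin> T" for s
      proof (cases "s = k")
        case False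
        have [measurable]: "{p \<in> space M. fst p s \<noteq> snd p s} \<in> sets M"
          using s by measurable
        have "emeasure N {p \<in> space N. fst p s \<noteq> snd p s} = (\<integral>\<^sup>+p. (if fst p s \<noteq> snd p s then 1 else 0) \<partial>M)"
          unfolding em[OF s(1)] using u.emeasure_space_1 by (simp add: st[OF s(1,3) False])
        also have "\<dots> = (\<integral>\<^sup>+p. indicator {p \<in> space M. fst p s \<noteq> snd p s} p \<partial>M)"
          by (intro nn_integral_cong) (auto simp: indicator_def)
        also have "\<dots> = emeasure M {p \<in> space M. fst p s \<noteq> snd p s}" by simp
        finally show ?thesis using IM s False by (auto simp: I_def)
      next
        case True
        have "emeasure N {p \<in> space N. fst p s \<noteq> snd p s}
          \<le> (\<integral>\<^sup>+p. (\<integral>\<^sup>+u. (if u \<le> accept d (w k) (g k) (snd p) then 0 else 1) \<partial>uniform_measure lborel {0..1::real}) \<partial>M)"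
          unfolding em[OF s(1)]
        proof (rule nn_integral_mono_AE, use ae in eventually_elim)
          case (elim p)
          \<comment> \<open>An accepted move adds exactly the missing amount, so disagreement at
            \<open>k\<close> forces rejection.\<close>
          then have "snd p k + lin d (g k) (snd p) * w k k = fst p k"
            using k by (intro undo) auto
          then show ?case
            using True k by (intro nn_integral_mono) (auto simp: refl_step_def)
        qed
        also have "\<dots> = (\<integral>\<^sup>+z. (\<integral>\<^sup>+u. (if u \<le> accept d (w k) (g k) z then 0 else 1) \<partial>uniform_measure lborel {0..1::real}) \<partial>gauss_vec d)"
          by (rule gauss_coupling_snd[OF M, of "\<lambda>z. \<integral>\<^sup>+u. (if u \<le> accept d (w k) (g k) z then 0 else 1) \<partial>uniform_measure lborel {0..1::real}"])
            measurable
        also have "\<dots> \<le> ennreal (r k + (r k)\<^sup>2 / 2)"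
          using r[OF k] by (intro refl_step_reject w g k) auto
        also have "\<dots> \<le> ennreal q" using r[OF k] by (intro ennreal_leI) auto
        finally show ?thesis .
      qed
      then have "I (Suc k) N" using N ae' by (simp add: I_def)
      then show ?thesis by blast
    qed
  qed
  then obtain M where "I d M" by blast
  then show ?thesis unfolding I_def by (intro exI[of _ M]) (auto elim: AE_mp)
qed

section \<open>Rotations in the plane of two flat vectors\<close>


lemma lin_commute: "lin d v z = lin d z v"
  by (simp add: lin_def mult.commute)

lemma lin_add_right: "lin d v (\<lambda>j. a * x j + b * y j) = a * lin d v x + b * lin d v y"
  by (simp add: lin_def sum.distrib sum_distrib_left algebra_simps)

lemma lin_add_left: "lin d (\<lambda>j. a * x j + b * y j) z = a * lin d x z + b * lin d y z"
  using lin_add_right[of d z a x b y] by (simp add: lin_commute)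

lemma vnorm_sq: "vnorm d v = sqrt (lin d v v)"
  by (simp add: vnorm_def lin_def power2_eq_square)

lemma refl_along_apply: "j < d \<Longrightarrow> refl_along d w x j = x j - 2 * lin d w x * w j"
  by (simp add: refl_along_def)

lemma lin_refl_along: "lin d v (refl_along d w x) = lin d v x - 2 * lin d w x * lin d v w"
  by (simp add: refl_along_def)

text \<open>The rotation is a product of two reflections.\<close>

lemma plane_rotation:
  assumes e: "lin d e e = 1" and e': "lin d e' e' = 1" and ee': "lin d e e' = 0"
    and cs: "co\<^sup>2 + si\<^sup>2 = 1" and co: "co < 1"
  obtains R where "R \<in> measurable (vec_space d) (vec_space d)"
    and "\<And>F. F \<in> borel_measurable (vec_space d) \<Longrightarrow>
      (\<integral>\<^sup>+z. F (R z) \<partial>gauss_vec d) = (\<integral>\<^sup>+z. F z \<partial>gauss_vec d)"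
    and "\<And>x. lin d e (R x) = co * lin d e x - si * lin d e' x"
    and "\<And>x. lin d e' (R x) = si * lin d e x + co * lin d e' x"
    and "\<And>x j. j < d \<Longrightarrow>
      R x j = x j + (lin d e (R x) - lin d e x) * e j + (lin d e' (R x) - lin d e' x) * e' j"
proof -
  \<comment> \<open>With \<open>co\<close> and \<open>si\<close> the cosine and sine of the angle,
    \<open>\<delta>\<close> is the length of the chord between \<open>e\<close> and its image, and
    \<open>\<nu>\<close> is the unit vector along this chord. The reflection along \<open>e'\<close>
    fixes \<open>e\<close>, and the one along \<open>\<nu>\<close> then carries \<open>e\<close> to
    its image.\<close>
  define \<delta> where "\<delta> = sqrt (2 - 2 * co)"
  have \<delta>: "\<delta> > 0" "\<delta>\<^sup>2 = 2 - 2 * co" using co by (auto simp: \<delta>_def)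
  define \<nu> where "\<nu> = (\<lambda>j. (1 - co) / \<delta> * e j + (- si / \<delta>) * e' j)"
  define R where "R x = refl_along d \<nu> (refl_along d e' x)" for x
  have \<nu>x: "lin d \<nu> x = (1 - co) / \<delta> * lin d e x + (- si / \<delta>) * lin d e' x" for x
    unfolding \<nu>_def by (rule lin_add_left)
  have x\<nu>: "lin d x \<nu> = (1 - co) / \<delta> * lin d x e + (- si / \<delta>) * lin d x e'" for x
    unfolding \<nu>_def by (rule lin_add_right)
  have e'e: "lin d e' e = 0" using ee' by (simp add: lin_commute)
  have ss: "si\<^sup>2 = (1 - co) * (1 + co)" using cs by (simp add: power2_eq_square algebra_simps)
  have \<nu>: "lin d \<nu> \<nu> = 1"
  proof -
    have "lin d \<nu> \<nu> = ((1 - co)\<^sup>2 + si\<^sup>2) / \<delta>\<^sup>2"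
      by (simp add: \<nu>x x\<nu> e e' ee' e'e power2_eq_square add_divide_distrib)
    also have "(1 - co)\<^sup>2 + si\<^sup>2 = 2 - 2 * co"
      using cs by (simp add: power2_eq_square algebra_simps)
    finally show ?thesis using \<delta> co by simp
  qed
  have \<nu>r: "lin d \<nu> (refl_along d e' x) = ((1 - co) * lin d e x + si * lin d e' x) / \<delta>" for x
    using \<delta> by (simp add: \<nu>x lin_refl_along ee' e' field_simps)
  have d2: "2 * y / \<delta> * (z / \<delta>) = y * z / (1 - co)" for y z
  proof -
    have "2 * y / \<delta> * (z / \<delta>) = 2 * (y * z) / \<delta>\<^sup>2" by (simp add: power2_eq_square)
    also have "\<dots> = 2 * (y * z) / (2 * (1 - co))" by (simp add: \<delta>(2))
    finally show ?thesis by (simp only: mult_divide_mult_cancel_left_if) simp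
  qed
  have Re: "lin d e (R x) = co * lin d e x - si * lin d e' x" for x
  proof -
    have "lin d e (R x) = lin d e x - 2 * ((1 - co) * lin d e x + si * lin d e' x) / \<delta> * ((1 - co) / \<delta>)"
      by (simp add: R_def lin_refl_along[of d e] \<nu>r x\<nu> ee' e)
    also have "\<dots> = co * lin d e x - si * lin d e' x"
      unfolding d2 using co by (simp add: field_simps)
    finally show ?thesis .
  qed
  have Re': "lin d e' (R x) = si * lin d e x + co * lin d e' x" for x
  proof -
    have "lin d e' (R x) = - lin d e' x + 2 * ((1 - co) * lin d e x + si * lin d e' x) / \<delta> * (si / \<delta>)"
      by (simp add: R_def lin_refl_along[of d e'] \<nu>r x\<nu> e'e e')
    also have "\<dots> = - lin d e' x + si * lin d e x + si\<^sup>2 * lin d e' x / (1 - co)"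
      unfolding d2 using co by (simp add: field_simps power2_eq_square)
    also have "si\<^sup>2 * lin d e' x / (1 - co) = (1 + co) * lin d e' x"
      unfolding ss using co by simp
    finally show ?thesis by (simp add: algebra_simps)
  qed
  \<comment> \<open>Both reflections displace \<open>x\<close> within the plane. The displacement is
    expressed by values of \<open>e\<close> and \<open>e'\<close>, because their values at
    \<open>R x\<close> survive the later moves.\<close>
  have Rj: "R x j = x j + (lin d e (R x) - lin d e x) * e j + (lin d e' (R x) - lin d e' x) * e' j"
    if j: "j < d" for x j
  proof -
    define c where "c = 2 * lin d \<nu> (refl_along d e' x)"
    have r: "R x j = x j - 2 * lin d e' x * e' j - c * \<nu> j"
      using j by (simp add: R_def refl_along_apply c_def)
    have 1: "lin d e (R x) - lin d e x = - c * ((1 - co) / \<delta>)"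
      by (simp add: R_def lin_refl_along[of d e] c_def x\<nu> ee' e)
    have 2: "lin d e' (R x) - lin d e' x = - 2 * lin d e' x - c * (- si / \<delta>)"
      by (simp add: R_def lin_refl_along[of d e'] c_def x\<nu> e'e e')
    show ?thesis unfolding 1 2 r \<nu>_def using \<delta>(1) by (simp add: field_simps)
  qed
  have m: "R \<in> measurable (vec_space d) (vec_space d)" unfolding R_def by measurable
  have inv: "(\<integral>\<^sup>+z. F (R z) \<partial>gauss_vec d) = (\<integral>\<^sup>+z. F z \<partial>gauss_vec d)"
    if [measurable]: "F \<in> borel_measurable (vec_space d)" for F
    unfolding R_def
    using nn_integral_gauss_refl[OF e', of "\<lambda>z. F (refl_along d \<nu> z)"] nn_integral_gauss_refl[OF \<nu>, of F]
    by simp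
  show ?thesis by (rule that[OF m inv Re Re' Rj])
qed

section \<open>A flat orthonormal pair: the first Fourier mode on d points\<close>

definition ecos :: "nat \<Rightarrow> nat \<Rightarrow> real" where
  "ecos d j = sqrt (2 / real d) * cos (2 * pi * real j / real d)"

definition esin :: "nat \<Rightarrow> nat \<Rightarrow> real" where
  "esin d j = sqrt (2 / real d) * sin (2 * pi * real j / real d)"

text \<open>The double-angle formulas reduce all three products to sums of
  \<open>cos (2 * \<theta> j)\<close> and \<open>sin (2 * \<theta> j)\<close>. These are the real
  and imaginary parts of a geometric series in \<open>z\<close>, a \<open>d\<close>-th root of unity
  that differs from 1 once \<open>d \<ge> 3\<close>.\<close>

lemma ecos_esin_orthonormal:
  assumes d: "d \<ge> 3"
  shows "lin d (ecos d) (ecos d) = 1" "lin d (esin d) (esin d) = 1" "lin d (ecos d) (esin d) = 0"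
proof -
  define \<theta> where "\<theta> j = 2 * pi * real j / real d" for j
  define z where "z = cis (4 * pi / real d)"
  have "z \<noteq> 1"
  proof
    assume "z = 1"
    then have "cos (4 * pi / real d) = 1" by (simp add: z_def complex_eq_iff)
    then obtain n :: int where n: "4 * pi / real d = real_of_int n * 2 * pi"
      using cos_one_2pi_int by auto
    then have n': "2 = real_of_int n * real d" using d pi_gt_zero by (simp add: field_simps)
    then have "2 = n * int d" by (metis of_int_eq_iff of_int_mult of_int_numeral of_int_of_nat_eq)
    then have "int d dvd 2" by (metis dvd_triv_right)
    then show False using d zdvd_imp_le by fastforce
  qed
  moreover have "z ^ d = 1"
  proof -
    have "z ^ d = cis (real d * (4 * pi / real d))" unfolding z_def by (rule Complex.DeMoivre)
    also have "real d * (4 * pi / real d) = 2 * pi * 2" using d by simp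
    also have "cis (2 * pi * 2) = 1"
      using cos_2npi[of 2] sin_2npi[of 2] by (simp add: complex_eq_iff mult_ac)
    finally show ?thesis .
  qed
  ultimately have "(\<Sum>j<d. z ^ j) = 0" by (simp add: geometric_sum)
  moreover have "z ^ j = cis (2 * \<theta> j)" for j
    unfolding z_def Complex.DeMoivre by (simp add: \<theta>_def mult_ac)
  ultimately have "(\<Sum>j<d. cis (2 * \<theta> j)) = 0" by simp
  then have c: "(\<Sum>j<d. cos (2 * \<theta> j)) = 0" and s: "(\<Sum>j<d. sin (2 * \<theta> j)) = 0"
    by (simp_all add: complex_eq_iff)
  have sq: "sqrt (2 / real d) * x * (sqrt (2 / real d) * y) = 2 / real d * (x * y)" for x y
    using d by (metis (no_types, opaque_lifting) mult.assoc mult.left_commute real_sqrt_mult_self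
        abs_of_nonneg divide_nonneg_nonneg of_nat_0_le_iff zero_le_numeral)
  have "lin d (ecos d) (ecos d) = (\<Sum>j<d. 2 / real d * ((1 + cos (2 * \<theta> j)) / 2))"
    unfolding lin_def ecos_def \<theta>_def[symmetric] sq
    by (intro sum.cong refl) (simp add: cos_double_cos power2_eq_square)
  also have "\<dots> = 1 / real d * (\<Sum>j<d. 1 + cos (2 * \<theta> j))"
    unfolding sum_distrib_left by (intro sum.cong refl) (simp add: field_simps)
  finally show "lin d (ecos d) (ecos d) = 1" using d by (simp add: sum.distrib c)
  have "lin d (esin d) (esin d) = (\<Sum>j<d. 2 / real d * ((1 - cos (2 * \<theta> j)) / 2))"
    unfolding lin_def esin_def \<theta>_def[symmetric] sq
    by (intro sum.cong refl) (simp add: cos_double_sin power2_eq_square)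
  also have "\<dots> = 1 / real d * (\<Sum>j<d. 1 - cos (2 * \<theta> j))"
    unfolding sum_distrib_left by (intro sum.cong refl) (simp add: field_simps)
  finally show "lin d (esin d) (esin d) = 1" using d by (simp add: sum_subtractf c)
  have "lin d (ecos d) (esin d) = (\<Sum>j<d. 2 / real d * (sin (2 * \<theta> j) / 2))"
    unfolding lin_def esin_def ecos_def \<theta>_def[symmetric] sq
    by (intro sum.cong refl) (simp add: sin_double)
  also have "\<dots> = 1 / real d * (\<Sum>j<d. sin (2 * \<theta> j))"
    unfolding sum_distrib_left by (intro sum.cong refl) (simp add: field_simps)
  finally show "lin d (ecos d) (esin d) = 0" by (simp add: s)
qed

text \<open>This is the flatness: every coordinate vector has the same projection length on the
  plane. It controls the displacement of each single coordinate under the rotation.\<close>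

lemma ecos_esin_sq: "d > 0 \<Longrightarrow> (ecos d j)\<^sup>2 + (esin d j)\<^sup>2 = 2 / real d"
  unfolding ecos_def esin_def power_mult_distrib distrib_left[symmetric] by simp

text \<open>A shift by about a third of the circle keeps the angle between \<open>t\<close> and its
  sink away from 0 and from half a turn, where the restrictions of \<open>ecos d\<close> and
  \<open>esin d\<close> to the two sinks would become dependent. A shift is also injective, so a
  uniform \<open>t\<close> makes each coordinate a sink with probability at most 2 / d.\<close>

definition sink :: "nat \<Rightarrow> nat \<Rightarrow> nat" where
  "sink d t = (t + d div 3) mod d"

lemma sink_sin:
  assumes d: "d \<ge> 3" and t: "t < d"
  shows "sink d t < d" "sink d t \<noteq> t"
    "(sin (2 * pi * (real (sink d t) - real t) / real d))\<^sup>2 \<ge> 3 / 4"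
proof -
  define k where "k = d div 3"
  \<comment> \<open>The floor costs at most a factor 2: d / 6 \<le> k \<le> d / 3, so the angle lies
    between \<pi> / 3 and 2 \<pi> / 3.\<close>
  have k: "k \<ge> 1" "3 * k \<le> d" "d \<le> 6 * k" using d unfolding k_def by presburger+
  show "sink d t < d" using d by (simp add: sink_def)
  have cases: "sink d t = t + k \<or> (sink d t = t + k - d \<and> t + k \<ge> d)"
  proof (cases "t + k < d")
    case True
    then show ?thesis by (simp add: sink_def k_def[symmetric])
  next
    case False
    then have "(t + k) mod d = t + k - d"
      using t k by (simp add: le_mod_geq)
    then show ?thesis using False by (simp add: sink_def k_def[symmetric])
  qed
  then show "sink d t \<noteq> t" using k d by auto
  define x where "x = 2 * pi * real k / real d"
  have "sin (2 * pi * (real (sink d t) - real t) / real d) = sin x"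
    using cases
  proof
    assume "sink d t = t + k"
    then show ?thesis by (simp add: x_def)
  next
    assume *: "sink d t = t + k - d \<and> t + k \<ge> d"
    then have "2 * pi * (real (sink d t) - real t) / real d = x - 2 * pi"
      using d by (simp add: x_def of_nat_diff field_simps)
    then show ?thesis by (simp add: sin_diff)
  qed
  moreover have "(sin x)\<^sup>2 \<ge> 3 / 4"
  proof -
    have x: "pi / 3 \<le> x" "x \<le> 2 * pi / 3"
    proof -
      have "real d \<le> real (6 * k)" "real (3 * k) \<le> real d" using k by (simp_all only: of_nat_le_iff)
      then have "real d \<le> 6 * real k" "3 * real k \<le> real d" by simp_all
      then have "pi * real d \<le> pi * (6 * real k)" "pi * (3 * real k) \<le> pi * real d"
        by (simp_all add: pi_gt_zero)
      then show "pi / 3 \<le> x" "x \<le> 2 * pi / 3"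
        using d by (simp_all add: x_def field_simps)
    qed
    have "cos x \<le> cos (pi / 3)" using x pi_gt_zero by (intro cos_monotone_0_pi_le) auto
    moreover have "cos (2 * pi / 3) \<le> cos x" using x pi_gt_zero by (intro cos_monotone_0_pi_le) auto
    ultimately have "\<bar>cos x\<bar> \<le> 1 / 2" by (simp add: cos_60 cos_120)
    then have "\<bar>cos x\<bar>\<^sup>2 \<le> (1 / 2)\<^sup>2" by (intro power_mono) auto
    then have "(cos x)\<^sup>2 \<le> 1 / 4" by (simp only: power2_abs) (simp add: power2_eq_square)
    then show ?thesis using sin_cos_squared_add[of x] by linarith
  qed
  ultimately show "(sin (2 * pi * (real (sink d t) - real t) / real d))\<^sup>2 \<ge> 3 / 4" by simp
qed

lemma lin_three_support:
  assumes "a < d" "b < d" "c < d" "a \<noteq> b" "a \<noteq> c" "b \<noteq> c"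
  shows "lin d v (\<lambda>j. if j = a then x else if j = b then y else if j = c then z else 0)
    = v a * x + v b * y + v c * z"
proof -
  have "lin d v (\<lambda>j. if j = a then x else if j = b then y else if j = c then z else 0)
     = (\<Sum>j<d. (if j = a then v j * x else 0) + (if j = b then v j * y else 0) + (if j = c then v j * z else 0))"
    unfolding lin_def using assms by (intro sum.cong) auto
  then show ?thesis using assms by (simp add: sum.distrib)
qed

text \<open>The coefficients are the cross product of the restrictions of \<open>ecos\<close>, \<open>esin\<close> to the three
  coordinates \<open>s\<close>, \<open>a\<close>, \<open>b\<close>.\<close>

lemma three_coordinate_direction:
  assumes d: "d \<ge> 3" and s: "s < d" "a < d" "b < d" "s \<noteq> a" "s \<noteq> b" "a \<noteq> b"
    and ab: "(sin (2 * pi * (real b - real a) / real d))\<^sup>2 \<ge> 3 / 4"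
  obtains w where "lin d w w = 1" "lin d (ecos d) w = 0" "lin d (esin d) w = 0"
    "(w s)\<^sup>2 \<ge> 1 / 4" "\<And>j. j \<noteq> s \<Longrightarrow> j \<noteq> a \<Longrightarrow> j \<noteq> b \<Longrightarrow> w j = 0"
proof -
  define \<theta> where "\<theta> j = 2 * pi * real j / real d" for j
  \<comment> \<open>Up to the factor 2 / d these are the minors of the cross product;
    \<open>x\<close>, the one that belongs to \<open>s\<close>, depends on the sinks only.\<close>
  define x y z where "x = sin (\<theta> b - \<theta> a)" and "y = sin (\<theta> s - \<theta> b)" and "z = sin (\<theta> a - \<theta> s)"
  define n where "n = sqrt (x\<^sup>2 + y\<^sup>2 + z\<^sup>2)"
  have "\<theta> b - \<theta> a = 2 * pi * (real b - real a) / real d"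
    by (simp add: \<theta>_def diff_divide_distrib right_diff_distrib)
  then have x: "x\<^sup>2 \<ge> 3 / 4" using ab by (simp add: x_def)
  have le1: "(sin u)\<^sup>2 \<le> 1" for u :: real
    using sin_cos_squared_add[of u] zero_le_power2[of "cos u"] by linarith
  have n2: "n\<^sup>2 = x\<^sup>2 + y\<^sup>2 + z\<^sup>2" by (simp add: n_def)
  \<comment> \<open>Three sines give \<open>n\<^sup>2 \<le> 3\<close>, and the sink angle gives
    \<open>x\<^sup>2 \<ge> 3 / 4\<close>; their quotient is the bound 1 / 4 for
    \<open>(w s)\<^sup>2\<close>.\<close>
  have "x\<^sup>2 \<le> 1" "y\<^sup>2 \<le> 1" "z\<^sup>2 \<le> 1" by (auto simp: x_def y_def z_def le1)
  then have n: "n\<^sup>2 \<le> 3" "n\<^sup>2 > 0" using x n2 zero_le_power2[of y] zero_le_power2[of z] by linarith+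
  then have n0: "n > 0" by (simp add: n_def)
  define u where "u j = (if j = s then x else if j = a then y else if j = b then z else 0)" for j
  define w where "w j = u j / n" for j
  have lw: "lin d v w = lin d v u / n" for v
    by (simp add: lin_def w_def sum_divide_distrib)
  have lu: "lin d v u = v s * x + v a * y + v b * z" for v
    unfolding u_def using s by (intro lin_three_support) auto
  have "lin d w w = (x * x + y * y + z * z) / n / n"
    unfolding lw lu using s by (simp add: w_def u_def add_divide_distrib)
  also have "\<dots> = (x\<^sup>2 + y\<^sup>2 + z\<^sup>2) / n\<^sup>2" by (simp add: power2_eq_square)
  finally have 1: "lin d w w = 1" using n n2 by simp
  have 2: "lin d (ecos d) w = 0"
  proof -
    have "ecos d s * x + ecos d a * y + ecos d b * z
       = sqrt (2 / real d) * (cos (\<theta> s) * x + cos (\<theta> a) * y + cos (\<theta> b) * z)"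
      by (simp add: ecos_def \<theta>_def algebra_simps)
    \<comment> \<open>A determinant with two equal rows, expanded along one of them.\<close>
    also have "cos (\<theta> s) * x + cos (\<theta> a) * y + cos (\<theta> b) * z = 0"
      by (simp add: x_def y_def z_def sin_diff algebra_simps)
    finally show ?thesis by (simp add: lw lu)
  qed
  have 3: "lin d (esin d) w = 0"
  proof -
    have "esin d s * x + esin d a * y + esin d b * z
       = sqrt (2 / real d) * (sin (\<theta> s) * x + sin (\<theta> a) * y + sin (\<theta> b) * z)"
      by (simp add: esin_def \<theta>_def algebra_simps)
    also have "sin (\<theta> s) * x + sin (\<theta> a) * y + sin (\<theta> b) * z = 0"
      by (simp add: x_def y_def z_def sin_diff algebra_simps)
    finally show ?thesis by (simp add: lw lu)
  qed
  have "(w s)\<^sup>2 = x\<^sup>2 / n\<^sup>2" by (simp add: w_def u_def power_divide)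
  also have "\<dots> \<ge> 1 / 4" using n x by (simp add: field_simps)
  finally have 4: "(w s)\<^sup>2 \<ge> 1 / 4" .
  have 5: "w j = 0" if "j \<noteq> s" "j \<noteq> a" "j \<noteq> b" for j using that by (simp add: w_def u_def)
  show ?thesis by (rule that[OF 1 2 3 4 5])
qed

text \<open>The direction chosen for \<open>s\<close> has
  \<open>\<bar>w s s\<bar> \<ge> 1 / 2\<close>, so restoring the coordinate takes a move of standard
  deviation \<open>r s \<le> 2 * \<delta> * sqrt (2 / real d)\<close>. As this is at most 1,
  \<open>r s + (r s)\<^sup>2 / 2\<close> is at most 3 / 2 times \<open>r s\<close>, which gives the
  constant 3.\<close>

lemma coupling_fixed_sinks:
  assumes d: "d \<ge> 3" and t: "t < d" and cs: "co\<^sup>2 + si\<^sup>2 = 1" and \<delta>: "0 < \<delta>" "\<delta> \<le> 1 / 2" "\<delta>\<^sup>2 = 2 - 2 * co"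
  shows "\<exists>M. gauss_coupling d M \<and>
    (AE p in M. lin d (ecos d) (snd p) = co * lin d (ecos d) (fst p) - si * lin d (esin d) (fst p) \<and>
       lin d (esin d) (snd p) = si * lin d (ecos d) (fst p) + co * lin d (esin d) (fst p)) \<and>
    (\<forall>s<d. s \<notin> {t, sink d t} \<longrightarrow>
       emeasure M {p \<in> space M. fst p s \<noteq> snd p s} \<le> ennreal (3 * \<delta> * sqrt (2 / real d)))"
proof -
  let ?e = "ecos d" and ?e' = "esin d"
  note on = ecos_esin_orthonormal[OF d]
  have on': "lin d ?e' ?e = 0" using on(3) by (simp add: lin_commute)
  have co: "co < 1" using \<delta> zero_less_power[of \<delta> 2] by simp
  obtain R where R: "R \<in> measurable (vec_space d) (vec_space d)"
    "\<And>F. F \<in> borel_measurable (vec_space d) \<Longrightarrow> (\<integral>\<^sup>+z. F (R z) \<partial>gauss_vec d) = (\<integral>\<^sup>+z. F z \<partial>gauss_vec d)"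
    and Re: "\<And>x. lin d ?e (R x) = co * lin d ?e x - si * lin d ?e' x"
    and Re': "\<And>x. lin d ?e' (R x) = si * lin d ?e x + co * lin d ?e' x"
    and Rj: "\<And>x j. j < d \<Longrightarrow>
      R x j = x j + (lin d ?e (R x) - lin d ?e x) * ?e j + (lin d ?e' (R x) - lin d ?e' x) * ?e' j"
    by (rule plane_rotation[OF on cs co]) blast
  define T where "T = {t, sink d t}"
  have "\<exists>w. lin d w w = 1 \<and> lin d ?e w = 0 \<and> lin d ?e' w = 0 \<and> (w s)\<^sup>2 \<ge> 1 / 4 \<and>
      (\<forall>j. j \<notin> T \<longrightarrow> j \<noteq> s \<longrightarrow> w j = 0)" if "s < d" "s \<notin> T" for s
  proof (rule three_coordinate_direction[OF d that(1) t sink_sin(1)[OF d t] _ _ _ sink_sin(3)[OF d t]])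
    fix w :: "nat \<Rightarrow> real"
    assume "lin d w w = 1" "lin d ?e w = 0" "lin d ?e' w = 0" "(w s)\<^sup>2 \<ge> 1 / 4"
      "\<And>j. j \<noteq> s \<Longrightarrow> j \<noteq> t \<Longrightarrow> j \<noteq> sink d t \<Longrightarrow> w j = 0"
    then show ?thesis by (intro exI[of _ w]) (auto simp: T_def)
  qed (use that sink_sin(2)[OF d t] in \<open>auto simp: T_def\<close>)
  then have "\<forall>s\<in>{..<d} - T. \<exists>w. lin d w w = 1 \<and> lin d ?e w = 0 \<and> lin d ?e' w = 0 \<and> (w s)\<^sup>2 \<ge> 1 / 4 \<and>
      (\<forall>j. j \<notin> T \<longrightarrow> j \<noteq> s \<longrightarrow> w j = 0)" by blast
  from bchoice[OF this] obtain w where "\<forall>s\<in>{..<d} - T. lin d (w s) (w s) = 1 \<and> lin d ?e (w s) = 0 \<and>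
      lin d ?e' (w s) = 0 \<and> (w s s)\<^sup>2 \<ge> 1 / 4 \<and> (\<forall>j. j \<notin> T \<longrightarrow> j \<noteq> s \<longrightarrow> w s j = 0)" ..
  then have w: "\<And>s. s < d \<Longrightarrow> s \<notin> T \<Longrightarrow> lin d (w s) (w s) = 1 \<and> lin d ?e (w s) = 0 \<and>
      lin d ?e' (w s) = 0 \<and> (w s s)\<^sup>2 \<ge> 1 / 4 \<and> (\<forall>j. j \<notin> T \<longrightarrow> j \<noteq> s \<longrightarrow> w s j = 0)"
    by simp
  \<comment> \<open>The displacement of coordinate \<open>s\<close> under the rotation is
    \<open>p s\<close> times the value of \<open>ecos d\<close> plus \<open>p' s\<close> times the
    value of \<open>esin d\<close>, both taken after the rotation. Every later move keeps these
    values, so \<open>g s\<close> reads the required step off the current vector. As a combination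
    of the two, \<open>g s\<close> is orthogonal to \<open>w s\<close>.\<close>
  define p p' where "p s = (1 - co) * ?e s + si * ?e' s" and "p' s = (1 - co) * ?e' s - si * ?e s" for s
  define g where "g s = (\<lambda>j. (- p s / w s s) * ?e j + (- p' s / w s s) * ?e' j)" for s
  define r where "r s = \<delta> * sqrt (2 / real d) / \<bar>w s s\<bar>" for s
  have gz: "lin d (g s) z = (- p s / w s s) * lin d ?e z + (- p' s / w s s) * lin d ?e' z" for s z
    unfolding g_def by (rule lin_add_left)
  have zg: "lin d z (g s) = (- p s / w s s) * lin d z ?e + (- p' s / w s s) * lin d z ?e'" for s z
    unfolding g_def by (rule lin_add_right)
  \<comment> \<open>In complex form, p + i p' is the product of 1 - co - i si and e + i e', and the
    modulus is multiplicative.\<close>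
  have pp: "(p s)\<^sup>2 + (p' s)\<^sup>2 = \<delta>\<^sup>2 * (2 / real d)" for s
  proof -
    have "(p s)\<^sup>2 + (p' s)\<^sup>2 = ((1 - co)\<^sup>2 + si\<^sup>2) * ((?e s)\<^sup>2 + (?e' s)\<^sup>2)"
      by (simp add: p_def p'_def power2_eq_square algebra_simps)
    also have "(1 - co)\<^sup>2 + si\<^sup>2 = \<delta>\<^sup>2"
      using cs \<delta>(3) by (simp add: power2_eq_square algebra_simps)
    finally show ?thesis using d by (simp add: ecos_esin_sq)
  qed
  have q1: "2 * \<delta> * sqrt (2 / real d) \<le> 1"
  proof -
    have "sqrt (2 / real d) \<le> sqrt 1" using d by (intro real_sqrt_le_mono) auto
    then have "2 * \<delta> * sqrt (2 / real d) \<le> 1 * 1" using \<delta> by (intro mult_mono) auto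
    then show ?thesis by simp
  qed
  have "\<exists>M. gauss_coupling d M \<and>
    (AE p in M. lin d ?e (snd p) = lin d ?e (R (fst p)) \<and> lin d ?e' (snd p) = lin d ?e' (R (fst p))) \<and>
    (\<forall>s<d. s \<notin> T \<longrightarrow> emeasure M {p \<in> space M. fst p s \<noteq> snd p s} \<le> ennreal (3 * \<delta> * sqrt (2 / real d)))"
  proof (rule coupling_with_sinks[OF R, where w = w and g = g and r = r])
    fix s assume s: "s < d" "s \<notin> T"
    note ws = w[OF s]
    have w0: "w s s \<noteq> 0" using ws by auto
    have aw: "\<bar>w s s\<bar> \<ge> 1 / 2"
    proof -
      have "(1 / 2)\<^sup>2 \<le> \<bar>w s s\<bar>\<^sup>2" using ws by (simp add: power2_eq_square)
      then show ?thesis using abs_ge_zero power2_le_imp_le by blast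
    qed
    show "lin d (w s) (w s) = 1" "lin d ?e (w s) = 0" "lin d ?e' (w s) = 0" using ws by auto
    show "lin d (g s) (w s) = 0" using ws by (simp add: gz)
    have "lin d (g s) (g s) = ((p s)\<^sup>2 + (p' s)\<^sup>2) / (w s s)\<^sup>2"
      by (simp add: gz zg on on' power2_eq_square add_divide_distrib)
    also have "\<dots> = (r s)\<^sup>2"
      unfolding pp r_def by (simp add: power_divide power_mult_distrib)
    finally show "lin d (g s) (g s) = (r s)\<^sup>2" .
    have r0: "r s > 0" using \<delta> d w0 by (simp add: r_def)
    have r1: "r s \<le> 2 * \<delta> * sqrt (2 / real d)"
    proof -
      have "\<delta> * sqrt (2 / real d) * 1 \<le> \<delta> * sqrt (2 / real d) * (2 * \<bar>w s s\<bar>)"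
        using aw \<delta> by (intro mult_left_mono) auto
      then show ?thesis using w0 by (simp add: r_def field_simps)
    qed
    have "r s * r s \<le> r s * 1" using r1 q1 r0 by (intro mult_left_mono) auto
    then have "(r s)\<^sup>2 \<le> r s" by (simp only: power2_eq_square mult_1_right)
    then show "r s > 0 \<and> r s + (r s)\<^sup>2 / 2 \<le> 3 * \<delta> * sqrt (2 / real d)"
      using r0 r1 by linarith
    show "w s j = 0" if "j \<notin> T" "j \<noteq> s" for j using ws that by simp
    fix x z
    assume z: "lin d ?e z = lin d ?e (R x)" "lin d ?e' z = lin d ?e' (R x)" "z s = R x s"
    define A B where "A = lin d ?e x" and "B = lin d ?e' x"
    define U V where "U = co * A - si * B" and "V = si * A + co * B"
    have "co * U + si * V = (co\<^sup>2 + si\<^sup>2) * A" "co * V - si * U = (co\<^sup>2 + si\<^sup>2) * B"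
      by (simp_all add: U_def V_def power2_eq_square algebra_simps)
    \<comment> \<open>The inverse rotation recovers the original values \<open>A\<close>,
      \<open>B\<close> from the rotated ones \<open>U\<close>, \<open>V\<close>.\<close>
    then have AB: "A = co * U + si * V" "B = co * V - si * U" by (simp_all add: cs)
    have "lin d (g s) z * w s s = - p s * lin d ?e (R x) - p' s * lin d ?e' (R x)"
      using w0 by (simp add: gz z(1,2) algebra_simps)
    also have "\<dots> = - p s * U - p' s * V"
      unfolding Re Re' U_def V_def A_def B_def ..
    also have "\<dots> = - ((U - (co * U + si * V)) * ?e s + (V - (co * V - si * U)) * ?e' s)"
      unfolding p_def p'_def by (simp add: algebra_simps)
    also have "\<dots> = x s - R x s"
      using Rj[OF s(1), of x]
      unfolding Re Re' A_def[symmetric] B_def[symmetric] U_def[symmetric] V_def[symmetric]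
      unfolding AB(1)[symmetric] AB(2)[symmetric] by simp
    finally show "z s + lin d (g s) z * w s s = x s" using z(3) by simp
  qed
  then show ?thesis unfolding Re Re' T_def .
qed

section \<open>Two regressors with coupled examples\<close>


text \<open>Mixing over a uniform index preserves Gaussian marginals and almost sure properties, and
  it averages the probabilities of all other events. So an entry that is a sink for few indices is
  lost with small probability.\<close>

lemma gauss_coupling_average:
  assumes d: "d \<ge> 1"
    and M: "\<And>t. t < d \<Longrightarrow> gauss_coupling d (M t)"
    and Q [measurable]: "Measurable.pred (vec_space d \<Otimes>\<^sub>M vec_space d) Q"
    and ae: "\<And>t. t < d \<Longrightarrow> AE p in M t. Q p"
  shows "\<exists>N. gauss_coupling d N \<and> (AE p in N. Q p) \<and>
    (\<forall>A\<in>sets (vec_space d \<Otimes>\<^sub>M vec_space d). emeasure N A = (\<Sum>t<d. emeasure (M t) A) / of_nat d)"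
proof -
  \<comment> \<open>The hypotheses concern indices below \<open>d\<close> only; reduction modulo
    \<open>d\<close> turns the family into a kernel on all naturals.\<close>
  define K where "K t = M (t mod d)" for t
  define P where "P = measure_pmf (pmf_of_set {..<d})"
  define N where "N = P \<bind> K"
  have tm: "t mod d < d" for t using d by simp
  have K: "gauss_coupling d (K t)" for t unfolding K_def by (rule M[OF tm])
  have Km [measurable]: "K \<in> measurable P (subprob_algebra (vec_space d \<Otimes>\<^sub>M vec_space d))"
  proof -
    have "K t \<in> space (subprob_algebra (vec_space d \<Otimes>\<^sub>M vec_space d))" for t
      using gauss_coupling_prob[OF K[of t]] gauss_coupling_sets[OF K[of t]]
      by (simp add: space_subprob_algebra prob_space_imp_subprob_space)
    then show ?thesis by (simp add: P_def)
  qed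
  have ne: "{..<d} \<noteq> {}" using d by (simp add: lessThan_empty_iff)
  have sN: "sets N = sets (vec_space d \<Otimes>\<^sub>M vec_space d)"
    unfolding N_def by (rule sets_bind) (auto simp: gauss_coupling_sets[OF K] P_def)
  have int: "(\<integral>\<^sup>+p. F p \<partial>N) = (\<Sum>t<d. \<integral>\<^sup>+p. F p \<partial>M t) / of_nat d"
    if [measurable]: "F \<in> borel_measurable (vec_space d \<Otimes>\<^sub>M vec_space d)" for F
  proof -
    have "(\<integral>\<^sup>+p. F p \<partial>N) = (\<integral>\<^sup>+t. (\<integral>\<^sup>+p. F p \<partial>K t) \<partial>P)"
      unfolding N_def by (rule nn_integral_bind[OF that Km])
    also have "\<dots> = (\<Sum>t<d. \<integral>\<^sup>+p. F p \<partial>K t) / of_nat d"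
      unfolding P_def using ne by (subst nn_integral_pmf_of_set) auto
    also have "(\<Sum>t<d. \<integral>\<^sup>+p. F p \<partial>K t) = (\<Sum>t<d. \<integral>\<^sup>+p. F p \<partial>M t)"
      by (intro sum.cong) (auto simp: K_def)
    finally show ?thesis .
  qed
  have dd: "(\<Sum>t<d. c) / of_nat d = c" for c :: ennreal
  proof -
    have "(\<Sum>t<d. c) = c * of_nat d" by (simp add: mult.commute)
    then show ?thesis using d by (simp only:) (rule ennreal_mult_divide_eq, auto)
  qed
  have "gauss_coupling d N"
  proof (rule gauss_couplingI[OF sN])
    fix F :: "(nat \<Rightarrow> real) \<Rightarrow> ennreal" assume F [measurable]: "F \<in> borel_measurable (vec_space d)"
    have "(\<Sum>t<d. \<integral>\<^sup>+p. F (fst p) \<partial>M t) = (\<Sum>t<d. \<integral>\<^sup>+x. F x \<partial>gauss_vec d)"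
      by (intro sum.cong refl gauss_coupling_fst[OF M F]) simp
    then show "(\<integral>\<^sup>+p. F (fst p) \<partial>N) = (\<integral>\<^sup>+x. F x \<partial>gauss_vec d)"
      by (subst int) (measurable, simp only: dd)
    have "(\<Sum>t<d. \<integral>\<^sup>+p. F (snd p) \<partial>M t) = (\<Sum>t<d. \<integral>\<^sup>+x. F x \<partial>gauss_vec d)"
      by (intro sum.cong refl gauss_coupling_snd[OF M F]) simp
    then show "(\<integral>\<^sup>+p. F (snd p) \<partial>N) = (\<integral>\<^sup>+x. F x \<partial>gauss_vec d)"
      by (subst int) (measurable, simp only: dd)
  qed
  moreover have em: "emeasure N A = (\<Sum>t<d. emeasure (M t) A) / of_nat d"
    if A [measurable]: "A \<in> sets (vec_space d \<Otimes>\<^sub>M vec_space d)" for A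
    using int[of "indicator A"] A by (simp add: sN gauss_coupling_sets[OF M])
  moreover have "AE p in N. Q p"
  proof -
    have B: "{p \<in> space (vec_space d \<Otimes>\<^sub>M vec_space d). \<not> Q p} \<in> sets (vec_space d \<Otimes>\<^sub>M vec_space d)"
      by measurable
    have "emeasure (M t) {p \<in> space (vec_space d \<Otimes>\<^sub>M vec_space d). \<not> Q p} = 0" if "t < d" for t
      using ae[OF that] B sets_eq_imp_space_eq[OF gauss_coupling_sets[OF M[OF that]]]
      by (subst (asm) AE_iff_measurable[OF _ refl]) (auto simp: gauss_coupling_sets[OF M[OF that]])
    then have "emeasure N {p \<in> space (vec_space d \<Otimes>\<^sub>M vec_space d). \<not> Q p} = 0"
      by (simp add: em[OF B])
    then show ?thesis
      using B sN sets_eq_imp_space_eq[OF sN] by (subst AE_iff_measurable[OF _ refl]) auto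
  qed
  ultimately show ?thesis by blast
qed

text \<open>\<open>s\<close> equals \<open>t\<close> for one index, and \<open>sink d\<close>, being
  a cyclic shift, takes the value \<open>s\<close> at most once.\<close>

lemma sink_count:
  assumes s: "s < d"
  shows "card {t. t < d \<and> s \<in> {t, sink d t}} \<le> 2"
proof -
  have inj: "inj_on (sink d) {..<d}"
  proof (rule inj_onI)
    fix t u assume tu: "t \<in> {..<d}" "u \<in> {..<d}" and "sink d t = sink d u"
    then have "(t + d div 3) mod d = (u + d div 3) mod d" by (simp add: sink_def)
    then have "t mod d = u mod d" by (simp add: mod_eq_dvd_iff_nat mod_add_cong nat_mod_eq_iff)
    then show "t = u" using tu by simp
  qed
  have "card {t. t < d \<and> s = sink d t} \<le> 1"
    using inj by (subst card_le_Suc0_iff_eq[simplified One_nat_def[symmetric]]) (auto simp: inj_on_def)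
  moreover have "{t. t < d \<and> s \<in> {t, sink d t}} \<subseteq> {s} \<union> {t. t < d \<and> s = sink d t}" by auto
  then have "card {t. t < d \<and> s \<in> {t, sink d t}} \<le> card ({s} \<union> {t. t < d \<and> s = sink d t})"
    by (intro card_mono) auto
  moreover have "card ({s} \<union> {t. t < d \<and> s = sink d t}) \<le> card {s} + card {t. t < d \<and> s = sink d t}"
    by (rule card_Un_le)
  ultimately show ?thesis by simp
qed

lemma pred_neq_coordinate:
  assumes "s < d"
  shows "{p \<in> space (vec_space d \<Otimes>\<^sub>M vec_space d). fst p s \<noteq> snd p s} \<in> sets (vec_space d \<Otimes>\<^sub>M vec_space d)"
proof -
  have "(\<lambda>p. fst p s) \<in> borel_measurable (vec_space d \<Otimes>\<^sub>M vec_space d)"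
       "(\<lambda>p. snd p s) \<in> borel_measurable (vec_space d \<Otimes>\<^sub>M vec_space d)"
    using assms by (auto intro!: measurable_compose[OF measurable_fst measurable_component_vec]
        measurable_compose[OF measurable_snd measurable_component_vec])
  then show ?thesis by measurable
qed

text \<open>For the at most two indices that make \<open>s\<close> a sink, the probability of a
  change is bounded by 1; for the others by \<open>q\<close>.\<close>

lemma coupling_random_sinks:
  assumes d: "d \<ge> 3" and cs: "co\<^sup>2 + si\<^sup>2 = 1" and \<delta>: "0 < \<delta>" "\<delta> \<le> 1 / 2" "\<delta>\<^sup>2 = 2 - 2 * co"
  shows "\<exists>M. gauss_coupling d M \<and>
    (AE p in M. lin d (ecos d) (snd p) = co * lin d (ecos d) (fst p) - si * lin d (esin d) (fst p) \<and>
       lin d (esin d) (snd p) = si * lin d (ecos d) (fst p) + co * lin d (esin d) (fst p)) \<and>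
    (\<forall>s<d. emeasure M {p \<in> space M. fst p s \<noteq> snd p s} \<le> ennreal (2 / real d + 3 * \<delta> * sqrt (2 / real d)))"
proof -
  define q where "q = 3 * \<delta> * sqrt (2 / real d)"
  have q: "q \<ge> 0" using \<delta> by (simp add: q_def)
  let ?Q = "\<lambda>p. lin d (ecos d) (snd p) = co * lin d (ecos d) (fst p) - si * lin d (esin d) (fst p) \<and>
       lin d (esin d) (snd p) = si * lin d (ecos d) (fst p) + co * lin d (esin d) (fst p)"
  have "\<forall>t\<in>{..<d}. \<exists>M. gauss_coupling d M \<and> (AE p in M. ?Q p) \<and>
    (\<forall>s<d. s \<notin> {t, sink d t} \<longrightarrow> emeasure M {p \<in> space M. fst p s \<noteq> snd p s} \<le> ennreal q)"
    using coupling_fixed_sinks[OF d _ cs \<delta>] by (auto simp: q_def)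
  from bchoice[OF this] obtain M where M: "\<forall>t\<in>{..<d}. gauss_coupling d (M t) \<and> (AE p in M t. ?Q p) \<and>
    (\<forall>s<d. s \<notin> {t, sink d t} \<longrightarrow> emeasure (M t) {p \<in> space (M t). fst p s \<noteq> snd p s} \<le> ennreal q)" ..
  have Mt: "gauss_coupling d (M t)" if "t < d" for t using M that by auto
  have "\<exists>N. gauss_coupling d N \<and> (AE p in N. ?Q p) \<and>
    (\<forall>A\<in>sets (vec_space d \<Otimes>\<^sub>M vec_space d). emeasure N A = (\<Sum>t<d. emeasure (M t) A) / of_nat d)"
  proof (rule gauss_coupling_average)
    show "Measurable.pred (vec_space d \<Otimes>\<^sub>M vec_space d) ?Q" by measurable
  qed (use M d in auto)
  then obtain N where N: "gauss_coupling d N" "AE p in N. ?Q p"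
    "\<And>A. A \<in> sets (vec_space d \<Otimes>\<^sub>M vec_space d) \<Longrightarrow> emeasure N A = (\<Sum>t<d. emeasure (M t) A) / of_nat d"
    by blast
  have "emeasure N {p \<in> space N. fst p s \<noteq> snd p s} \<le> ennreal (2 / real d + q)" if s: "s < d" for s
  proof -
    have sp: "space K = space (vec_space d \<Otimes>\<^sub>M vec_space d)" if "gauss_coupling d K" for K
      using sets_eq_imp_space_eq[OF gauss_coupling_sets[OF that]] .
    have "emeasure N {p \<in> space N. fst p s \<noteq> snd p s}
      = (\<Sum>t<d. emeasure (M t) {p \<in> space (M t). fst p s \<noteq> snd p s}) / of_nat d"
      using N(3)[OF pred_neq_coordinate[OF s]] by (simp add: sp[OF N(1)] sp[OF Mt])
    also have "\<dots> \<le> (\<Sum>t<d. ennreal ((if s \<in> {t, sink d t} then 1 else 0) + q)) / of_nat d"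
    proof (intro divide_right_mono_ennreal sum_mono)
      fix t assume "t \<in> {..<d}"
      then have t: "t < d" by simp
      interpret prob_space "M t" by (rule gauss_coupling_prob[OF Mt[OF t]])
      show "emeasure (M t) {p \<in> space (M t). fst p s \<noteq> snd p s} \<le> ennreal ((if s \<in> {t, sink d t} then 1 else 0) + q)"
      proof (cases "s \<in> {t, sink d t}")
        case True
        have "emeasure (M t) {p \<in> space (M t). fst p s \<noteq> snd p s} \<le> ennreal 1" by (simp add: emeasure_le_1)
        also have "\<dots> \<le> ennreal (1 + q)" using q by (intro ennreal_leI) simp
        finally show ?thesis using True by simp
      next
        case False
        then show ?thesis using M t s by auto
      qed
    qed
    also have "\<dots> = ennreal ((\<Sum>t<d. (if s \<in> {t, sink d t} then 1 else 0) + q) / real d)"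
      using q d by (simp add: sum_ennreal sum_nonneg divide_ennreal[symmetric] ennreal_of_nat_eq_real_of_nat
        del: ennreal_plus)
    also have "\<dots> \<le> ennreal (2 / real d + q)"
    proof (rule ennreal_leI)
      have "(\<Sum>t<d. (if s \<in> {t, sink d t} then 1 else 0) + q) = real (card {t. t < d \<and> s \<in> {t, sink d t}}) + real d * q"
        by (simp only: sum.distrib sum_constant card_lessThan of_nat_id)
          (simp add: sum.If_cases Int_def)
      also have "\<dots> \<le> 2 + real d * q" using sink_count[OF s] by simp
      finally show "(\<Sum>t<d. (if s \<in> {t, sink d t} then 1 else 0) + q) / real d \<le> 2 / real d + q"
        using d by (simp add: field_simps)
    qed
    finally show ?thesis .
  qed
  with N(1,2) show ?thesis unfolding q_def by blast
qed

lemma gauss_coupling_refl: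
  assumes "lin d w w = 1"
  shows "gauss_coupling d (distr (gauss_vec d) (vec_space d \<Otimes>\<^sub>M vec_space d) (\<lambda>x. (x, refl_along d w x)))"
proof -
  have [measurable]: "(\<lambda>x. (x, refl_along d w x)) \<in> measurable (gauss_vec d) (vec_space d \<Otimes>\<^sub>M vec_space d)"
    by measurable
  show ?thesis
    by (rule gauss_couplingI) (auto simp: nn_integral_distr nn_integral_gauss_refl[OF assms])
qed

text \<open>The distance is twice the error that the theorem asks for, since an estimate can be
  close to only one of the two. The lower bound on \<open>\<eta>\<close> gives 2 / d \<le> \<eta> (1
  - c / 3), and rejections add 6 sqrt 2 \<eta> c / 100 \<le> 9 \<eta> c / 100, less than \<eta> c /
  6; a fraction c / 6 of the budget stays free.\<close>

lemma indistinguishable_regressors: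
  fixes c \<eta> b :: real
  assumes d: "d \<ge> 1" and c: "0 < c" "c < 1" and \<eta>: "(2 + c) / real d \<le> \<eta>" "\<eta> \<le> 4 / sqrt (real d)"
    and b: "b \<ge> 0"
  obtains \<beta> \<beta>' M where "vnorm d \<beta> = b" "vnorm d \<beta>' = b"
    "vnorm d (\<lambda>j. \<beta> j - \<beta>' j) \<ge> 2 * (\<eta> * (c * sqrt (real d) / 100) * b)"
    "gauss_coupling d M" "AE p in M. lin d \<beta> (fst p) = lin d \<beta>' (snd p)"
    "\<forall>j<d. emeasure M {p \<in> space M. fst p j \<noteq> snd p j} \<le> ennreal (\<eta> * (1 - c / 6))"
proof -
  have sd: "sqrt (real d) > 0" using d by simp
  have \<eta>0: "\<eta> > 0"
  proof -
    have "(2 + c) / real d > 0" using d c by simp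
    then show ?thesis using \<eta> by linarith
  qed
  have \<eta>d: "\<eta> * sqrt (real d) \<le> 4" using \<eta>(2) sd by (simp add: field_simps)
  show ?thesis
  proof (cases "d \<ge> 3")
    case True
    \<comment> \<open>The chord length between the two unit directions. The upper bound on
      \<open>\<eta>\<close> makes it at most 8 / 100, well below the 1 / 2 that the coupling asks
      for.\<close>
    define \<delta> where "\<delta> = 2 * (\<eta> * sqrt (real d)) * c / 100"
    have \<delta>: "\<delta> > 0" "\<delta> \<le> 1 / 2"
    proof -
      show "\<delta> > 0" using \<eta>0 sd c by (simp add: \<delta>_def)
      have "(\<eta> * sqrt (real d)) * c \<le> 4 * 1" using \<eta>d \<eta>0 c by (intro mult_mono) auto
      then show "\<delta> \<le> 1 / 2" by (simp add: \<delta>_def mult_ac)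
    qed
    define co where "co = 1 - \<delta>\<^sup>2 / 2"
    have \<delta>2: "\<delta>\<^sup>2 \<le> 1" using \<delta> by (simp add: power_le_one)
    define si where "si = sqrt (1 - co\<^sup>2)"
    have "co\<^sup>2 \<le> 1" using \<delta>2 by (intro power_le_one) (auto simp: co_def)
    then have cs: "co\<^sup>2 + si\<^sup>2 = 1" by (simp add: si_def)
    have \<delta>co: "\<delta>\<^sup>2 = 2 - 2 * co" by (simp add: co_def)
    obtain M where M: "gauss_coupling d M"
      "AE p in M. lin d (ecos d) (snd p) = co * lin d (ecos d) (fst p) - si * lin d (esin d) (fst p) \<and>
         lin d (esin d) (snd p) = si * lin d (ecos d) (fst p) + co * lin d (esin d) (fst p)"
      "\<And>s. s < d \<Longrightarrow> emeasure M {p \<in> space M. fst p s \<noteq> snd p s} \<le> ennreal (2 / real d + 3 * \<delta> * sqrt (2 / real d))"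
      using coupling_random_sinks[OF True cs \<delta> \<delta>co] by blast
    note on = ecos_esin_orthonormal[OF True]
    have on': "lin d (esin d) (ecos d) = 0" using on(3) by (simp add: lin_commute)
    \<comment> \<open>Both regressors are written as combinations of the same orthonormal pair, so
      \<open>n\<close> computes every norm that occurs.\<close>
    define \<beta> where "\<beta> = (\<lambda>j. b * ecos d j + 0 * esin d j)"
    define \<beta>' where "\<beta>' = (\<lambda>j. (b * co) * ecos d j + (b * si) * esin d j)"
    have n: "vnorm d (\<lambda>j. x * ecos d j + y * esin d j) = sqrt (x\<^sup>2 + y\<^sup>2)" for x y
      unfolding vnorm_sq lin_add_left lin_add_right by (simp add: on on' power2_eq_square)
    show ?thesis
    proof (rule that[of \<beta> \<beta>' M])
      show "vnorm d \<beta> = b" unfolding \<beta>_def n using b by simp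
      have "(b * co)\<^sup>2 + (b * si)\<^sup>2 = b\<^sup>2 * (co\<^sup>2 + si\<^sup>2)"
        by (simp add: power_mult_distrib algebra_simps)
      then show "vnorm d \<beta>' = b" unfolding \<beta>'_def n using b cs by simp
      have "(\<lambda>j. \<beta> j - \<beta>' j) = (\<lambda>j. (b - b * co) * ecos d j + (- b * si) * esin d j)"
        by (simp add: \<beta>_def \<beta>'_def fun_eq_iff algebra_simps)
      moreover have "(b - b * co)\<^sup>2 + (- b * si)\<^sup>2 = (b * \<delta>)\<^sup>2"
      proof -
        have "(b - b * co)\<^sup>2 + (- b * si)\<^sup>2 = b\<^sup>2 * (1 - 2 * co + (co\<^sup>2 + si\<^sup>2))"
          by (simp add: power2_eq_square algebra_simps)
        also have "\<dots> = b\<^sup>2 * \<delta>\<^sup>2" by (simp add: cs \<delta>co)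
        finally show ?thesis by (simp add: power_mult_distrib)
      qed
      ultimately have "vnorm d (\<lambda>j. \<beta> j - \<beta>' j) = b * \<delta>"
        using b \<delta> by (simp only: n real_sqrt_abs) simp
      then show "vnorm d (\<lambda>j. \<beta> j - \<beta>' j) \<ge> 2 * (\<eta> * (c * sqrt (real d) / 100) * b)"
        by (simp add: \<delta>_def algebra_simps)
      show "gauss_coupling d M" by (rule M(1))
      show "AE p in M. lin d \<beta> (fst p) = lin d \<beta>' (snd p)"
        using M(2)
      proof eventually_elim
        case (elim p)
        define A B where "A = lin d (ecos d) (fst p)" and "B = lin d (esin d) (fst p)"
        have "lin d \<beta>' (snd p) = b * co * (co * A - si * B) + b * si * (si * A + co * B)"
          unfolding \<beta>'_def lin_add_left using elim by (simp add: A_def B_def)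
        also have "\<dots> = b * ((co\<^sup>2 + si\<^sup>2) * A)" by (simp add: power2_eq_square algebra_simps)
        also have "\<dots> = lin d \<beta> (fst p)" unfolding \<beta>_def lin_add_left by (simp add: cs A_def)
        finally show ?case by simp
      qed
      show "\<forall>j<d. emeasure M {p \<in> space M. fst p j \<noteq> snd p j} \<le> ennreal (\<eta> * (1 - c / 6))"
      proof (intro allI impI)
        fix j assume j: "j < d"
        have "3 * \<delta> * sqrt (2 / real d) = (6 * sqrt 2) * (\<eta> * c / 100)"
          using sd by (simp add: \<delta>_def real_sqrt_divide field_simps)
        also have "\<dots> \<le> 9 * (\<eta> * c / 100)"
        proof (rule mult_right_mono)
          have "sqrt 2 \<le> 3 / 2" by (rule real_le_lsqrt) (auto simp: power2_eq_square)
          then show "6 * sqrt 2 \<le> 9" by simp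
        qed (use \<eta>0 c in simp)
        finally have 1: "3 * \<delta> * sqrt (2 / real d) \<le> 9 * (\<eta> * c / 100)" .
        have "2 / real d = (2 + c) / real d * (2 / (2 + c))"
          using c d by (simp add: divide_simps)
        also have "\<dots> \<le> \<eta> * (2 / (2 + c))" using \<eta>(1) c by (intro mult_right_mono) auto
        also have "2 / (2 + c) \<le> 1 - c / 3"
          using c by (simp add: field_simps)
        then have "\<eta> * (2 / (2 + c)) \<le> \<eta> * (1 - c / 3)" using \<eta>0 by (intro mult_left_mono) auto
        finally have "2 / real d \<le> \<eta> - \<eta> * c / 3" by (simp add: algebra_simps)
        moreover have "\<eta> * c \<ge> 0" using \<eta>0 c by simp
        ultimately have "2 / real d + 3 * \<delta> * sqrt (2 / real d) \<le> \<eta> * (1 - c / 6)"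
          using 1 by (simp add: algebra_simps)
        then show "emeasure M {p \<in> space M. fst p j \<noteq> snd p j} \<le> ennreal (\<eta> * (1 - c / 6))"
          by (rule order_trans[OF M(3)[OF j] ennreal_leI])
      qed
    qed
  next
    case False
    \<comment> \<open>With fewer than three coordinates, opposite regressors and a change of sign of
      the first coordinate suffice: the allowed probability is at least 1, and the distance
      \<open>2 * b\<close> is enough because \<open>\<eta> * sqrt (real d) \<le> 4\<close>.\<close>
    define w :: "nat \<Rightarrow> real" where "w j = (if j = 0 then 1 else 0)" for j
    have lw: "lin d w z = z 0" for z
    proof -
      have "lin d w z = (\<Sum>j<d. if j = 0 then z j else 0)" unfolding lin_def w_def by (intro sum.cong) auto
      then show ?thesis using d by simp
    qed
    have w: "lin d w w = 1" by (simp add: lw w_def)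
    define M where "M = distr (gauss_vec d) (vec_space d \<Otimes>\<^sub>M vec_space d) (\<lambda>x. (x, refl_along d w x))"
    have M: "gauss_coupling d M" unfolding M_def by (rule gauss_coupling_refl[OF w])
    define \<beta> where "\<beta> = (\<lambda>j. b * w j + 0 * w j)"
    define \<beta>' where "\<beta>' = (\<lambda>j. (- b) * w j + 0 * w j)"
    have n: "vnorm d (\<lambda>j. x * w j + y * w j) = \<bar>x + y\<bar>" for x y
      unfolding vnorm_sq lin_add_left lin_add_right
      by (simp add: w distrib_right[symmetric] distrib_left[symmetric] flip: power2_eq_square)
    show ?thesis
    proof (rule that[of \<beta> \<beta>' M])
      show "vnorm d \<beta> = b" "vnorm d \<beta>' = b" unfolding \<beta>_def \<beta>'_def n using b by auto
      have "(\<lambda>j. \<beta> j - \<beta>' j) = (\<lambda>j. (2 * b) * w j + 0 * w j)"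
        by (simp add: \<beta>_def \<beta>'_def fun_eq_iff)
      then have "vnorm d (\<lambda>j. \<beta> j - \<beta>' j) = 2 * b" using b by (simp only: n)
      moreover have le: "\<eta> * (c * sqrt (real d) / 100) * b \<le> 1 * b"
      proof (rule mult_right_mono)
        have "(\<eta> * sqrt (real d)) * c \<le> 4 * 1" using \<eta>d \<eta>0 c by (intro mult_mono) auto
        then show "\<eta> * (c * sqrt (real d) / 100) \<le> 1" by (simp add: algebra_simps)
      qed (rule b)
      ultimately show "vnorm d (\<lambda>j. \<beta> j - \<beta>' j) \<ge> 2 * (\<eta> * (c * sqrt (real d) / 100) * b)"
        using mult_left_mono[OF le, of 2] by (simp only: mult_1 mult_1_right)
      show "gauss_coupling d M" by (rule M)
      have "lin d \<beta> x = lin d \<beta>' (refl_along d w x)" for x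
        unfolding \<beta>_def \<beta>'_def lin_add_left lin_refl_along by (simp add: w)
      then show "AE p in M. lin d \<beta> (fst p) = lin d \<beta>' (snd p)"
        unfolding M_def by (subst AE_distr_iff) auto
      show "\<forall>j<d. emeasure M {p \<in> space M. fst p j \<noteq> snd p j} \<le> ennreal (\<eta> * (1 - c / 6))"
      proof (intro allI impI)
        fix j assume "j < d"
        interpret prob_space M by (rule gauss_coupling_prob[OF M])
        have "1 \<le> \<eta> * (1 - c / 6)"
        proof -
          have "(2 + c) / 2 \<le> (2 + c) / real d" using False d c by (intro divide_left_mono) auto
          then have "(2 + c) / 2 \<le> \<eta>" using \<eta>(1) by linarith
          then have "(2 + c) / 2 * (1 - c / 6) \<le> \<eta> * (1 - c / 6)" using c by (intro mult_right_mono) auto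
          moreover have "c * c \<le> 1 * c" using c by (intro mult_right_mono) auto
          then have "1 \<le> (2 + c) / 2 * (1 - c / 6)" using c by (simp add: field_simps)
          ultimately show ?thesis by linarith
        qed
        then have "ennreal 1 \<le> ennreal (\<eta> * (1 - c / 6))" by (rule ennreal_leI)
        then show "emeasure M {p \<in> space M. fst p j \<noteq> snd p j} \<le> ennreal (\<eta> * (1 - c / 6))"
          by (intro order_trans[OF emeasure_le_1]) simp
      qed
    qed
  qed
qed

section \<open>Adversaries that erase a pattern of entries\<close>


text \<open>The conditional probability of pattern \<open>k\<close> given the samples is the
  Radon-Nikodym derivative of the law of \<open>S\<close> on the event \<open>P \<omega> = k\<close>
  with respect to the law of \<open>S\<close>. As there are finitely many patterns, finitely many
  derivatives make up the conditional law.\<close>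

lemma finite_conditional_kernel:
  fixes M :: "'s measure" and P :: "'w \<Rightarrow> 'k"
  assumes "prob_space \<Omega>" and S [measurable]: "S \<in> measurable \<Omega> M"
    and K: "finite K" "k0 \<in> K" and P: "\<And>\<omega>. \<omega> \<in> space \<Omega> \<Longrightarrow> P \<omega> \<in> K"
    and Pm: "\<And>k. k \<in> K \<Longrightarrow> {\<omega> \<in> space \<Omega>. P \<omega> = k} \<in> sets \<Omega>"
  shows "\<exists>\<kappa> :: 'k \<Rightarrow> 's \<Rightarrow> ennreal. (\<forall>k\<in>K. \<kappa> k \<in> borel_measurable M) \<and>
    (\<forall>s. (\<Sum>k\<in>K. \<kappa> k s) = 1) \<and>
    (\<forall>k\<in>K. \<forall>G\<in>borel_measurable M. (\<integral>\<^sup>+s. \<kappa> k s * G s \<partial>distr \<Omega> M S)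
      = (\<integral>\<^sup>+\<omega>. indicator {\<omega> \<in> space \<Omega>. P \<omega> = k} \<omega> * G (S \<omega>) \<partial>\<Omega>))"
proof -
  interpret \<Omega>: prob_space \<Omega> by fact
  define N where "N = distr \<Omega> M S"
  interpret N: prob_space N unfolding N_def by (rule \<Omega>.prob_space_distr[OF S])
  have sN [simp, measurable_cong]: "sets N = sets M" by (simp add: N_def)
  define E where "E k = {\<omega> \<in> space \<Omega>. P \<omega> = k}" for k
  have E [measurable]: "E k \<in> sets \<Omega>" if "k \<in> K" for k using Pm[OF that] by (simp add: E_def)
  define \<nu> where "\<nu> k = distr (density \<Omega> (indicator (E k))) M S" for k
  have \<nu>: "emeasure (\<nu> k) A = (\<integral>\<^sup>+\<omega>. indicator (E k) \<omega> * indicator A (S \<omega>) \<partial>\<Omega>)"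
    if k: "k \<in> K" and A [measurable]: "A \<in> sets M" for k A
  proof -
    note [measurable] = E[OF k]
    have "emeasure (\<nu> k) A = (\<integral>\<^sup>+x. indicator A x \<partial>\<nu> k)" using A by (simp add: \<nu>_def)
    also have "\<dots> = (\<integral>\<^sup>+\<omega>. indicator (E k) \<omega> * indicator A (S \<omega>) \<partial>\<Omega>)"
      unfolding \<nu>_def by (subst nn_integral_distr, measurable, subst nn_integral_density) auto
    finally show ?thesis .
  qed
  have "\<exists>f\<in>borel_measurable N. density N f = \<nu> k" if k: "k \<in> K" for k
  proof (rule N.Radon_Nikodym)
    show "sets (\<nu> k) = sets N" by (simp add: \<nu>_def)
    show "absolutely_continuous N (\<nu> k)"
      unfolding absolutely_continuous_def
    proof
      fix A assume "A \<in> null_sets N"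
      then have A [measurable]: "A \<in> sets M" and 0: "emeasure N A = 0" by auto
      have "emeasure (\<nu> k) A \<le> (\<integral>\<^sup>+\<omega>. indicator A (S \<omega>) \<partial>\<Omega>)"
        unfolding \<nu>[OF k A] by (intro nn_integral_mono) (auto simp: indicator_def)
      also have "\<dots> = (\<integral>\<^sup>+x. indicator A x \<partial>N)"
        unfolding N_def by (subst nn_integral_distr) auto
      also have "\<dots> = 0" using 0 A by simp
      finally show "A \<in> null_sets (\<nu> k)" by (simp add: null_sets_def \<nu>_def)
    qed
  qed
  then have "\<forall>k\<in>K. \<exists>f. f \<in> borel_measurable N \<and> density N f = \<nu> k" by blast
  from bchoice[OF this] obtain f where f: "\<forall>k\<in>K. f k \<in> borel_measurable N \<and> density N (f k) = \<nu> k" ..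
  have fm [measurable]: "f k \<in> borel_measurable M" if "k \<in> K" for k
    using f that by (simp cong: measurable_cong_sets)
  have fm' [measurable]: "(\<lambda>s. \<Sum>k\<in>K. f k s) \<in> borel_measurable M"
    by (rule borel_measurable_sum) (rule fm)
  have fint: "(\<integral>\<^sup>+s. f k s * G s \<partial>N) = (\<integral>\<^sup>+\<omega>. indicator (E k) \<omega> * G (S \<omega>) \<partial>\<Omega>)"
    if k: "k \<in> K" and G [measurable]: "G \<in> borel_measurable M" for k G
  proof -
    note [measurable] = fm[OF k] E[OF k]
    have "(\<integral>\<^sup>+s. f k s * G s \<partial>N) = (\<integral>\<^sup>+s. G s \<partial>density N (f k))"
      by (subst nn_integral_density) auto
    also have "density N (f k) = \<nu> k" using f k by simp
    also have "(\<integral>\<^sup>+s. G s \<partial>\<nu> k) = (\<integral>\<^sup>+\<omega>. indicator (E k) \<omega> * G (S \<omega>) \<partial>\<Omega>)"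
      unfolding \<nu>_def by (subst nn_integral_distr, measurable, subst nn_integral_density) auto
    finally show ?thesis .
  qed
  have one: "(\<Sum>k\<in>K. indicator (E k) \<omega> :: ennreal) = 1" if "\<omega> \<in> space \<Omega>" for \<omega>
  proof -
    have "(\<Sum>k\<in>K. indicator (E k) \<omega> :: ennreal) = (\<Sum>k\<in>K. if k = P \<omega> then 1 else 0)"
      using that by (intro sum.cong) (auto simp: E_def indicator_def)
    then show ?thesis using K P[OF that] by simp
  qed
  have "AE s in N. (\<Sum>k\<in>K. f k s) = 1"
  proof (rule N.density_unique)
    show "(\<lambda>s. \<Sum>k\<in>K. f k s) \<in> borel_measurable N" by measurable
    show "density N (\<lambda>s. \<Sum>k\<in>K. f k s) = density N (\<lambda>s. 1)"
    proof (rule measure_eqI)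
      fix A assume "A \<in> sets (density N (\<lambda>s. \<Sum>k\<in>K. f k s))"
      then have A [measurable]: "A \<in> sets M" by simp
      have "emeasure (density N (\<lambda>s. \<Sum>k\<in>K. f k s)) A = (\<integral>\<^sup>+s. (\<Sum>k\<in>K. f k s * indicator A s) \<partial>N)"
        by (subst emeasure_density) (auto simp: sum_distrib_right)
      also have "\<dots> = (\<Sum>k\<in>K. \<integral>\<^sup>+s. f k s * indicator A s \<partial>N)"
        by (rule nn_integral_sum) (use fm in measurable)
      also have "\<dots> = (\<Sum>k\<in>K. \<integral>\<^sup>+\<omega>. indicator (E k) \<omega> * indicator A (S \<omega>) \<partial>\<Omega>)"
        by (intro sum.cong refl fint) auto
      also have "\<dots> = (\<integral>\<^sup>+\<omega>. (\<Sum>k\<in>K. indicator (E k) \<omega> * indicator A (S \<omega>)) \<partial>\<Omega>)"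
        by (rule nn_integral_sum[symmetric]) (use E in measurable)
      also have "\<dots> = (\<integral>\<^sup>+\<omega>. indicator A (S \<omega>) \<partial>\<Omega>)"
        by (intro nn_integral_cong) (simp add: sum_distrib_right[symmetric] one)
      also have "\<dots> = (\<integral>\<^sup>+x. indicator A x \<partial>N)"
        unfolding N_def by (subst nn_integral_distr) auto
      finally show "emeasure (density N (\<lambda>s. \<Sum>k\<in>K. f k s)) A = emeasure (density N (\<lambda>s. 1)) A"
        by (simp add: density_1)
    qed simp
  qed simp
  \<comment> \<open>The derivatives sum to 1 only almost everywhere, while an adversary must respond
    to every sample. On the exceptional set all weight goes to \<open>k0\<close>; this changes no
    integral.\<close>
  define \<kappa> where "\<kappa> k s = (if (\<Sum>k\<in>K. f k s) = 1 then f k s else if k = k0 then 1 else 0)" for k s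
  show ?thesis
  proof (rule exI[of _ \<kappa>], intro conjI ballI allI)
    fix k assume k: "k \<in> K"
    note [measurable] = fm[OF k]
    show \<kappa>m [measurable]: "\<kappa> k \<in> borel_measurable M" unfolding \<kappa>_def by measurable
    fix G :: "'s \<Rightarrow> ennreal" assume G: "G \<in> borel_measurable M"
    have "(\<integral>\<^sup>+s. \<kappa> k s * G s \<partial>N) = (\<integral>\<^sup>+s. f k s * G s \<partial>N)"
      by (intro nn_integral_cong_AE) (use \<open>AE s in N. (\<Sum>k\<in>K. f k s) = 1\<close> in \<open>eventually_elim, simp add: \<kappa>_def\<close>)
    then show "(\<integral>\<^sup>+s. \<kappa> k s * G s \<partial>distr \<Omega> M S)
        = (\<integral>\<^sup>+\<omega>. indicator {\<omega> \<in> space \<Omega>. P \<omega> = k} \<omega> * G (S \<omega>) \<partial>\<Omega>)"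
      using fint[OF k G] by (simp add: N_def E_def)
  next
    fix s
    show "(\<Sum>k\<in>K. \<kappa> k s) = 1"
      using K by (cases "(\<Sum>k\<in>K. f k s) = 1") (simp_all add: \<kappa>_def)
  qed
qed

section \<open>Erasure patterns and the data they produce\<close>

definition erase ::
  "nat \<Rightarrow> nat \<Rightarrow> (nat \<times> nat) set \<Rightarrow> (nat \<Rightarrow> (nat \<Rightarrow> real) \<times> real) \<Rightarrow>
   nat \<Rightarrow> (nat \<Rightarrow> real option) \<times> real option" where
  "erase d n p s = (\<lambda>i\<in>{..<n}.
     (\<lambda>j\<in>{..<d}. if (i, j) \<in> p then None else Some (fst (s i) j), Some (snd (s i))))"

text \<open>Confining a pattern to the grid leaves finitely many, so that its conditional law is a
  finite family of weights.\<close>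

definition patterns :: "nat \<Rightarrow> nat \<Rightarrow> real \<Rightarrow> (nat \<times> nat) set set" where
  "patterns d n \<eta> = {p. p \<subseteq> {..<n} \<times> {..<d} \<and>
     (\<forall>j<d. real (card {i. i < n \<and> (i, j) \<in> p}) \<le> \<eta> * real n)}"

lemma finite_patterns: "finite (patterns d n \<eta>)"
  by (rule finite_subset[of _ "Pow ({..<n} \<times> {..<d})"]) (auto simp: patterns_def)

lemma empty_in_patterns: "\<eta> \<ge> 0 \<Longrightarrow> {} \<in> patterns d n \<eta>"
  by (simp add: patterns_def)

lemma space_opt_borel [simp]: "space opt_borel = UNIV"
  by (simp add: opt_borel_def)

lemma measurable_Some_opt_borel [measurable]: "Some \<in> measurable borel opt_borel"
  unfolding opt_borel_def
proof (rule measurable_measure_of)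
  fix A :: "real option set"
  assume "A \<in> {Some ` B |B. B \<in> sets borel} \<union> {{None}}"
  then consider B where "A = Some ` B" "B \<in> sets borel" | "A = {None}" by blast
  then show "Some -` A \<inter> space borel \<in> sets borel"
  proof cases
    case 1
    then have "Some -` A = B" by (simp only: inj_vimage_image_eq[OF inj_Some])
    then show ?thesis using 1 by simp
  next
    case 2
    then have "Some -` A = {}" by blast
    then show ?thesis by simp
  qed
qed simp_all

lemma erase_in_space: "erase d n p s \<in> space (data_space d n)"
  by (auto simp: erase_def data_space_def space_PiM space_pair_measure)

text \<open>The erased versions of one sample form a finite set. Measurable singletons make this set
  measurable, so that almost sure statements about corruptions can be checked on it point by
  point.\<close>

lemma singleton_in_data_space:
  assumes "D \<in> space (data_space d n)"
  shows "{D} \<in> sets (data_space d n)"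
proof -
  have o: "{x} \<in> sets opt_borel" for x
  proof (cases x)
    case None
    then show ?thesis by (auto simp: opt_borel_def intro: sigma_sets.Basic)
  next
    case (Some y)
    then have "{x} = Some ` {y}" by simp
    then show ?thesis by (auto simp: opt_borel_def intro!: sigma_sets.Basic)
  qed
  let ?R = "PiM {..<d} (\<lambda>_. opt_borel) \<Otimes>\<^sub>M opt_borel"
  have r: "{x} \<in> sets ?R" if x: "x \<in> space ?R" for x
  proof -
    have "fst x \<in> {..<d} \<rightarrow>\<^sub>E UNIV" using x by (auto simp: space_pair_measure space_PiM)
    then have "{fst x} = Pi\<^sub>E {..<d} (\<lambda>j. {fst x j})"
      by (subst PiE_singleton) (auto simp: PiE_def)
    then have "{fst x} \<in> sets (PiM {..<d} (\<lambda>_. opt_borel))"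
      using o by (simp only:) (rule sets_PiM_I_finite, auto)
    then have "{fst x} \<times> {snd x} \<in> sets ?R" using o by (rule pair_measureI)
    then show ?thesis by simp
  qed
  have "D \<in> {..<n} \<rightarrow>\<^sub>E space ?R" using assms by (simp add: data_space_def space_PiM)
  then have D: "{D} = Pi\<^sub>E {..<n} (\<lambda>i. {D i})" and Di: "\<And>i. i < n \<Longrightarrow> D i \<in> space ?R"
    by (subst PiE_singleton, auto simp: PiE_def)
  show ?thesis
    unfolding data_space_def by (subst D) (intro sets_PiM_I_finite r Di, auto)
qed

lemma measurable_erase:
  "erase d n p \<in> measurable (PiM {..<n} (\<lambda>_. vec_space d \<Otimes>\<^sub>M borel)) (data_space d n)"
  unfolding data_space_def
proof (rule measurable_PiM_single')
  let ?M = "PiM {..<n} (\<lambda>_::nat. vec_space d \<Otimes>\<^sub>M (borel :: real measure))"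
  show "erase d n p \<in> space ?M \<rightarrow> {..<n} \<rightarrow>\<^sub>E space (PiM {..<d} (\<lambda>_. opt_borel) \<Otimes>\<^sub>M opt_borel)"
    by (auto simp: erase_def space_PiM space_pair_measure)
  fix i assume i: "i \<in> {..<n}"
  have [measurable]: "(\<lambda>s. s i) \<in> measurable ?M (vec_space d \<Otimes>\<^sub>M borel)"
    using i by (rule measurable_component_singleton)
  have "(\<lambda>s. \<lambda>j\<in>{..<d}. if (i, j) \<in> p then None else Some (fst (s i) j)) \<in> measurable ?M (PiM {..<d} (\<lambda>_. opt_borel))"
  proof (rule measurable_restrict)
    fix j assume "j \<in> {..<d}"
    then have j: "j < d" by simp
    have "(\<lambda>s. fst (s i)) \<in> measurable ?M (vec_space d)" by measurable
    from measurable_compose[OF measurable_compose[OF this measurable_component_vec[OF j]] measurable_Some_opt_borel]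
    show "(\<lambda>s. if (i, j) \<in> p then None else Some (fst (s i) j)) \<in> measurable ?M opt_borel"
      by (cases "(i, j) \<in> p") simp_all
  qed
  moreover have "(\<lambda>s. snd (s i)) \<in> borel_measurable ?M" by measurable
  note measurable_compose[OF this measurable_Some_opt_borel]
  ultimately show "(\<lambda>s. erase d n p s i) \<in> measurable ?M (PiM {..<d} (\<lambda>_. opt_borel) \<Otimes>\<^sub>M opt_borel)"
    using i by (simp add: erase_def)
qed

lemma is_corruption_erase:
  assumes p: "p \<in> patterns d n \<eta>" and \<eta>: "\<eta> \<ge> 0"
  shows "is_corruption d n \<eta> s (erase d n p s)"
proof -
  have "{i. i < n \<and> fst (erase d n p s i) j = None} = {i. i < n \<and> (i, j) \<in> p}" if "j < d" for j
    using that by (auto simp: erase_def)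
  moreover have "{i. i < n \<and> snd (erase d n p s i) = None} = {}"
    by (auto simp: erase_def)
  ultimately show ?thesis
    using p \<eta> erase_in_space[of d n p s] by (auto simp: is_corruption_def erase_def patterns_def)
qed

lemma sets_sample_space: "sets (sample_space d n \<beta> \<sigma>) = sets (PiM {..<n} (\<lambda>_. vec_space d \<Otimes>\<^sub>M borel))"
  unfolding sample_space_def lr_example_def by (intro sets_PiM_cong) auto

text \<open>Given a joint law of the samples and of a pattern, the adversary draws the pattern from its
  conditional law given the samples.\<close>

lemma pattern_adversary:
  fixes \<Omega> :: "'w measure"
  assumes \<Omega>: "prob_space \<Omega>" and \<eta>: "\<eta> \<ge> 0"
    and S: "S \<in> measurable \<Omega> (PiM {..<n} (\<lambda>_. vec_space d \<Otimes>\<^sub>M borel))"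
    and law: "distr \<Omega> (PiM {..<n} (\<lambda>_. vec_space d \<Otimes>\<^sub>M borel)) S = sample_space d n \<beta> \<sigma>"
    and P: "\<And>\<omega>. \<omega> \<in> space \<Omega> \<Longrightarrow> P \<omega> \<in> patterns d n \<eta>"
    and Pm: "\<And>k. k \<in> patterns d n \<eta> \<Longrightarrow> {\<omega> \<in> space \<Omega>. P \<omega> = k} \<in> sets \<Omega>"
    and alg: "randomized_alg d n A"
  obtains Adv where "cw_adversary d n \<eta> \<beta> \<sigma> Adv"
    "\<And>E. E \<in> sets (vec_space d) \<Longrightarrow>
      emeasure (output_law d n \<beta> \<sigma> Adv A) E = (\<integral>\<^sup>+\<omega>. emeasure (A (erase d n (P \<omega>) (S \<omega>))) E \<partial>\<Omega>)"
proof -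
  let ?M = "PiM {..<n} (\<lambda>_::nat. vec_space d \<Otimes>\<^sub>M (borel :: real measure))"
  let ?K = "patterns d n \<eta>"
  interpret \<Omega>: prob_space \<Omega> by fact
  note K = finite_patterns[of d n \<eta>]
  obtain \<kappa> :: "(nat \<times> nat) set \<Rightarrow> _ \<Rightarrow> ennreal" where kern:
    "(\<forall>k\<in>?K. \<kappa> k \<in> borel_measurable ?M) \<and> (\<forall>s. (\<Sum>k\<in>?K. \<kappa> k s) = 1) \<and>
     (\<forall>k\<in>?K. \<forall>G\<in>borel_measurable ?M. (\<integral>\<^sup>+s. \<kappa> k s * G s \<partial>distr \<Omega> ?M S)
      = (\<integral>\<^sup>+\<omega>. indicator {\<omega> \<in> space \<Omega>. P \<omega> = k} \<omega> * G (S \<omega>) \<partial>\<Omega>))"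
    using finite_conditional_kernel[OF \<Omega> S K empty_in_patterns[OF \<eta>] P Pm] ..
  have \<kappa>: "\<And>k. k \<in> ?K \<Longrightarrow> \<kappa> k \<in> borel_measurable ?M"
    "\<And>s. (\<Sum>k\<in>?K. \<kappa> k s) = 1"
    "\<And>k G. k \<in> ?K \<Longrightarrow> G \<in> borel_measurable ?M \<Longrightarrow>
      (\<integral>\<^sup>+s. \<kappa> k s * G s \<partial>distr \<Omega> ?M S)
      = (\<integral>\<^sup>+\<omega>. indicator {\<omega> \<in> space \<Omega>. P \<omega> = k} \<omega> * G (S \<omega>) \<partial>\<Omega>)"
    using kern[THEN conjunct1] kern[THEN conjunct2, THEN conjunct1] kern[THEN conjunct2, THEN conjunct2]
    by - (erule bspec, assumption, erule spec, drule bspec, assumption, erule bspec, assumption)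
  let ?Smp = "sample_space d n \<beta> \<sigma>"
  have sS [measurable_cong]: "sets ?Smp = sets ?M" by (rule sets_sample_space)
  have spS: "space ?Smp = space ?M" using sets_eq_imp_space_eq[OF sS] .
  define Adv where "Adv s = distr (point_measure ?K (\<lambda>k. \<kappa> k s)) (data_space d n) (\<lambda>k. erase d n k s)" for s
  have pm: "(\<lambda>k. erase d n k s) \<in> measurable (point_measure ?K (\<lambda>k. \<kappa> k s)) (data_space d n)" for s
    by (auto simp: measurable_def sets_point_measure space_point_measure erase_in_space)
  have int: "(\<integral>\<^sup>+D. g D \<partial>Adv s) = (\<Sum>k\<in>?K. \<kappa> k s * g (erase d n k s))"
    if "g \<in> borel_measurable (data_space d n)" for g s
    unfolding Adv_def using that pm K by (simp add: nn_integral_distr nn_integral_point_measure_finite)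
  have em: "emeasure (Adv s) X = (\<Sum>k\<in>?K. \<kappa> k s * indicator X (erase d n k s))"
    if "X \<in> sets (data_space d n)" for X s
    using int[of "indicator X" s] that by (simp add: Adv_def)
  have Advp: "prob_space (Adv s)" for s
  proof
    have "emeasure (Adv s) (space (data_space d n)) = (\<Sum>k\<in>?K. \<kappa> k s)"
      by (simp add: em erase_in_space)
    then show "emeasure (Adv s) (space (Adv s)) = 1"
      using \<kappa>(2)[of s] by (simp add: Adv_def)
  qed
  have mm: "erase d n k \<in> measurable ?Smp (data_space d n)" for k
    using measurable_erase[of d n k] sS by (simp cong: measurable_cong_sets)
  have \<kappa>m: "\<kappa> k \<in> borel_measurable ?Smp" if "k \<in> ?K" for k
    using \<kappa>(1)[OF that] sS by (simp cong: measurable_cong_sets)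
  have Advm: "Adv \<in> measurable ?Smp (subprob_algebra (data_space d n))"
  proof (rule measurable_subprob_algebra)
    fix s assume "s \<in> space ?Smp"
    then show "subprob_space (Adv s)"
      using Advp[of s] spS by (simp add: prob_space_imp_subprob_space)
    show "sets (Adv s) = sets (data_space d n)" by (simp add: Adv_def)
  next
    fix X assume X: "X \<in> sets (data_space d n)"
    show "(\<lambda>s. emeasure (Adv s) X) \<in> borel_measurable ?Smp"
      unfolding em[OF X]
      by (intro borel_measurable_sum borel_measurable_times_ennreal \<kappa>m
          measurable_compose[OF mm borel_measurable_indicator[OF X]])
  qed
  have Am: "A \<in> measurable (data_space d n) (subprob_algebra (vec_space d))"
    using alg by (simp add: randomized_alg_def)
  have neM: "space ?Smp \<noteq> {}"
  proof -
    obtain \<omega> where "\<omega> \<in> space \<Omega>" using \<Omega>.not_empty by (meson ex_in_conv)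
    then have "S \<omega> \<in> space ?Smp" unfolding spS by (rule measurable_space[OF S])
    then show ?thesis by (simp only: ex_in_conv[symmetric]) (rule exI)
  qed
  have neD: "space (Adv s) \<noteq> {}" for s
    using erase_in_space[of d n "{}" undefined] by (auto simp: Adv_def)
  have bm: "(\<lambda>s. bind (Adv s) A) \<in> measurable ?Smp (subprob_algebra (vec_space d))"
    by (rule measurable_bind2[OF Advm Am])
  have out: "emeasure (output_law d n \<beta> \<sigma> Adv A) E = (\<integral>\<^sup>+\<omega>. emeasure (A (erase d n (P \<omega>) (S \<omega>))) E \<partial>\<Omega>)"
    if E: "E \<in> sets (vec_space d)" for E
  proof -
    have gm: "(\<lambda>D. emeasure (A D) E) \<in> borel_measurable (data_space d n)"
      by (rule measurable_compose[OF Am measurable_emeasure_subprob_algebra[OF E]])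
    have gmk: "(\<lambda>s. emeasure (A (erase d n k s)) E) \<in> borel_measurable ?M" for k
      by (rule measurable_compose[OF measurable_erase gm])
    have gmk': "(\<lambda>s. emeasure (A (erase d n k s)) E) \<in> borel_measurable ?Smp" for k
      by (rule measurable_compose[OF mm gm])
    have "emeasure (output_law d n \<beta> \<sigma> Adv A) E = (\<integral>\<^sup>+s. emeasure (bind (Adv s) A) E \<partial>?Smp)"
      unfolding output_law_def by (rule emeasure_bind[OF neM bm E])
    also have "\<dots> = (\<integral>\<^sup>+s. (\<integral>\<^sup>+D. emeasure (A D) E \<partial>Adv s) \<partial>?Smp)"
    proof (rule nn_integral_cong)
      fix s
      have "A \<in> measurable (Adv s) (subprob_algebra (vec_space d))"
        using Am by (simp add: Adv_def)
      then show "emeasure (bind (Adv s) A) E = (\<integral>\<^sup>+D. emeasure (A D) E \<partial>Adv s)"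
        by (rule emeasure_bind[OF neD _ E])
    qed
    also have "\<dots> = (\<integral>\<^sup>+s. (\<Sum>k\<in>?K. \<kappa> k s * emeasure (A (erase d n k s)) E) \<partial>?Smp)"
      by (simp only: int[OF gm])
    also have "\<dots> = (\<Sum>k\<in>?K. \<integral>\<^sup>+s. \<kappa> k s * emeasure (A (erase d n k s)) E \<partial>?Smp)"
      by (intro nn_integral_sum borel_measurable_times_ennreal \<kappa>m gmk')
    \<comment> \<open>The defining property of the kernel replaces the average over samples by one
      over \<open>\<Omega>\<close>, with the actual pattern in place of its conditional law.\<close>
    also have "\<dots> = (\<Sum>k\<in>?K. \<integral>\<^sup>+\<omega>. indicator {\<omega> \<in> space \<Omega>. P \<omega> = k} \<omega> * emeasure (A (erase d n k (S \<omega>))) E \<partial>\<Omega>)"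
      unfolding law[symmetric] by (intro sum.cong refl \<kappa>(3) gmk)
    also have "\<dots> = (\<integral>\<^sup>+\<omega>. (\<Sum>k\<in>?K. indicator {\<omega> \<in> space \<Omega>. P \<omega> = k} \<omega> * emeasure (A (erase d n k (S \<omega>))) E) \<partial>\<Omega>)"
      by (intro nn_integral_sum[symmetric] borel_measurable_times_ennreal
          borel_measurable_indicator Pm measurable_compose[OF S gmk])
    also have "\<dots> = (\<integral>\<^sup>+\<omega>. emeasure (A (erase d n (P \<omega>) (S \<omega>))) E \<partial>\<Omega>)"
    proof (rule nn_integral_cong)
      fix \<omega> assume \<omega>: "\<omega> \<in> space \<Omega>"
      have "(\<Sum>k\<in>?K. indicator {\<omega> \<in> space \<Omega>. P \<omega> = k} \<omega> * emeasure (A (erase d n k (S \<omega>))) E)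
        = (\<Sum>k\<in>?K. if k = P \<omega> then emeasure (A (erase d n (P \<omega>) (S \<omega>))) E else 0)"
        using \<omega> by (intro sum.cong) (auto simp: indicator_def)
      then show "(\<Sum>k\<in>?K. indicator {\<omega> \<in> space \<Omega>. P \<omega> = k} \<omega> * emeasure (A (erase d n k (S \<omega>))) E)
        = emeasure (A (erase d n (P \<omega>) (S \<omega>))) E"
        using K P[OF \<omega>] by simp
    qed
    finally show ?thesis .
  qed
  have ae: "AE D in Adv s. is_corruption d n \<eta> s D" for s
  proof -
    \<comment> \<open>The law is carried by finitely many points, each of them a permitted
      corruption.\<close>
    let ?X = "(\<lambda>k. erase d n k s) ` ?K"
    have "?X \<in> sets (data_space d n)"
    proof (rule sets.countable)
      show "countable ?X" by (intro countable_finite finite_imageI K)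
      fix D assume "D \<in> ?X"
      then show "{D} \<in> sets (data_space d n)"
        by (elim imageE) (simp only: singleton_in_data_space erase_in_space)
    qed
    then have X: "space (data_space d n) - ?X \<in> sets (data_space d n)"
      by (rule sets.compl_sets)
    have "emeasure (Adv s) (space (data_space d n) - ?X) = 0"
      using K by (simp add: em[OF X])
    then have "space (data_space d n) - ?X \<in> null_sets (Adv s)"
      using X by (auto simp: Adv_def)
    moreover have "is_corruption d n \<eta> s D" if "D \<in> ?X" for D
      using that is_corruption_erase[OF _ \<eta>] by auto
    ultimately show ?thesis
      by (intro AE_I') (auto simp: Adv_def)
  qed
  show ?thesis
    by (rule that[OF _ out]) (simp add: cw_adversary_def Advm Advp ae spS)
qed

section \<open>Laws of the samples and deletion counts\<close>


lemma measurable_of_component: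
  "i \<in> I \<Longrightarrow> f \<in> measurable N L \<Longrightarrow> (\<lambda>\<omega>. f (\<omega> i)) \<in> measurable (PiM I (\<lambda>_. N)) L"
  by (rule measurable_compose[OF measurable_component_singleton[of i I "\<lambda>_. N"]])

lemma noise_dist:
  assumes "\<sigma> \<ge> 0"
  shows sets_noise_dist: "sets (noise_dist \<sigma>) = sets borel"
    and prob_space_noise_dist: "prob_space (noise_dist \<sigma>)"
  using assms by (auto simp: noise_dist_def intro: prob_space_return prob_space_normal_density)

definition example_of ::
  "nat \<Rightarrow> (nat \<Rightarrow> real) \<Rightarrow> (nat \<Rightarrow> real) \<times> real \<Rightarrow> (nat \<Rightarrow> real) \<times> real" where
  "example_of d \<beta> = (\<lambda>(x, \<xi>). (x, lin d \<beta> x + \<xi>))"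

lemma measurable_example_of [measurable]:
  "example_of d \<beta> \<in> measurable (vec_space d \<Otimes>\<^sub>M borel) (vec_space d \<Otimes>\<^sub>M borel)"
  unfolding example_of_def by measurable

lemma lr_example_eq:
  "lr_example d \<beta> \<sigma> = distr (gauss_vec d \<Otimes>\<^sub>M noise_dist \<sigma>) (vec_space d \<Otimes>\<^sub>M borel) (example_of d \<beta>)"
  by (simp add: lr_example_def example_of_def lin_def)

text \<open>Used with \<open>fst\<close> and with \<open>snd\<close> of a coupling: both resulting
  examples share the noise, so their labels agree as soon as the linear parts do.\<close>

lemma lr_example_coupled:
  assumes \<sigma>: "\<sigma> \<ge> 0" and \<phi>: "\<phi> \<in> measurable M (vec_space d)" and M: "prob_space M"
    and int: "\<And>F. F \<in> borel_measurable (vec_space d) \<Longrightarrow> (\<integral>\<^sup>+p. F (\<phi> p) \<partial>M) = (\<integral>\<^sup>+x. F x \<partial>gauss_vec d)"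
  shows "(\<lambda>q. example_of d \<beta> (\<phi> (fst q), snd q)) \<in> measurable (M \<Otimes>\<^sub>M noise_dist \<sigma>) (vec_space d \<Otimes>\<^sub>M borel)"
    and "distr (M \<Otimes>\<^sub>M noise_dist \<sigma>) (vec_space d \<Otimes>\<^sub>M borel) (\<lambda>q. example_of d \<beta> (\<phi> (fst q), snd q))
      = lr_example d \<beta> \<sigma>"
proof -
  interpret \<nu>: prob_space "noise_dist \<sigma>" by (rule prob_space_noise_dist[OF \<sigma>])
  note [measurable_cong] = sets_noise_dist[OF \<sigma>]
  note [measurable] = \<phi>
  show m [measurable]: "(\<lambda>q. example_of d \<beta> (\<phi> (fst q), snd q)) \<in> measurable (M \<Otimes>\<^sub>M noise_dist \<sigma>) (vec_space d \<Otimes>\<^sub>M borel)"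
    by measurable
  have g [measurable]: "example_of d \<beta> \<in> measurable (gauss_vec d \<Otimes>\<^sub>M noise_dist \<sigma>) (vec_space d \<Otimes>\<^sub>M borel)"
    by measurable
  show "distr (M \<Otimes>\<^sub>M noise_dist \<sigma>) (vec_space d \<Otimes>\<^sub>M borel) (\<lambda>q. example_of d \<beta> (\<phi> (fst q), snd q))
      = lr_example d \<beta> \<sigma>"
  proof (rule measure_eqI)
    show "sets (distr (M \<Otimes>\<^sub>M noise_dist \<sigma>) (vec_space d \<Otimes>\<^sub>M borel) (\<lambda>q. example_of d \<beta> (\<phi> (fst q), snd q)))
      = sets (lr_example d \<beta> \<sigma>)" by (simp add: lr_example_eq)
    fix A assume "A \<in> sets (distr (M \<Otimes>\<^sub>M noise_dist \<sigma>) (vec_space d \<Otimes>\<^sub>M borel) (\<lambda>q. example_of d \<beta> (\<phi> (fst q), snd q)))"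
    then have A [measurable]: "A \<in> sets (vec_space d \<Otimes>\<^sub>M borel)" by simp
    define H where "H x = (\<integral>\<^sup>+\<xi>. indicator A (example_of d \<beta> (x, \<xi>)) \<partial>noise_dist \<sigma>)" for x
    have H: "H \<in> borel_measurable (vec_space d)" unfolding H_def by measurable
    have "emeasure (distr (M \<Otimes>\<^sub>M noise_dist \<sigma>) (vec_space d \<Otimes>\<^sub>M borel) (\<lambda>q. example_of d \<beta> (\<phi> (fst q), snd q))) A
      = (\<integral>\<^sup>+z. indicator A z \<partial>distr (M \<Otimes>\<^sub>M noise_dist \<sigma>) (vec_space d \<Otimes>\<^sub>M borel) (\<lambda>q. example_of d \<beta> (\<phi> (fst q), snd q)))"
      by simp
    also have "\<dots> = (\<integral>\<^sup>+q. indicator A (example_of d \<beta> (\<phi> (fst q), snd q)) \<partial>(M \<Otimes>\<^sub>M noise_dist \<sigma>))"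
      by (rule nn_integral_distr[OF m]) measurable
    also have "\<dots> = (\<integral>\<^sup>+p. H (\<phi> p) \<partial>M)"
      unfolding H_def
      by (subst \<nu>.nn_integral_fst[symmetric, OF measurable_compose[OF m borel_measurable_indicator[OF A]]]) simp
    also have "\<dots> = (\<integral>\<^sup>+x. H x \<partial>gauss_vec d)" by (rule int[OF H])
    also have "\<dots> = (\<integral>\<^sup>+q. indicator A (example_of d \<beta> q) \<partial>(gauss_vec d \<Otimes>\<^sub>M noise_dist \<sigma>))"
      unfolding H_def
      by (subst \<nu>.nn_integral_fst[symmetric, OF measurable_compose[OF g borel_measurable_indicator[OF A]]]) simp
    also have "\<dots> = (\<integral>\<^sup>+z. indicator A z \<partial>lr_example d \<beta> \<sigma>)"
      unfolding lr_example_eq by (rule nn_integral_distr[OF g, symmetric]) measurable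
    also have "\<dots> = emeasure (lr_example d \<beta> \<sigma>) A" using A by (simp add: lr_example_eq)
    finally show "emeasure (distr (M \<Otimes>\<^sub>M noise_dist \<sigma>) (vec_space d \<Otimes>\<^sub>M borel) (\<lambda>q. example_of d \<beta> (\<phi> (fst q), snd q))) A
      = emeasure (lr_example d \<beta> \<sigma>) A" .
  qed
qed

lemma prob_space_lr_example:
  assumes "\<sigma> \<ge> 0"
  shows "prob_space (lr_example d \<beta> \<sigma>)"
proof -
  interpret g: prob_space "gauss_vec d" by (rule prob_space_gauss_vec)
  interpret \<nu>: prob_space "noise_dist \<sigma>" by (rule prob_space_noise_dist[OF assms])
  interpret P: pair_prob_space "gauss_vec d" "noise_dist \<sigma>" ..
  note [measurable_cong] = sets_noise_dist[OF assms]
  show ?thesis unfolding lr_example_eq by (rule P.prob_space_distr) measurable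
qed

lemma sample_space_distr:
  assumes \<sigma>: "\<sigma> \<ge> 0" and N: "prob_space N" and f: "f \<in> measurable N (vec_space d \<Otimes>\<^sub>M borel)"
    and law: "distr N (vec_space d \<Otimes>\<^sub>M borel) f = lr_example d \<beta> \<sigma>"
  shows "compose {..<n} f \<in> measurable (PiM {..<n} (\<lambda>_. N)) (PiM {..<n} (\<lambda>_. vec_space d \<Otimes>\<^sub>M borel))"
    and "distr (PiM {..<n} (\<lambda>_. N)) (PiM {..<n} (\<lambda>_. vec_space d \<Otimes>\<^sub>M borel)) (compose {..<n} f)
      = sample_space d n \<beta> \<sigma>"
proof -
  have s: "sets (lr_example d \<beta> \<sigma>) = sets (vec_space d \<Otimes>\<^sub>M borel)" by (simp add: lr_example_eq)
  show "compose {..<n} f \<in> measurable (PiM {..<n} (\<lambda>_. N)) (PiM {..<n} (\<lambda>_. vec_space d \<Otimes>\<^sub>M borel))"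
    unfolding compose_def
    by (intro measurable_restrict measurable_of_component f)
  have f': "f \<in> measurable N (lr_example d \<beta> \<sigma>)"
    using f s by (simp cong: measurable_cong_sets)
  have "distr (PiM {..<n} (\<lambda>_. N)) (PiM {..<n} (\<lambda>_. vec_space d \<Otimes>\<^sub>M borel)) (compose {..<n} f)
     = distr (PiM {..<n} (\<lambda>_. N)) (PiM {..<n} (\<lambda>_. lr_example d \<beta> \<sigma>)) (compose {..<n} f)"
    by (intro distr_cong refl sets_PiM_cong s[symmetric])
  also have "\<dots> = PiM {..<n} (\<lambda>_. distr N (lr_example d \<beta> \<sigma>) f)"
    by (rule distr_PiM_finite_prob_space') (simp_all add: N prob_space_lr_example[OF \<sigma>] f')
  also have "distr N (lr_example d \<beta> \<sigma>) f = distr N (vec_space d \<Otimes>\<^sub>M borel) f"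
    by (intro distr_cong refl s)
  finally show "distr (PiM {..<n} (\<lambda>_. N)) (PiM {..<n} (\<lambda>_. vec_space d \<Otimes>\<^sub>M borel)) (compose {..<n} f)
      = sample_space d n \<beta> \<sigma>"
    by (simp add: law sample_space_def)
qed

section \<open>A Chernoff bound with relative slack c / 6\<close>

lemma exp_tilt_bound:
  fixes c :: real
  assumes "0 < c" "c < 1"
  shows "(1 - c / 6) * (exp (c / 12) - 1) - c / 12 \<le> - (c\<^sup>2 / 144)"
proof -
  \<comment> \<open>The tilt is half of the slack \<open>c / 6\<close>, so \<open>1 - c / 6\<close>
    becomes \<open>1 - 2 * l\<close>. The quadratic loss in
    \<open>exp l \<le> 1 + l + l\<^sup>2\<close> then uses up only half of the gain
    \<open>2 * l\<^sup>2\<close>; what remains is \<open>l\<^sup>2\<close>, whence 144.\<close>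
  define l where "l = c / 12"
  have l: "0 < l" "l \<le> 1 / 12" using assms by (auto simp: l_def)
  have "exp l \<le> 1 + l + l\<^sup>2" using l by (intro exp_bound) auto
  then have "(1 - 2 * l) * (exp l - 1) \<le> (1 - 2 * l) * (l + l\<^sup>2)"
    using l by (intro mult_left_mono) auto
  also have "\<dots> = l - l\<^sup>2 - 2 * l * l\<^sup>2" by (simp add: power2_eq_square algebra_simps)
  also have "\<dots> \<le> l - l\<^sup>2" using l by simp
  finally have "(1 - 2 * l) * (exp l - 1) - l \<le> - l\<^sup>2" by simp
  then show ?thesis by (simp add: l_def power2_eq_square)
qed

text \<open>Markov's inequality for the exponential of \<open>l\<close> times the count; by
  independence its mean is the \<open>n\<close>-th power of the mean of one factor
  \<open>u\<close>.\<close>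

lemma chernoff_count:
  fixes c \<eta> :: real
  assumes N: "prob_space N" and B: "B \<in> sets N" and p: "emeasure N B \<le> ennreal (\<eta> * (1 - c / 6))"
    and c: "0 < c" "c < 1" and \<eta>: "\<eta> \<ge> 0"
  shows "emeasure (PiM {..<n} (\<lambda>_. N))
      {\<omega> \<in> space (PiM {..<n} (\<lambda>_. N)). real (card {i. i < n \<and> \<omega> i \<in> B}) > \<eta> * real n}
    \<le> ennreal (exp (- (1 / 144) * c\<^sup>2 * \<eta> * real n))"
proof -
  interpret N: prob_space N by fact
  interpret product_sigma_finite "\<lambda>_::nat. N" by standard
  let ?P = "PiM {..<n} (\<lambda>_. N)"
  let ?bad = "{\<omega> \<in> space ?P. real (card {i. i < n \<and> \<omega> i \<in> B}) > \<eta> * real n}"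
  define l where "l = c / 12"
  define q where "q = \<eta> * (1 - c / 6)"
  have l: "l > 0" using c by (simp add: l_def)
  have q: "q \<ge> 0" using c \<eta> by (simp add: q_def)
  define u where "u x = ennreal (if x \<in> B then exp l else 1)" for x
  have um: "u \<in> borel_measurable N" unfolding u_def using B by measurable
  have u1: "(\<integral>\<^sup>+x. u x \<partial>N) \<le> ennreal (exp ((exp l - 1) * q))"
  proof -
    have e: "exp l - 1 \<ge> 0" using l by simp
    have "(\<integral>\<^sup>+x. u x \<partial>N) = (\<integral>\<^sup>+x. 1 + ennreal (exp l - 1) * indicator B x \<partial>N)"
    proof (rule nn_integral_cong)
      fix x
      have "ennreal (1 + (exp l - 1)) = ennreal 1 + ennreal (exp l - 1)"
        using e by (intro ennreal_plus) simp_all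
      then have "ennreal (exp l) = 1 + ennreal (exp l - 1)" by simp
      then show "u x = 1 + ennreal (exp l - 1) * indicator B x"
        by (cases "x \<in> B") (simp_all add: u_def)
    qed
    also have "\<dots> = 1 + ennreal (exp l - 1) * emeasure N B"
      using B by (subst nn_integral_add) (simp_all add: nn_integral_cmult_indicator N.emeasure_space_1)
    also have "\<dots> \<le> ennreal 1 + ennreal (exp l - 1) * ennreal q"
      using p by (intro add_mono mult_left_mono) (simp_all add: q_def)
    also have "\<dots> = ennreal (1 + (exp l - 1) * q)"
      by (subst ennreal_plus) (simp_all only: ennreal_mult[OF e q] zero_le_one mult_nonneg_nonneg[OF e q])
    also have "\<dots> \<le> ennreal (exp ((exp l - 1) * q))"
      by (intro ennreal_leI exp_ge_add_one_self)
    finally show ?thesis .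
  qed
  have prod: "(\<Prod>i<n. u (\<omega> i)) = ennreal (exp (l * real (card {i. i < n \<and> \<omega> i \<in> B})))" for \<omega>
  proof -
    have "(\<Prod>i<n. u (\<omega> i)) = ennreal (\<Prod>i<n. if \<omega> i \<in> B then exp l else 1)"
      unfolding u_def by (rule prod_ennreal) simp
    also have "(\<Prod>i<n. if \<omega> i \<in> B then exp l else 1) = exp l ^ card ({..<n} \<inter> {i. \<omega> i \<in> B})"
      by (simp add: prod.If_cases)
    also have "{..<n} \<inter> {i. \<omega> i \<in> B} = {i. i < n \<and> \<omega> i \<in> B}" by auto
    finally show ?thesis by (simp add: exp_of_nat_mult[symmetric] mult.commute)
  qed
  have pm: "(\<lambda>\<omega>. \<Prod>i<n. u (\<omega> i)) \<in> borel_measurable ?P"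
    by (intro borel_measurable_prod_ennreal measurable_of_component um)
  have "emeasure ?P ?bad \<le> (\<integral>\<^sup>+\<omega>. ennreal (exp (- l * \<eta> * real n)) * (\<Prod>i<n. u (\<omega> i)) \<partial>?P)"
  proof -
    have "?bad \<in> sets ?P"
    proof -
      have "(\<lambda>\<omega>. (\<Sum>i<n. indicator B (\<omega> i)) :: real) \<in> borel_measurable ?P"
        by (intro borel_measurable_sum measurable_of_component borel_measurable_indicator B)
      moreover have "(\<Sum>i<n. indicator B (\<omega> i)) = real (card {i. i < n \<and> \<omega> i \<in> B})" for \<omega>
      proof -
        have "(\<Sum>i<n. indicator B (\<omega> i)) = (\<Sum>i<n. if \<omega> i \<in> B then 1 else (0::real))"
          by (intro sum.cong refl) (simp add: indicator_def)
        also have "\<dots> = real (card ({..<n} \<inter> {i. \<omega> i \<in> B}))" by (simp add: sum.If_cases)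
        also have "{..<n} \<inter> {i. \<omega> i \<in> B} = {i. i < n \<and> \<omega> i \<in> B}" by auto
        finally show ?thesis .
      qed
      ultimately have m: "(\<lambda>\<omega>. real (card {i. i < n \<and> \<omega> i \<in> B})) \<in> borel_measurable ?P"
        by (simp only:)
      show ?thesis by (rule borel_measurable_less[OF measurable_const m]) simp
    qed
    then have "emeasure ?P ?bad = (\<integral>\<^sup>+\<omega>. indicator ?bad \<omega> \<partial>?P)"
      by (rule nn_integral_indicator[symmetric])
    also have "\<dots> \<le> (\<integral>\<^sup>+\<omega>. ennreal (exp (- l * \<eta> * real n)) * (\<Prod>i<n. u (\<omega> i)) \<partial>?P)"
    proof (rule nn_integral_mono)
      fix \<omega> assume "\<omega> \<in> space ?P"
      show "indicator ?bad \<omega> \<le> ennreal (exp (- l * \<eta> * real n)) * (\<Prod>i<n. u (\<omega> i))"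
      proof (cases "\<omega> \<in> ?bad")
        case True
        then have "\<eta> * real n \<le> real (card {i. i < n \<and> \<omega> i \<in> B})" by simp
        then have "l * (\<eta> * real n) \<le> l * real (card {i. i < n \<and> \<omega> i \<in> B})"
          using l by (intro mult_left_mono) simp_all
        then have "0 \<le> - l * \<eta> * real n + l * real (card {i. i < n \<and> \<omega> i \<in> B})" by linarith
        then have "1 \<le> exp (- l * \<eta> * real n + l * real (card {i. i < n \<and> \<omega> i \<in> B}))"
          by (simp only: one_le_exp_iff)
        then have "ennreal 1 \<le> ennreal (exp (- l * \<eta> * real n) * exp (l * real (card {i. i < n \<and> \<omega> i \<in> B})))"
          unfolding exp_add by (rule ennreal_leI)
        then show ?thesis using True by (simp add: prod ennreal_mult)
      qed simp
    qed
    finally show ?thesis .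
  qed
  also have "\<dots> = ennreal (exp (- l * \<eta> * real n)) * (\<Prod>i<n. \<integral>\<^sup>+x. u x \<partial>N)"
    by (subst nn_integral_cmult[OF pm], subst product_nn_integral_prod) (simp_all add: um)
  also have "\<dots> \<le> ennreal (exp (- l * \<eta> * real n)) * (\<Prod>i<n. ennreal (exp ((exp l - 1) * q)))"
    by (intro mult_left_mono prod_mono_ennreal u1) simp
  also have "\<dots> = ennreal (exp (- l * \<eta> * real n) * exp ((exp l - 1) * q) ^ n)"
    by (simp add: ennreal_mult ennreal_power)
  also have "\<dots> \<le> ennreal (exp (- (1 / 144) * c\<^sup>2 * \<eta> * real n))"
  proof (rule ennreal_leI)
    have "exp (- l * \<eta> * real n) * exp ((exp l - 1) * q) ^ n
        = exp (- l * \<eta> * real n + real n * ((exp l - 1) * q))"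
      by (simp only: exp_add exp_of_nat_mult)
    also have "\<dots> \<le> exp (- (1 / 144) * c\<^sup>2 * \<eta> * real n)"
    proof (rule exp_le_cancel_iff[THEN iffD2])
      have "((1 - c / 6) * (exp (c / 12) - 1) - c / 12) * (\<eta> * real n) \<le> - (c\<^sup>2 / 144) * (\<eta> * real n)"
        using \<eta> by (intro mult_right_mono exp_tilt_bound[OF c]) simp
      then show "- l * \<eta> * real n + real n * ((exp l - 1) * q) \<le> - (1 / 144) * c\<^sup>2 * \<eta> * real n"
        by (simp add: l_def q_def algebra_simps)
    qed
    finally show "exp (- l * \<eta> * real n) * exp ((exp l - 1) * q) ^ n
        \<le> exp (- (1 / 144) * c\<^sup>2 * \<eta> * real n)" .
  qed
  finally show ?thesis .
qed

section \<open>The two-point argument\<close>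


text \<open>Both adversaries aim to erase exactly the entries in which the coupled vectors differ.
  Within the budget the algorithm then receives the same data under \<open>\<beta>\<close> and
  \<open>\<beta>'\<close>, and since \<open>E\<close> and \<open>E'\<close> cover the output space,
  the two probabilities add up to at least 1. Each adversary sees its own sample only and draws the
  pattern from the conditional law.\<close>

lemma coupled_adversaries:
  fixes c \<eta> \<sigma> :: real
  assumes \<sigma>: "\<sigma> \<ge> 0" and \<eta>: "\<eta> \<ge> 0" and c: "0 < c" "c < 1"
    and M: "gauss_coupling d M" and eq: "AE p in M. lin d \<beta> (fst p) = lin d \<beta>' (snd p)"
    and p: "\<And>j. j < d \<Longrightarrow> emeasure M {p \<in> space M. fst p j \<noteq> snd p j} \<le> ennreal (\<eta> * (1 - c / 6))"
    and alg: "randomized_alg d n A"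
    and E: "E \<in> sets (vec_space d)" "E' \<in> sets (vec_space d)" "E \<union> E' = space (vec_space d)"
  obtains Adv Adv' where "cw_adversary d n \<eta> \<beta> \<sigma> Adv" "cw_adversary d n \<eta> \<beta>' \<sigma> Adv'"
    "emeasure (output_law d n \<beta> \<sigma> Adv A) E \<le> 1" "emeasure (output_law d n \<beta>' \<sigma> Adv' A) E' \<le> 1"
    "1 \<le> emeasure (output_law d n \<beta> \<sigma> Adv A) E + emeasure (output_law d n \<beta>' \<sigma> Adv' A) E'
       + ennreal (real d * exp (- (1 / 144) * c\<^sup>2 * \<eta> * real n))"
proof -
  interpret M: prob_space M by (rule gauss_coupling_prob[OF M])
  interpret \<nu>: prob_space "noise_dist \<sigma>" by (rule prob_space_noise_dist[OF \<sigma>])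
  interpret MN: pair_prob_space M "noise_dist \<sigma>" ..
  define N where "N = M \<Otimes>\<^sub>M noise_dist \<sigma>"
  interpret N: prob_space N unfolding N_def by (rule MN.prob_space_axioms)
  define \<Omega> where "\<Omega> = PiM {..<n} (\<lambda>_. N)"
  interpret \<Omega>: prob_space \<Omega> unfolding \<Omega>_def by (intro prob_space_PiM N.prob_space_axioms)
  note sM = gauss_coupling_sets[OF M]
  have fstm: "fst \<in> measurable M (vec_space d)" and sndm: "snd \<in> measurable M (vec_space d)"
    using sM by (simp_all cong: measurable_cong_sets)
  define f where "f = (\<lambda>q :: ((nat \<Rightarrow> real) \<times> (nat \<Rightarrow> real)) \<times> real. example_of d \<beta> (fst (fst q), snd q))"
  define f' where "f' = (\<lambda>q :: ((nat \<Rightarrow> real) \<times> (nat \<Rightarrow> real)) \<times> real. example_of d \<beta>' (snd (fst q), snd q))"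
  have law: "f \<in> measurable N (vec_space d \<Otimes>\<^sub>M borel)"
    "distr N (vec_space d \<Otimes>\<^sub>M borel) f = lr_example d \<beta> \<sigma>"
    unfolding f_def N_def
    by (rule lr_example_coupled[OF \<sigma> fstm M.prob_space_axioms], rule gauss_coupling_fst[OF M], assumption)+
  have law': "f' \<in> measurable N (vec_space d \<Otimes>\<^sub>M borel)"
    "distr N (vec_space d \<Otimes>\<^sub>M borel) f' = lr_example d \<beta>' \<sigma>"
    unfolding f'_def N_def
    by (rule lr_example_coupled[OF \<sigma> sndm M.prob_space_axioms], rule gauss_coupling_snd[OF M], assumption)+
  define S where "S = compose {..<n} f"
  define S' where "S' = compose {..<n} f'"
  note S = sample_space_distr[OF \<sigma> N.prob_space_axioms law, where n = n, folded S_def \<Omega>_def]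
  note S' = sample_space_distr[OF \<sigma> N.prob_space_axioms law', where n = n, folded S'_def \<Omega>_def]

  define B where "B j = {p \<in> space M. fst p j \<noteq> snd p j} \<times> space (noise_dist \<sigma>)" for j
  have B: "B j \<in> sets N" and Bp: "emeasure N (B j) \<le> ennreal (\<eta> * (1 - c / 6))" if j: "j < d" for j
  proof -
    have C: "{p \<in> space M. fst p j \<noteq> snd p j} \<in> sets M"
      using pred_neq_coordinate[OF j] sM sets_eq_imp_space_eq[OF sM] by simp
    show "B j \<in> sets N" unfolding B_def N_def by (intro pair_measureI C sets.top)
    have "emeasure N (B j) = emeasure M {p \<in> space M. fst p j \<noteq> snd p j} * 1"
      unfolding B_def N_def \<nu>.emeasure_space_1[symmetric] by (intro \<nu>.emeasure_pair_measure_Times C sets.top)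
    then show "emeasure N (B j) \<le> ennreal (\<eta> * (1 - c / 6))" using p[OF j] by simp
  qed

  define raw where "raw \<omega> = {(i, j). i < n \<and> j < d \<and> \<omega> i \<in> B j}" for \<omega>
  have raw_sub: "raw \<omega> \<in> Pow ({..<n} \<times> {..<d})" for \<omega> by (simp add: raw_def subset_iff)
  have raw_eq: "{\<omega> \<in> space \<Omega>. raw \<omega> = k} \<in> sets \<Omega>" if k: "k \<in> Pow ({..<n} \<times> {..<d})" for k
  proof -
    have "{\<omega> \<in> space \<Omega>. (\<omega> (fst ij) \<in> B (snd ij)) = (ij \<in> k)} \<in> sets \<Omega>"
      if ij: "ij \<in> {..<n} \<times> {..<d}" for ij
    proof -
      have i: "fst ij \<in> {..<n}" and j: "snd ij < d" using ij by (simp_all add: mem_Times_iff)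
      have "(\<lambda>\<omega>. \<omega> (fst ij)) \<in> measurable \<Omega> N"
        unfolding \<Omega>_def by (rule measurable_component_singleton[OF i])
      from measurable_sets[OF this B[OF j]]
      have 1: "{\<omega> \<in> space \<Omega>. \<omega> (fst ij) \<in> B (snd ij)} \<in> sets \<Omega>"
        by (simp add: vimage_def Int_def conj_commute)
      show ?thesis
      proof (cases "ij \<in> k")
        case True
        then show ?thesis using 1 by simp
      next
        case False
        then show ?thesis using sets.sets_Collect_neg[OF 1] by simp
      qed
    qed
    then have "{\<omega> \<in> space \<Omega>. \<forall>ij\<in>{..<n} \<times> {..<d}. (\<omega> (fst ij) \<in> B (snd ij)) = (ij \<in> k)} \<in> sets \<Omega>"
      by (rule sets.sets_Collect_finite_All) (assumption, intro finite_cartesian_product finite_lessThan)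
    moreover have "raw \<omega> = k \<longleftrightarrow> (\<forall>ij\<in>{..<n} \<times> {..<d}. (\<omega> (fst ij) \<in> B (snd ij)) = (ij \<in> k))" for \<omega>
      using k unfolding raw_def by fastforce
    ultimately show ?thesis by simp
  qed
  have finP: "finite (Pow ({..<n} \<times> {..<d}))"
    by (intro finite_Pow_iff[THEN iffD2] finite_cartesian_product finite_lessThan)
  \<comment> \<open>Only finitely many patterns occur, so every predicate of the pattern defines an
    event.\<close>
  have raw_pred: "{\<omega> \<in> space \<Omega>. Q (raw \<omega>)} \<in> sets \<Omega>" for Q
  proof -
    have "(\<Union>k\<in>{k \<in> Pow ({..<n} \<times> {..<d}). Q k}. {\<omega> \<in> space \<Omega>. raw \<omega> = k}) \<in> sets \<Omega>"
      by (intro sets.finite_UN raw_eq finite_subset[OF _ finP]) (simp_all only: mem_Collect_eq Collect_subset)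
    also have "(\<Union>k\<in>{k \<in> Pow ({..<n} \<times> {..<d}). Q k}. {\<omega> \<in> space \<Omega>. raw \<omega> = k}) = {\<omega> \<in> space \<Omega>. Q (raw \<omega>)}"
      using raw_sub by blast
    finally show ?thesis .
  qed

  let ?K = "patterns d n \<eta>"
  \<comment> \<open>Outside the budget nothing is erased. Any admissible pattern could be the
    default, since only the event \<open>?G\<close> contributes to the lower bound.\<close>
  define P where "P \<omega> = (if raw \<omega> \<in> ?K then raw \<omega> else {})" for \<omega>
  have PK: "P \<omega> \<in> ?K" for \<omega> using empty_in_patterns[OF \<eta>] by (simp add: P_def)
  have Pm: "{\<omega> \<in> space \<Omega>. P \<omega> = k} \<in> sets \<Omega>" for k
    unfolding P_def by (rule raw_pred)
  have PC: "P \<in> measurable \<Omega> (count_space ?K)"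
  proof -
    have "P -` {k} \<inter> space \<Omega> \<in> sets \<Omega>" for k
      using Pm[of k] by (simp add: vimage_def Int_def conj_commute)
    then show ?thesis using PK by (simp add: measurable_count_space_eq2[OF finite_patterns])
  qed
  obtain Adv where Adv: "cw_adversary d n \<eta> \<beta> \<sigma> Adv"
    "\<And>E. E \<in> sets (vec_space d) \<Longrightarrow>
      emeasure (output_law d n \<beta> \<sigma> Adv A) E = (\<integral>\<^sup>+\<omega>. emeasure (A (erase d n (P \<omega>) (S \<omega>))) E \<partial>\<Omega>)"
    by (rule pattern_adversary[OF \<Omega>.prob_space_axioms \<eta> S PK Pm alg]) (rule that, assumption, blast)
  obtain Adv' where Adv': "cw_adversary d n \<eta> \<beta>' \<sigma> Adv'"
    "\<And>E. E \<in> sets (vec_space d) \<Longrightarrow>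
      emeasure (output_law d n \<beta>' \<sigma> Adv' A) E = (\<integral>\<^sup>+\<omega>. emeasure (A (erase d n (P \<omega>) (S' \<omega>))) E \<partial>\<Omega>)"
    by (rule pattern_adversary[OF \<Omega>.prob_space_axioms \<eta> S' PK Pm alg]) (rule that, assumption, blast)

  have Am: "A \<in> measurable (data_space d n) (subprob_algebra (vec_space d))"
    and Ap: "\<And>D. D \<in> space (data_space d n) \<Longrightarrow> prob_space (A D)"
    using alg by (simp_all add: randomized_alg_def)
  have As: "sets (A D) = sets (vec_space d)" if "D \<in> space (data_space d n)" for D
    using sets_kernel[OF Am that] .
  have le1: "emeasure (A (erase d n k s)) X \<le> 1" for k s X
    by (rule prob_space.emeasure_le_1[OF Ap[OF erase_in_space]])
  have int1: "(\<integral>\<^sup>+\<omega>. emeasure (A (erase d n (P \<omega>) (T \<omega>))) X \<partial>\<Omega>) \<le> 1" for T X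
  proof -
    have "(\<integral>\<^sup>+\<omega>. emeasure (A (erase d n (P \<omega>) (T \<omega>))) X \<partial>\<Omega>) \<le> (\<integral>\<^sup>+\<omega>. 1 \<partial>\<Omega>)"
      by (intro nn_integral_mono le1)
    then show ?thesis by (simp add: \<Omega>.emeasure_space_1)
  qed
  have meas: "(\<lambda>\<omega>. emeasure (A (erase d n (P \<omega>) (T \<omega>))) X) \<in> borel_measurable \<Omega>"
    if T: "T \<in> measurable \<Omega> (PiM {..<n} (\<lambda>_. vec_space d \<Otimes>\<^sub>M borel))" and X: "X \<in> sets (vec_space d)" for T X
  proof -
    have "(\<lambda>\<omega>. erase d n (P \<omega>) (T \<omega>)) \<in> measurable \<Omega> (data_space d n)"
      by (rule measurable_compose_countable'[OF measurable_compose[OF T measurable_erase] PC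
            countable_finite[OF finite_patterns]])
    then show ?thesis
      by (rule measurable_compose[OF _ measurable_compose[OF Am measurable_emeasure_subprob_algebra[OF X]]])
  qed

  let ?G = "{\<omega> \<in> space \<Omega>. raw \<omega> \<in> ?K}"
  have G: "?G \<in> sets \<Omega>" by (rule raw_pred)
  have aeN: "AE q in N. lin d \<beta> (fst (fst q)) = lin d \<beta>' (snd (fst q))"
  proof -
    have 1: "distr N M fst = M" unfolding N_def by (rule \<nu>.distr_pair_fst)
    have 2: "fst \<in> measurable N M" unfolding N_def by simp
    show ?thesis
      using AE_distrD[OF 2, of "\<lambda>p. lin d \<beta> (fst p) = lin d \<beta>' (snd p)"] eq unfolding 1 by blast
  qed
  have "AE \<omega> in \<Omega>. lin d \<beta> (fst (fst (\<omega> i))) = lin d \<beta>' (snd (fst (\<omega> i)))" if "i \<in> {..<n}" for i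
    unfolding \<Omega>_def
    by (rule AE_PiM_component[where P = "\<lambda>q. lin d \<beta> (fst (fst q)) = lin d \<beta>' (snd (fst q))",
          OF N.prob_space_axioms that aeN])
  then have aeq: "AE \<omega> in \<Omega>. \<forall>i\<in>{..<n}. lin d \<beta> (fst (fst (\<omega> i))) = lin d \<beta>' (snd (fst (\<omega> i)))"
    by (intro AE_finite_allI) simp_all
  \<comment> \<open>Entries that remain agree by the choice of \<open>B\<close>, labels by the
    equality of the linear parts and the common noise.\<close>
  have same: "erase d n (raw \<omega>) (S \<omega>) = erase d n (raw \<omega>) (S' \<omega>)"
    if \<omega>: "\<omega> \<in> space \<Omega>" and l: "\<forall>i\<in>{..<n}. lin d \<beta> (fst (fst (\<omega> i))) = lin d \<beta>' (snd (fst (\<omega> i)))" for \<omega>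
    unfolding erase_def
  proof (rule restrict_ext)
    fix i assume i: "i \<in> {..<n}"
    have "\<omega> i \<in> space N" using \<omega> i by (simp add: \<Omega>_def space_PiM PiE_iff)
    then have sp: "fst (\<omega> i) \<in> space M" "snd (\<omega> i) \<in> space (noise_dist \<sigma>)"
      by (simp_all add: N_def space_pair_measure mem_Times_iff)
    have Si: "S \<omega> i = f (\<omega> i)" "S' \<omega> i = f' (\<omega> i)" using i by (simp_all add: S_def S'_def compose_def)
    have "(\<lambda>j\<in>{..<d}. if (i, j) \<in> raw \<omega> then None else Some (fst (S \<omega> i) j))
        = (\<lambda>j\<in>{..<d}. if (i, j) \<in> raw \<omega> then None else Some (fst (S' \<omega> i) j))"
    proof (rule restrict_ext)
      fix j assume "j \<in> {..<d}"
      then show "(if (i, j) \<in> raw \<omega> then None else Some (fst (S \<omega> i) j))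
        = (if (i, j) \<in> raw \<omega> then None else Some (fst (S' \<omega> i) j))"
        using i sp by (simp add: Si f_def f'_def example_of_def raw_def B_def mem_Times_iff)
    qed
    moreover have "snd (S \<omega> i) = snd (S' \<omega> i)"
      using l i by (simp add: Si f_def f'_def example_of_def)
    ultimately show "((\<lambda>j\<in>{..<d}. if (i, j) \<in> raw \<omega> then None else Some (fst (S \<omega> i) j)), Some (snd (S \<omega> i)))
      = ((\<lambda>j\<in>{..<d}. if (i, j) \<in> raw \<omega> then None else Some (fst (S' \<omega> i) j)), Some (snd (S' \<omega> i)))"
      by simp
  qed

  have "emeasure \<Omega> ?G = (\<integral>\<^sup>+\<omega>. indicator ?G \<omega> \<partial>\<Omega>)" by (rule nn_integral_indicator[OF G, symmetric])
  also have "\<dots> \<le> (\<integral>\<^sup>+\<omega>. emeasure (A (erase d n (P \<omega>) (S \<omega>))) E + emeasure (A (erase d n (P \<omega>) (S' \<omega>))) E' \<partial>\<Omega>)"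
  proof (rule nn_integral_mono_AE)
    show "AE \<omega> in \<Omega>. indicator ?G \<omega> \<le> emeasure (A (erase d n (P \<omega>) (S \<omega>))) E + emeasure (A (erase d n (P \<omega>) (S' \<omega>))) E'"
      using aeq AE_space
    proof eventually_elim
      case (elim \<omega>)
      show ?case
      proof (cases "\<omega> \<in> ?G")
        case True
        let ?D = "erase d n (raw \<omega>) (S \<omega>)"
        have D: "erase d n (P \<omega>) (S \<omega>) = ?D" "erase d n (P \<omega>) (S' \<omega>) = ?D"
          using True same[OF elim(2,1)] by (simp_all add: P_def)
        interpret AD: prob_space "A ?D" by (rule Ap[OF erase_in_space])
        have sA: "sets (A ?D) = sets (vec_space d)" by (rule As[OF erase_in_space])
        have "1 = emeasure (A ?D) (E \<union> E')"
          using AD.emeasure_space_1 sets_eq_imp_space_eq[OF sA] E(3) by simp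
        also have "\<dots> \<le> emeasure (A ?D) E + emeasure (A ?D) E'"
          using E sA by (intro emeasure_subadditive) simp_all
        finally show ?thesis using True by (simp add: D)
      qed simp
    qed
  qed
  also have "\<dots> = emeasure (output_law d n \<beta> \<sigma> Adv A) E + emeasure (output_law d n \<beta>' \<sigma> Adv' A) E'"
    unfolding Adv(2)[OF E(1)] Adv'(2)[OF E(2)]
    by (rule nn_integral_add[OF meas[OF S(1) E(1)] meas[OF S'(1) E(2)]])
  finally have good: "emeasure \<Omega> ?G \<le>
    emeasure (output_law d n \<beta> \<sigma> Adv A) E + emeasure (output_law d n \<beta>' \<sigma> Adv' A) E'" .

  define bad where "bad j = {\<omega> \<in> space \<Omega>. real (card {i. i < n \<and> \<omega> i \<in> B j}) > \<eta> * real n}" for j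
  let ?e = "exp (- (1 / 144) * c\<^sup>2 * \<eta> * real n)"
  have badp: "emeasure \<Omega> (bad j) \<le> ennreal ?e" if "j < d" for j
    unfolding bad_def \<Omega>_def by (rule chernoff_count[OF N.prob_space_axioms B[OF that] Bp[OF that] c \<eta>])
  have badm: "bad j \<in> sets \<Omega>" if j: "j < d" for j
  proof -
    have "{i. i < n \<and> \<omega> i \<in> B j} = {i. (i, j) \<in> raw \<omega>}" for \<omega> using j by (simp add: raw_def)
    then show ?thesis
      unfolding bad_def using raw_pred[of "\<lambda>k. \<eta> * real n < real (card {i. (i, j) \<in> k})"]
      by (simp only:)
  qed
  \<comment> \<open>A pattern fails only by exceeding the budget in some column.\<close>
  have "space \<Omega> - ?G \<subseteq> (\<Union>j<d. bad j)"
  proof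
    fix \<omega> assume "\<omega> \<in> space \<Omega> - ?G"
    then have "\<omega> \<in> space \<Omega>" "raw \<omega> \<notin> ?K" by simp_all
    then obtain j where j: "j < d" "\<not> real (card {i. i < n \<and> (i, j) \<in> raw \<omega>}) \<le> \<eta> * real n"
      using raw_sub[of \<omega>] by (auto simp: patterns_def)
    moreover have "{i. i < n \<and> (i, j) \<in> raw \<omega>} = {i. i < n \<and> \<omega> i \<in> B j}"
      using j(1) by (auto simp: raw_def)
    ultimately have "\<omega> \<in> bad j" using \<open>\<omega> \<in> space \<Omega>\<close> by (simp add: bad_def)
    then show "\<omega> \<in> (\<Union>j<d. bad j)" using j(1) by blast
  qed
  then have "emeasure \<Omega> (space \<Omega> - ?G) \<le> emeasure \<Omega> (\<Union>j<d. bad j)"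
    by (rule emeasure_mono) (intro sets.finite_UN badm, simp_all)
  also have "\<dots> \<le> (\<Sum>j<d. emeasure \<Omega> (bad j))"
    by (rule emeasure_subadditive_finite) (simp_all add: badm image_subset_iff)
  also have "\<dots> \<le> (\<Sum>j<d. ennreal ?e)" by (intro sum_mono badp) simp
  also have "\<dots> = ennreal (real d * ?e)"
    by (simp add: ennreal_mult ennreal_of_nat_eq_real_of_nat)
  finally have bad: "emeasure \<Omega> (space \<Omega> - ?G) \<le> ennreal (real d * ?e)" .
  have "1 = emeasure \<Omega> ?G + emeasure \<Omega> (space \<Omega> - ?G)"
    using plus_emeasure[OF G sets.compl_sets[OF G]] sets.sets_into_space[OF G] \<Omega>.emeasure_space_1
    by (simp add: Un_absorb1)
  also have "\<dots> \<le> emeasure (output_law d n \<beta> \<sigma> Adv A) E + emeasure (output_law d n \<beta>' \<sigma> Adv' A) E'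
       + ennreal (real d * ?e)"
    by (intro add_mono good bad)
  finally have total: "1 \<le> emeasure (output_law d n \<beta> \<sigma> Adv A) E + emeasure (output_law d n \<beta>' \<sigma> Adv' A) E'
       + ennreal (real d * ?e)" .
  show ?thesis
    by (rule that[OF Adv(1) Adv'(1) _ _ total]) (simp_all only: Adv(2)[OF E(1)] Adv'(2)[OF E(2)] int1)
qed

lemma vnorm_triangle:
  "vnorm d (\<lambda>j. \<beta> j - \<beta>' j) \<le> vnorm d (\<lambda>j. v j - \<beta> j) + vnorm d (\<lambda>j. v j - \<beta>' j)"
proof -
  have L: "vnorm d x = L2_set x {..<d}" for x by (simp add: vnorm_def L2_set_def)
  have "vnorm d (\<lambda>j. \<beta> j - \<beta>' j) = L2_set (\<lambda>j. (\<beta> j - v j) + (v j - \<beta>' j)) {..<d}" by (simp add: L)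
  also have "\<dots> \<le> L2_set (\<lambda>j. \<beta> j - v j) {..<d} + L2_set (\<lambda>j. v j - \<beta>' j) {..<d}"
    by (rule L2_set_triangle_ineq)
  also have "L2_set (\<lambda>j. \<beta> j - v j) {..<d} = vnorm d (\<lambda>j. v j - \<beta> j)"
    by (simp add: L L2_set_def power2_commute)
  finally show ?thesis by (simp add: L)
qed

lemma sets_far:
  "{v \<in> space (vec_space d). t \<le> vnorm d (\<lambda>j. v j - \<beta> j)} \<in> sets (vec_space d)"
proof -
  have "(\<lambda>v. \<Sum>j<d. (v j - \<beta> j)\<^sup>2) \<in> borel_measurable (vec_space d)"
    by (intro borel_measurable_sum borel_measurable_power borel_measurable_diff
        borel_measurable_const measurable_component_vec) simp
  then have m: "(\<lambda>v. vnorm d (\<lambda>j. v j - \<beta> j)) \<in> borel_measurable (vec_space d)"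
    unfolding vnorm_def by measurable
  show ?thesis by (rule borel_measurable_le[OF measurable_const m]) simp
qed

lemma half_le_one_of_two:
  fixes x y z z' :: real
  assumes "1 \<le> x + y + z'" "z' \<le> z"
  shows "1 / 2 * (1 - z) \<le> x \<or> 1 / 2 * (1 - z) \<le> y"
proof -
  have "1 / 2 * (1 - z) = 1 / 2 - z / 2" by (simp add: diff_divide_distrib)
  moreover have "1 / 2 - z / 2 \<le> x \<or> 1 / 2 - z / 2 \<le> y" using assms by argo
  ultimately show ?thesis by metis
qed

theorem theorem1:
  shows "\<exists>C > (0::real). \<exists>\<kappa> > (0::real).
    \<forall>d::nat. d \<ge> 1 \<longrightarrow>
    (\<forall>c::real. 0 < c \<and> c < 1 \<longrightarrow>
    (\<forall>\<sigma>::real. \<sigma> \<ge> 0 \<longrightarrow>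
    (\<forall>\<eta>::real. (2 + c) / real d \<le> \<eta> \<and> \<eta> \<le> 4 / sqrt (real d) \<longrightarrow>
    (\<forall>b::real. b \<ge> 0 \<longrightarrow>
    (\<forall>n::nat. \<forall>A :: real \<Rightarrow> real \<Rightarrow> real \<Rightarrow> (nat \<Rightarrow> (nat \<Rightarrow> real option) \<times> real option) \<Rightarrow> (nat \<Rightarrow> real) measure.
       randomized_alg d n (A \<eta> \<sigma> b) \<longrightarrow>
       (\<exists>\<beta> :: nat \<Rightarrow> real. vnorm d \<beta> = b \<and>
          (\<exists>Adv. cw_adversary d n \<eta> \<beta> \<sigma> Adv \<and>
             measure (output_law d n \<beta> \<sigma> Adv (A \<eta> \<sigma> b))
               {v \<in> space (vec_space d).
                  vnorm d (\<lambda>j. v j - \<beta> j) \<ge> \<eta> * (c * sqrt (real d) / C) * vnorm d \<beta>}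
             \<ge> 1/2 * (1 - (real d + 1) * exp (- \<kappa> * c\<^sup>2 * \<eta> * real n)))))))))"
\<comment> \<open>100 makes the chord short enough for rejections to fit beside the Chernoff slack;
  1 / 144 comes from the square of the tilt \<open>c / 12\<close>.\<close>
proof (rule exI[of _ 100], intro conjI, simp, rule exI[of _ "1 / 144"], intro conjI allI impI, simp)
  fix d :: nat and c \<sigma> \<eta> b :: real and n :: nat
    and A :: "real \<Rightarrow> real \<Rightarrow> real \<Rightarrow> (nat \<Rightarrow> (nat \<Rightarrow> real option) \<times> real option) \<Rightarrow> (nat \<Rightarrow> real) measure"
  assume d: "1 \<le> d" and c: "0 < c \<and> c < 1" and \<sigma>: "0 \<le> \<sigma>"
    and \<eta>: "(2 + c) / real d \<le> \<eta> \<and> \<eta> \<le> 4 / sqrt (real d)" and b: "0 \<le> b"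
    and alg: "randomized_alg d n (A \<eta> \<sigma> b)"
  have \<eta>0: "\<eta> \<ge> 0"
  proof -
    have "0 \<le> (2 + c) / real d" using c by simp
    then show ?thesis using \<eta> by linarith
  qed
  obtain \<beta> \<beta>' M where n1: "vnorm d \<beta> = b" and n2: "vnorm d \<beta>' = b"
    and far: "2 * (\<eta> * (c * sqrt (real d) / 100) * b) \<le> vnorm d (\<lambda>j. \<beta> j - \<beta>' j)"
    and M: "gauss_coupling d M" "AE p in M. lin d \<beta> (fst p) = lin d \<beta>' (snd p)"
      "\<forall>j<d. emeasure M {p \<in> space M. fst p j \<noteq> snd p j} \<le> ennreal (\<eta> * (1 - c / 6))"
    using indistinguishable_regressors[OF d conjunct1[OF c] conjunct2[OF c] conjunct1[OF \<eta>] conjunct2[OF \<eta>] b] .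
  \<comment> \<open>At most half the distance of the two regressors, so no \<open>v\<close> is
    closer than \<open>t\<close> to both and the two far regions cover the space.\<close>
  define t where "t = \<eta> * (c * sqrt (real d) / 100) * b"
  define E where "E \<beta> = {v \<in> space (vec_space d). t \<le> vnorm d (\<lambda>j. v j - \<beta> j)}" for \<beta>
  have Es: "E \<beta> \<in> sets (vec_space d)" for \<beta>
    unfolding E_def by (rule sets_far)
  have EU: "E \<beta> \<union> E \<beta>' = space (vec_space d)"
  proof -
    have "t \<le> vnorm d (\<lambda>j. v j - \<beta> j) \<or> t \<le> vnorm d (\<lambda>j. v j - \<beta>' j)" for v
      using vnorm_triangle[of d \<beta> \<beta>' v] far unfolding t_def[symmetric] by linarith
    then show ?thesis unfolding E_def by blast
  qed
  let ?x = "exp (- (1 / 144) * c\<^sup>2 * \<eta> * real n)"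
  obtain Adv Adv' where Adv: "cw_adversary d n \<eta> \<beta> \<sigma> Adv" and Adv': "cw_adversary d n \<eta> \<beta>' \<sigma> Adv'"
    and le: "emeasure (output_law d n \<beta> \<sigma> Adv (A \<eta> \<sigma> b)) (E \<beta>) \<le> 1"
    and le': "emeasure (output_law d n \<beta>' \<sigma> Adv' (A \<eta> \<sigma> b)) (E \<beta>') \<le> 1"
    and total: "1 \<le> emeasure (output_law d n \<beta> \<sigma> Adv (A \<eta> \<sigma> b)) (E \<beta>)
        + emeasure (output_law d n \<beta>' \<sigma> Adv' (A \<eta> \<sigma> b)) (E \<beta>') + ennreal (real d * ?x)"
    by (rule coupled_adversaries[OF \<sigma> \<eta>0 conjunct1[OF c] conjunct2[OF c] M(1,2) M(3)[rule_format] alg Es Es EU])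
  define m where "m = measure (output_law d n \<beta> \<sigma> Adv (A \<eta> \<sigma> b)) (E \<beta>)"
  define m' where "m' = measure (output_law d n \<beta>' \<sigma> Adv' (A \<eta> \<sigma> b)) (E \<beta>')"
  have fin: "emeasure (output_law d n \<beta> \<sigma> Adv (A \<eta> \<sigma> b)) (E \<beta>) = ennreal m"
    "emeasure (output_law d n \<beta>' \<sigma> Adv' (A \<eta> \<sigma> b)) (E \<beta>') = ennreal m'"
    unfolding m_def m'_def
    by (rule emeasure_eq_ennreal_measure[OF neq_top_trans[OF ennreal_one_neq_top le]],
        rule emeasure_eq_ennreal_measure[OF neq_top_trans[OF ennreal_one_neq_top le']])
  have "m \<ge> 0" "m' \<ge> 0" by (simp_all add: m_def m'_def)
  then have "ennreal 1 \<le> ennreal (m + m' + real d * ?x)"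
    using total unfolding fin by simp
  then have "1 \<le> m + m' + real d * ?x"
    using \<open>m \<ge> 0\<close> \<open>m' \<ge> 0\<close> by (subst (asm) ennreal_le_iff) simp_all
  \<comment> \<open>Labels are never erased, so the union bound runs over \<open>d\<close> columns;
    the factor d + 1 leaves room for one more.\<close>
  moreover have "(real d + 1) * ?x \<ge> real d * ?x" by (simp add: distrib_right)
  ultimately have half: "1 / 2 * (1 - (real d + 1) * ?x) \<le> m \<or> 1 / 2 * (1 - (real d + 1) * ?x) \<le> m'"
    by (rule half_le_one_of_two)
  have m_eq: "m = measure (output_law d n \<beta> \<sigma> Adv (A \<eta> \<sigma> b))
      {v \<in> space (vec_space d). \<eta> * (c * sqrt (real d) / 100) * vnorm d \<beta> \<le> vnorm d (\<lambda>j. v j - \<beta> j)}"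
    by (simp only: m_def E_def t_def n1)
  have m'_eq: "m' = measure (output_law d n \<beta>' \<sigma> Adv' (A \<eta> \<sigma> b))
      {v \<in> space (vec_space d). \<eta> * (c * sqrt (real d) / 100) * vnorm d \<beta>' \<le> vnorm d (\<lambda>j. v j - \<beta>' j)}"
    by (simp only: m'_def E_def t_def n2)
  from half show "\<exists>\<beta>. vnorm d \<beta> = b \<and> (\<exists>Adv. cw_adversary d n \<eta> \<beta> \<sigma> Adv \<and>
      1 / 2 * (1 - (real d + 1) * ?x) \<le> measure (output_law d n \<beta> \<sigma> Adv (A \<eta> \<sigma> b))
        {v \<in> space (vec_space d). \<eta> * (c * sqrt (real d) / 100) * vnorm d \<beta> \<le> vnorm d (\<lambda>j. v j - \<beta> j)})"
  proof
    assume h: "1 / 2 * (1 - (real d + 1) * ?x) \<le> m"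
    show ?thesis
      by (rule exI[of _ \<beta>], rule conjI[OF n1], rule exI[of _ Adv], rule conjI[OF Adv], rule h[unfolded m_eq])
  next
    assume h: "1 / 2 * (1 - (real d + 1) * ?x) \<le> m'"
    show ?thesis
      by (rule exI[of _ \<beta>'], rule conjI[OF n2], rule exI[of _ Adv'], rule conjI[OF Adv'], rule h[unfolded m'_eq])
  qed
qed

end
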